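(* Let $\mathbb{A}$ be a finite signature of constructors, and let $f$ be a function defined by general ramified simultaneous recurrence, i.e. $f\in\mathrm{SimRec}(\mathbb{A})$ and $f\rhd\mathbb{A}_{p_1}\times\cdots\times\mathbb{A}_{p_k}\to\mathbb{A}_m$ is derivable for some natural numbers $p_1,\dots,p_k,m$. Then there exists a polynomial $p_f:\mathbb{N}^k\to\mathbb{N}$ such that, for all inputs $v_1,\dots,v_k\in\mathbb{A}$, a DAG representation of $f(v_1,\dots,v_k)$ is computable from $v_1,\dots,v_k$ in time $p_f(|v_1|,\dots,|v_k|)$.
   Context: **Algebra.** $\mathbb{A}$ denotes a finite signature of constructors $\mathsf{c}_1,\dots,\mathsf{c}_K$, each with an arity $\mathrm{ar}(\mathsf{c}_i)$; the set of ground terms over it is also written $\mathbb{A}$. $|v|$ is the number of symbol occurrences in the term $v$, i.e. $|\mathsf{c}(v_1,\dots,v_k)|=1+\sum_i|v_i|$. **Simultaneous recursive functions.** $\mathrm{SimRec}(\mathbb{A})$ is the smallest class of functions $\mathbb{A}^n\to\mathbb{A}$ containing the basic functions - constructor functions $f_{\mathsf{c}}(x_1,\dots,x_{\mathrm{ar}(\mathsf{c})})=\mathsf{c}(x_1,\dots,x_{\mathrm{ar}(\mathsf{c})})$; - projections $\Pi^m_n(x_1,\dots,x_m)=x_n$ for $1\le n\le m$; and closed under - composition: from $f:\mathbb{A}^n\to\mathbb{A}$ and $g_1,\dots,g_n:\mathbb{A}^m\to\mathbb{A}$, the function $f\circ(g_1,\dots,g_n)$, $\vec x\mapsto f(g_1(\vec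 x),\dots,g_n(\vec x))$; - case distinction: from $f_i:\mathbb{A}^{\mathrm{ar}(\mathsf{c}_i)}\times\mathbb{A}^n\to\mathbb{A}$ ($1\le i\le K$), the function $g=\mathrm{case}(\{f_i\}_i)$ with $g(\mathsf{c}_i(\vec x),\vec y)=f_i(\vec x,\vec y)$; - simultaneous primitive recursion: from $f_i^j:\mathbb{A}^{\mathrm{ar}(\mathsf{c}_i)}\times\mathbb{A}^{n\cdot\mathrm{ar}(\mathsf{c}_i)}\times\mathbb{A}^m\to\mathbb{A}$ ($1\le i\le K$, $1\le j\le n$), the functions $g_1,\dots,g_n:\mathbb{A}\times\mathbb{A}^m\to\mathbb{A}$, $\{g_j\}_j=\mathrm{simrec}(\{f_i^j\}_{i,j})$, with, for $\vec x=x_1,\dots,x_a$ and $a=\mathrm{ar}(\mathsf{c}_i)$, $$g_j(\mathsf{c}_i(\vec x),\vec y)=f_i^j(\vec x,g_1(x_1,\vec y),\dots,g_1(x_a,\vec y),\dots,g_n(x_1,\vec y),\dots,g_n(x_a,\vec y),\vec y).$$ **Tiering.** Judgments $f\rhd\mathbb{A}_{p_1}\times\cdots\times\mathbb{A}_{p_k}\to\mathbb{A}_m$ (tiers $p_i,m\in\mathbb{N}$; $k$ the arity of $f$) are derived, following the definition of $f$, by the rules below, where $\mathbf{A}$ ranges over expressions $\mathbb{A}_{q_1}\times\cdots\times\mathbb{A}_{q_l}$: - $f_{\mathsf{c}}\rhd\mathbb{A}_n^{\mathrm{ar}(\mathsf{c})}\to\mathbb{A}_n$; - $\Pi^m_n\rhd\mathbb{A}_{p_1}\times\cdots\times\mathbb{A}_{p_m}\to\mathbb{A}_{p_n}$;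 - if $f_i\rhd\mathbb{A}_p^{\mathrm{ar}(\mathsf{c}_i)}\times\mathbf{A}\to\mathbb{A}_m$ for all $i$, then $\mathrm{case}(\{f_i\}_i)\rhd\mathbb{A}_p\times\mathbf{A}\to\mathbb{A}_m$; - if $f\rhd\mathbb{A}_{p_1}\times\cdots\times\mathbb{A}_{p_n}\to\mathbb{A}_m$ and $g_i\rhd\mathbf{A}\to\mathbb{A}_{p_i}$ for all $i$, then $f\circ(g_1,\dots,g_n)\rhd\mathbf{A}\to\mathbb{A}_m$; - if $f_i^j\rhd\mathbb{A}_p^{\mathrm{ar}(\mathsf{c}_i)}\times\mathbb{A}_m^{n\cdot\mathrm{ar}(\mathsf{c}_i)}\times\mathbf{A}\to\mathbb{A}_m$ for all $i,j$ and $p>m$, then each function $g_j$ of $\mathrm{simrec}(\{f_i^j\}_{i,j})$ satisfies $g_j\rhd\mathbb{A}_p\times\mathbf{A}\to\mathbb{A}_m$. **DAG representation.** A DAG representation of a term $v\in\mathbb{A}$ is a (string encoding of a) rooted directed acyclic graph with nodes labeled by constructors and ordered outgoing edges (as many as the arity of the label), maximally shared (no two distinct nodes have the same label and the same successor list), whose unfolding from the root is $v$. Inputs are given as ordinary terms; time is measured on a standard model such as Turing machines. *)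

theory Defs
  imports Main
begin

section \<open>Terms over a finite signature\<close>

text \<open>
  A signature with constructors \<open>c\<^sub>1, \<dots>, c\<^sub>K\<close> is the list \<open>ars\<close> of their arities, so \<open>K = length ars\<close>.
  Constructors, argument positions and the components of a simultaneous recursion are all counted
  from 0.
\<close>

datatype trm = Con nat "trm list"

inductive_set terms :: "nat list \<Rightarrow> trm set" for ars :: "nat list" where
  "i < length ars \<Longrightarrow> length ts = ars ! i \<Longrightarrow> (\<And>t. t \<in> set ts \<Longrightarrow> t \<in> terms ars)
     \<Longrightarrow> Con i ts \<in> terms ars"

fun tsize :: "trm \<Rightarrow> nat" where
  "tsize (Con i ts) = 1 + sum_list (map tsize ts)"

definition tuples :: "nat list \<Rightarrow> nat \<Rightarrow> trm list set" where
  "tuples ars n = {vs. length vs = n \<and> set vs \<subseteq> terms ars}"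


section \<open>Simultaneous recursive functions\<close>

text \<open>
  A function of arity \<open>n\<close> over the algebra is represented by any HOL function on lists that agrees
  with it on \<open>tuples ars n\<close>; its values elsewhere are irrelevant. Accordingly, each operation is the
  relation given by its defining equations on well-formed arguments.
\<close>

type_synonym tfun = "trm list \<Rightarrow> trm"

definition is_constr :: "nat list \<Rightarrow> nat \<Rightarrow> tfun \<Rightarrow> bool" where
  "is_constr ars i h \<longleftrightarrow> (\<forall>xs \<in> tuples ars (ars ! i). h xs = Con i xs)"

definition is_proj :: "nat list \<Rightarrow> nat \<Rightarrow> nat \<Rightarrow> tfun \<Rightarrow> bool" where
  "is_proj ars m n h \<longleftrightarrow> (\<forall>xs \<in> tuples ars m. h xs = xs ! n)"

definition is_comp :: "nat list \<Rightarrow> nat \<Rightarrow> tfun \<Rightarrow> tfun list \<Rightarrow> tfun \<Rightarrow> bool" where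
  "is_comp ars m f gs h \<longleftrightarrow> (\<forall>xs \<in> tuples ars m. h xs = f (map (\<lambda>g. g xs) gs))"

definition is_case :: "nat list \<Rightarrow> nat \<Rightarrow> (nat \<Rightarrow> tfun) \<Rightarrow> tfun \<Rightarrow> bool" where
  "is_case ars n fs h \<longleftrightarrow>
     (\<forall>i < length ars. \<forall>xs \<in> tuples ars (ars ! i). \<forall>ys \<in> tuples ars n.
        h (Con i xs # ys) = fs i (xs @ ys))"

definition is_simrec ::
    "nat list \<Rightarrow> nat \<Rightarrow> nat \<Rightarrow> (nat \<Rightarrow> nat \<Rightarrow> tfun) \<Rightarrow> (nat \<Rightarrow> tfun) \<Rightarrow> bool" where
  "is_simrec ars n m fs gs \<longleftrightarrow>
     (\<forall>j < n. \<forall>i < length ars. \<forall>xs \<in> tuples ars (ars ! i). \<forall>ys \<in> tuples ars m.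
        gs j (Con i xs # ys) =
          fs i j (xs @ concat (map (\<lambda>l. map (\<lambda>x. gs l (x # ys)) xs) [0..<n]) @ ys))"

inductive SimRec :: "nat list \<Rightarrow> nat \<Rightarrow> tfun \<Rightarrow> bool" for ars :: "nat list" where
  constr: "i < length ars \<Longrightarrow> is_constr ars i h \<Longrightarrow> SimRec ars (ars ! i) h"
| proj: "n < m \<Longrightarrow> is_proj ars m n h \<Longrightarrow> SimRec ars m h"
| comp: "SimRec ars (length gs) f \<Longrightarrow> (\<And>g. g \<in> set gs \<Longrightarrow> SimRec ars m g) \<Longrightarrow> is_comp ars m f gs h
    \<Longrightarrow> SimRec ars m h"
| casedist: "(\<And>i. i < length ars \<Longrightarrow> SimRec ars (ars ! i + n) (fs i)) \<Longrightarrow> is_case ars n fs h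
    \<Longrightarrow> SimRec ars (1 + n) h"
| simrec: "(\<And>i j. i < length ars \<Longrightarrow> j < n \<Longrightarrow> SimRec ars (ars ! i + n * ars ! i + m) (fs i j))
    \<Longrightarrow> is_simrec ars n m fs gs \<Longrightarrow> j < n \<Longrightarrow> SimRec ars (1 + m) (gs j)"

text \<open>
  \<open>tiered ars f ps m\<close> is the judgment that \<open>f\<close> maps arguments of tiers \<open>ps\<close> to a result of tier \<open>m\<close>.
  Functions being extensional, it holds iff some definition of \<open>f\<close> admits a tier derivation.
\<close>

inductive tiered :: "nat list \<Rightarrow> tfun \<Rightarrow> nat list \<Rightarrow> nat \<Rightarrow> bool" for ars :: "nat list" where
  constr: "i < length ars \<Longrightarrow> is_constr ars i h \<Longrightarrow> tiered ars h (replicate (ars ! i) n) n"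
| proj: "n < length ps \<Longrightarrow> is_proj ars (length ps) n h \<Longrightarrow> tiered ars h ps (ps ! n)"
| casedist: "(\<And>i. i < length ars \<Longrightarrow> tiered ars (fs i) (replicate (ars ! i) p @ qs) m)
    \<Longrightarrow> is_case ars (length qs) fs h \<Longrightarrow> tiered ars h (p # qs) m"
| comp: "tiered ars f ps m \<Longrightarrow> length gs = length ps
    \<Longrightarrow> (\<And>i. i < length ps \<Longrightarrow> tiered ars (gs ! i) qs (ps ! i))
    \<Longrightarrow> is_comp ars (length qs) f gs h \<Longrightarrow> tiered ars h qs m"
| simrec: "(\<And>i j. i < length ars \<Longrightarrow> j < n \<Longrightarrow>
        tiered ars (fs i j) (replicate (ars ! i) p @ replicate (n * ars ! i) m @ qs) m)
    \<Longrightarrow> p > m \<Longrightarrow> is_simrec ars n (length qs) fs gs \<Longrightarrow> j < n \<Longrightarrow> tiered ars (gs j) (p # qs) m"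


section \<open>Polynomials in several variables\<close>

definition polynomial_fun :: "nat \<Rightarrow> (nat list \<Rightarrow> nat) \<Rightarrow> bool" where
  "polynomial_fun k p \<longleftrightarrow>
     (\<exists>(E :: (nat \<Rightarrow> nat) set) (c :: (nat \<Rightarrow> nat) \<Rightarrow> nat). finite E \<and>
        (\<forall>xs. length xs = k \<longrightarrow> p xs = (\<Sum>e\<in>E. c e * (\<Prod>i<k. (xs ! i) ^ e i))))"


section \<open>DAG representations\<close>

record 'n dag =
  nodes :: "'n set"
  label :: "'n \<Rightarrow> nat"
  succs :: "'n \<Rightarrow> 'n list"
  dag_root :: "'n"

definition dag_edges :: "'n dag \<Rightarrow> ('n \<times> 'n) set" where
  "dag_edges G = {(x, y). x \<in> nodes G \<and> y \<in> set (succs G x)}"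

inductive unfolds :: "'n dag \<Rightarrow> 'n \<Rightarrow> trm \<Rightarrow> bool" for G :: "'n dag" where
  "list_all2 (unfolds G) (succs G x) ts \<Longrightarrow> unfolds G x (Con (label G x) ts)"

text \<open>
  Rootedness is read as in graph theory: every node is reachable from the root.
\<close>

definition dag_represents :: "nat list \<Rightarrow> 'n dag \<Rightarrow> trm \<Rightarrow> bool" where
  "dag_represents ars G v \<longleftrightarrow>
     finite (nodes G) \<and> dag_root G \<in> nodes G \<and>
     (\<forall>x \<in> nodes G. label G x < length ars \<and> length (succs G x) = ars ! label G x \<and>
        set (succs G x) \<subseteq> nodes G) \<and>
     acyclic (dag_edges G) \<and>
     (\<forall>x \<in> nodes G. (dag_root G, x) \<in> (dag_edges G)\<^sup>*) \<and>
     inj_on (\<lambda>x. (label G x, succs G x)) (nodes G) \<and>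
     unfolds G (dag_root G) v"


section \<open>String encodings\<close>

text \<open>
  Symbols are natural numbers: 0 is the blank, 1 and 2 are the two bits, 3 is a delimiter, and
  \<open>4 + i\<close> stands for constructor \<open>i\<close>. Terms are written in prefix notation, so that a term \<open>v\<close> is a
  string of length \<open>tsize v\<close>.
\<close>

fun term_code :: "trm \<Rightarrow> nat list" where
  "term_code (Con i ts) = (4 + i) # concat (map term_code ts)"

definition input_code :: "trm list \<Rightarrow> nat list" where
  "input_code vs = concat (map (\<lambda>v. term_code v @ [3]) vs)"

definition bits_code :: "bool list \<Rightarrow> nat list" where
  "bits_code bs = map (\<lambda>b. if b then 2 else 1) bs"

text \<open>
  DAGs are written as adjacency lists whose nodes are named by arbitrary (pairwise distinct) bit
  strings: first the name of the root, then for every node, in any order, its name, its label, and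
  the names of its successors.
\<close>

definition node_code :: "bool list dag \<Rightarrow> bool list \<Rightarrow> nat list" where
  "node_code G x =
     bits_code x @ [4 + label G x] @ concat (map (\<lambda>y. bits_code y @ [3]) (succs G x))"

definition dag_encoding :: "bool list dag \<Rightarrow> nat list \<Rightarrow> bool" where
  "dag_encoding G w \<longleftrightarrow>
     (\<exists>ns. distinct ns \<and> set ns = nodes G \<and>
        w = bits_code (dag_root G) @ [3] @ concat (map (node_code G) ns))"


section \<open>Multi-tape Turing machines\<close>

text \<open>
  Deterministic machines with two-way infinite tapes. The input is on the first tape and the output
  on the last one, each starting at cell 0 where all heads are placed initially.
\<close>

datatype move = Lft | Stay | Rgt

record tm =
  n_tapes :: nat
  alphabet :: "nat set"
  states :: "nat set"
  start :: nat
  halt :: nat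
  delta :: "nat \<Rightarrow> nat list \<Rightarrow> nat \<times> (nat \<times> move) list"

definition turing_machine :: "tm \<Rightarrow> bool" where
  "turing_machine M \<longleftrightarrow>
     n_tapes M > 0 \<and> finite (alphabet M) \<and> 0 \<in> alphabet M \<and>
     finite (states M) \<and> start M \<in> states M \<and> halt M \<in> states M \<and>
     (\<forall>q \<in> states M. \<forall>rs. length rs = n_tapes M \<and> set rs \<subseteq> alphabet M \<longrightarrow>
        (case delta M q rs of (q', as) \<Rightarrow>
           q' \<in> states M \<and> length as = n_tapes M \<and> fst ` set as \<subseteq> alphabet M))"

type_synonym tape = "(int \<Rightarrow> nat) \<times> int"
type_synonym config = "nat \<times> tape list"

fun tape_read :: "tape \<Rightarrow> nat" where
  "tape_read (t, h) = t h"

fun move_head :: "move \<Rightarrow> int \<Rightarrow> int" where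
  "move_head Lft h = h - 1"
| "move_head Stay h = h"
| "move_head Rgt h = h + 1"

fun tape_act :: "nat \<times> move \<Rightarrow> tape \<Rightarrow> tape" where
  "tape_act (a, d) (t, h) = (t(h := a), move_head d h)"

fun tm_step :: "tm \<Rightarrow> config \<Rightarrow> config" where
  "tm_step M (q, ts) =
     (if q = halt M then (q, ts)
      else case delta M q (map tape_read ts) of (q', as) \<Rightarrow> (q', map2 tape_act as ts))"

definition tape_content :: "nat list \<Rightarrow> int \<Rightarrow> nat" where
  "tape_content w z = (if 0 \<le> z \<and> z < int (length w) then w ! nat z else 0)"

definition init_config :: "tm \<Rightarrow> nat list \<Rightarrow> config" where
  "init_config M w =
     (start M, (tape_content w, 0) # replicate (n_tapes M - 1) (tape_content [], 0))"

definition outputs_within :: "tm \<Rightarrow> nat list \<Rightarrow> nat list \<Rightarrow> nat \<Rightarrow> bool" where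
  "outputs_within M w u t \<longleftrightarrow>
     (case (tm_step M ^^ t) (init_config M w) of (q, ts) \<Rightarrow>
        q = halt M \<and> fst (last ts) = tape_content u)"

end

theory Submission
  imports Defs
begin

text \<open>
  A value of tier \<open>m\<close> is built from its arguments of tier \<open>m\<close>, which are only passed on, and from new
  nodes. By induction on the tiering, the number of new distinct subterms is polynomial in the
  number of distinct subterms of the arguments of tier greater than \<open>m\<close>: a recursion contributes one
  batch of them for every distinct subterm of its recursion argument, whose tier is greater than
  \<open>m\<close>. Hence all intermediate values have polynomially many distinct subterms, although their sizes
  as terms may be exponential.

  Evaluation therefore shares equal terms on a hash-consed heap, so that equality of terms is
  equality of addresses, and it memoises every recursion on the distinct subterms of the recursion
  argument, visited in depth-first order. Addresses are written in unary, the heap is searched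
  linearly, and the whole evaluator is a structured program on stacks of symbols, which a
  multi-tape Turing machine runs with one stack on each tape.
\<close>


section \<open>Stack programs and Turing machines\<close>


text \<open>A recursion of tier \<open>m\<close> feeds its own tier-\<open>m\<close> results back
  into its step functions, so a bound in which tier-\<open>m\<close> arguments occur inside a
  polynomial would be iterated along the recursion and could become exponential. The invariant
  therefore subtracts a set: the subterms of tier-\<open>m\<close> arguments are removed before
  counting, and only the new ones are bounded, by a polynomial in the arguments of higher tier.
  Under iteration such batches add up by union instead of being composed. Arguments of tier below
  \<open>m\<close> occur in neither count.

  Tiers serve only to bound the number of distinct subterms of values. Given these bounds, the
  running time is estimated for each way of defining a function without further use of tiers, in
  terms of the number of distinct subterms of its arguments.

  Besides terms, the heap holds lists and memo tables, so it is not itself the required graph; a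
  last search with a constant memo value lists exactly the subterms of the result. That graph
  inherits maximal sharing from the injectivity of addresses.\<close>

type_synonym store = "nat \<Rightarrow> nat list"

datatype prog =
    Skip
  | Push nat nat
  | Pop nat
  | Emit nat
  | Seq prog prog (infixr ";;" 60)
  | Cond nat "nat set" prog prog
  | Loop nat "nat set" prog

text \<open>The default 0 is the blank that a machine reads on an empty stack. The programs below
  push only nonzero symbols, so 0 also marks the end of a stack.\<close>

definition peek :: "nat list \<Rightarrow> nat" where
  "peek xs = (case xs of [] \<Rightarrow> 0 | x # _ \<Rightarrow> x)"

lemma peek_simps [simp]: "peek [] = 0" "peek (x # xs) = x"
  by (simp_all add: peek_def)

text \<open>The step counts are those of the compiled code: \<open>Push\<close> takes a move and a
  write, the first branch of \<open>Cond\<close> ends with a jump over the second, and each turn of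
  a \<open>Loop\<close> ends with a jump back. Stack 0 is the output, which grows at its end and is
  never read.\<close>

inductive exec :: "prog \<Rightarrow> store \<Rightarrow> nat \<Rightarrow> store \<Rightarrow> bool" where
  Skip: "exec Skip s 0 s"
| Push: "0 < i \<Longrightarrow> exec (Push i a) s 2 (s(i := a # s i))"
| Pop: "0 < i \<Longrightarrow> exec (Pop i) s 1 (s(i := tl (s i)))"
| Emit: "exec (Emit a) s 1 (s(0 := s 0 @ [a]))"
| Seq: "exec c s t s' \<Longrightarrow> exec d s' t' s'' \<Longrightarrow> exec (c ;; d) s (t + t') s''"
| CondT: "0 < i \<Longrightarrow> peek (s i) \<in> A \<Longrightarrow> exec c s t s' \<Longrightarrow> exec (Cond i A c d) s (1 + (t + 1)) s'"
| CondF: "0 < i \<Longrightarrow> peek (s i) \<notin> A \<Longrightarrow> exec d s t s' \<Longrightarrow> exec (Cond i A c d) s (1 + t) s'"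
| LoopT: "0 < i \<Longrightarrow> peek (s i) \<in> A \<Longrightarrow> exec c s t s' \<Longrightarrow> exec (Loop i A c) s' t' s''
    \<Longrightarrow> exec (Loop i A c) s (1 + (t + (1 + t'))) s''"
| LoopF: "0 < i \<Longrightarrow> peek (s i) \<notin> A \<Longrightarrow> exec (Loop i A c) s 1 s"

section \<open>Translation of programs into machine code\<close>

datatype instr = Act nat "nat option" move | Br nat "nat set" nat nat

text \<open>\<open>b\<close> is the absolute address of the first instruction.
  \<open>Br 0 {} e e\<close> is an unconditional jump, as no symbol lies in the empty set.
  \<open>Push\<close> moves left without writing (\<open>None\<close>), then writes.\<close>

fun compile :: "nat \<Rightarrow> prog \<Rightarrow> instr list" where
  "compile b Skip = []"
| "compile b (Push i a) = [Act i None Lft, Act i (Some a) Stay]"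
| "compile b (Pop i) = [Act i (Some 0) Rgt]"
| "compile b (Emit a) = [Act 0 (Some a) Rgt]"
| "compile b (c ;; d) = (let C = compile b c in C @ compile (b + length C) d)"
| "compile b (Cond i A c d) =
     (let C = compile (b + 1) c; D = compile (b + 2 + length C) d;
          e = b + 2 + length C + length D
      in Br i A (b + 1) (b + 2 + length C) # C @ Br 0 {} e e # D)"
| "compile b (Loop i A c) =
     (let C = compile (b + 1) c in Br i A (b + 1) (b + 2 + length C) # C @ [Br 0 {} b b])"

text \<open>Stack \<open>i > 0\<close> lives on tape \<open>i - 1\<close>, and the output on the last tape.\<close>

definition tape_of :: "nat \<Rightarrow> nat \<Rightarrow> nat" where
  "tape_of n i = (if i = 0 then n - 1 else i - 1)"

definition keep :: "nat list \<Rightarrow> (nat \<times> move) list" where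
  "keep rs = map (\<lambda>a. (a, Stay)) rs"

definition machine_delta :: "nat \<Rightarrow> instr list \<Rightarrow> nat \<Rightarrow> nat list \<Rightarrow> nat \<times> (nat \<times> move) list" where
  "machine_delta n P q rs =
     (if q < length P then
        (case P ! q of
           Act i w d \<Rightarrow>
             (q + 1, (keep rs)[tape_of n i := (case w of None \<Rightarrow> rs ! tape_of n i | Some a \<Rightarrow> a, d)])
         | Br i A q1 q2 \<Rightarrow> (if rs ! tape_of n i \<in> A then q1 else q2, keep rs))
      else (q, keep rs))"

definition machine :: "nat \<Rightarrow> nat \<Rightarrow> instr list \<Rightarrow> tm" where
  "machine n S P = \<lparr>n_tapes = n, alphabet = {..<S}, states = {..length P}, start = 0,
     halt = length P, delta = machine_delta n P\<rparr>"

definition instr_ok :: "nat \<Rightarrow> nat \<Rightarrow> nat \<Rightarrow> instr \<Rightarrow> bool" where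
  "instr_ok n S l x = (case x of
     Act i w d \<Rightarrow> i < n \<and> (\<forall>a. w = Some a \<longrightarrow> a < S)
   | Br i A q1 q2 \<Rightarrow> i < n \<and> q1 \<le> l \<and> q2 \<le> l)"

lemma turing_machine_machine:
  assumes "0 < n" "0 < S" "\<forall>x \<in> set P. instr_ok n S (length P) x"
  shows "turing_machine (machine n S P)"
proof -
  have step: "case machine_delta n P q rs of (q', as) \<Rightarrow>
      q' \<le> length P \<and> length as = n \<and> fst ` set as \<subseteq> {..<S}"
    if q: "q \<le> length P" and l: "length rs = n" and rs: "set rs \<subseteq> {..<S}" for q rs
  proof (cases "q < length P")
    case False
    then show ?thesis using q l rs by (auto simp: machine_delta_def keep_def)
  next
    case True
    then have ok: "instr_ok n S (length P) (P ! q)" using assms(3) by auto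
    show ?thesis
    proof (cases "P ! q")
      case (Act i w d)
      have j: "tape_of n i < length rs" using ok Act l by (auto simp: tape_of_def instr_ok_def)
      let ?a = "case w of None \<Rightarrow> rs ! tape_of n i | Some a \<Rightarrow> a"
      have a: "?a < S" using ok Act subsetD[OF rs nth_mem[OF j]] by (auto simp: instr_ok_def split: option.splits)
      have "fst ` set ((keep rs)[tape_of n i := (?a, d)]) \<subseteq> fst ` insert (?a, d) (set (keep rs))"
        by (intro image_mono set_update_subset_insert)
      also have "\<dots> \<subseteq> {..<S}" using a rs by (auto simp: keep_def)
      finally show ?thesis using True Act l by (simp add: machine_delta_def keep_def)
    next
      case (Br i A q1 q2)
      then show ?thesis using True ok l rs
        by (auto simp: machine_delta_def keep_def instr_ok_def)
    qed
  qed
  show ?thesis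
    unfolding turing_machine_def machine_def using assms(1,2) step by simp
qed

text \<open>The head stands on the top symbol, deeper symbols lie to its right, and every cell to
  its left is blank; a pop therefore erases the cell that it leaves. The input tape is such a stack
  from the start.\<close>

definition stack_tape :: "nat list \<Rightarrow> tape \<Rightarrow> bool" where
  "stack_tape xs T \<longleftrightarrow> fst T = (\<lambda>z. tape_content xs (z - snd T))"

text \<open>Unlike for a stack, the position is fixed, because the output has to start at cell
  0.\<close>

definition output_tape :: "nat list \<Rightarrow> tape \<Rightarrow> bool" where
  "output_tape xs T \<longleftrightarrow> T = (tape_content xs, int (length xs))"

definition store_tapes :: "nat \<Rightarrow> store \<Rightarrow> tape list \<Rightarrow> bool" where
  "store_tapes n s ts \<longleftrightarrow> length ts = n \<and> output_tape (s 0) (ts ! (n - 1)) \<and>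
     (\<forall>i. 0 < i \<longrightarrow> i < n \<longrightarrow> stack_tape (s i) (ts ! (i - 1)))"

lemma stack_tape_peek: "stack_tape xs T \<Longrightarrow> tape_read T = peek xs"
  by (cases T; cases xs) (auto simp: stack_tape_def tape_content_def)

lemma tape_content_Cons:
  "tape_content (x # xs) z = (if z = 0 then x else tape_content xs (z - 1))"
proof (cases "z > 0")
  case True
  then obtain n where "nat z = Suc n"
    using gr0_implies_Suc[of "nat z"] by auto
  then have "z = int (Suc n)" by linarith
  then show ?thesis by (auto simp: tape_content_def nat_add_distrib)
qed (auto simp: tape_content_def)

lemma tape_content_tl:
  "tape_content (tl xs) z = (if z = -1 then 0 else tape_content xs (z + 1))"
  by (cases xs) (auto simp: tape_content_Cons, auto simp: tape_content_def)

lemma stack_tape_pop: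
  assumes "stack_tape xs T" shows "stack_tape (tl xs) (tape_act (0, Rgt) T)"
  using assms
  by (cases T) (auto simp: stack_tape_def tape_content_tl fun_eq_iff algebra_simps)

lemma stack_tape_push:
  "stack_tape xs T \<Longrightarrow> stack_tape (a # xs) (tape_act (a, Stay) (tape_act (tape_read T, Lft) T))"
  by (cases T) (auto simp: stack_tape_def tape_content_Cons fun_eq_iff)

lemma output_tape_emit: "output_tape xs T \<Longrightarrow> output_tape (xs @ [a]) (tape_act (a, Rgt) T)"
  by (cases T)
    (auto simp: output_tape_def tape_content_def fun_eq_iff nth_append nat_less_iff)

lemma tape_act_keep [simp]: "tape_act (tape_read T, Stay) T = T"
  by (cases T) auto

lemma map2_keep [simp]: "map2 tape_act (keep (map tape_read ts)) ts = ts"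
  by (induction ts) (auto simp: keep_def)

lemma map2_keep_update:
  "j < length ts \<Longrightarrow>
     map2 tape_act ((keep (map tape_read ts))[j := x]) ts = ts[j := tape_act x (ts ! j)]"
  by (rule nth_equalityI) (auto simp: keep_def nth_list_update)

lemma step_Act:
  assumes "q < length P" "P ! q = Act i w d" "length ts = n" "i < n"
  shows "tm_step (machine n S P) (q, ts) =
    (q + 1, ts[tape_of n i :=
       tape_act (case w of None \<Rightarrow> tape_read (ts ! tape_of n i) | Some a \<Rightarrow> a, d) (ts ! tape_of n i)])"
proof -
  have "tape_of n i < length ts" using assms by (auto simp: tape_of_def)
  then show ?thesis using assms
    by (auto simp: machine_def machine_delta_def map2_keep_update split: option.splits)
qed

lemma step_Br:
  assumes "q < length P" "P ! q = Br i A q1 q2" "length ts = n" "i < n"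
  shows "tm_step (machine n S P) (q, ts) =
    (if tape_read (ts ! tape_of n i) \<in> A then q1 else q2, ts)"
proof -
  have "tape_of n i < length ts" using assms by (auto simp: tape_of_def)
  then show ?thesis using assms by (auto simp: machine_def machine_delta_def)
qed

definition reaches :: "tm \<Rightarrow> config \<Rightarrow> nat \<Rightarrow> config \<Rightarrow> bool" where
  "reaches M C t C' \<longleftrightarrow> (tm_step M ^^ t) C = C'"

lemma reaches_trans: "reaches M C t C' \<Longrightarrow> reaches M C' t' C'' \<Longrightarrow> reaches M C (t + t') C''"
  unfolding reaches_def by (subst add.commute) (simp add: funpow_add)

lemma reaches_step: "tm_step M C = C' \<Longrightarrow> reaches M C 1 C'"
  by (simp add: reaches_def)

text \<open>Jump targets are absolute, so code is judged at its address \<open>b\<close> inside a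
  complete program \<open>P\<close>.\<close>

definition placed :: "instr list \<Rightarrow> nat \<Rightarrow> instr list \<Rightarrow> bool" where
  "placed P b C \<longleftrightarrow> (\<exists>xs ys. P = xs @ C @ ys \<and> length xs = b)"

lemma placed_append: "placed P b (C @ D) \<longleftrightarrow> placed P b C \<and> placed P (b + length C) D"
proof
  assume "placed P b (C @ D)"
  then obtain xs ys where "P = xs @ (C @ D) @ ys" "length xs = b" by (auto simp: placed_def)
  then have "P = xs @ C @ (D @ ys)" "length xs = b"
    "P = (xs @ C) @ D @ ys" "length (xs @ C) = b + length C" by simp_all
  then show "placed P b C \<and> placed P (b + length C) D" unfolding placed_def by blast
next
  assume *: "placed P b C \<and> placed P (b + length C) D"
  then obtain xs ys where a: "P = xs @ C @ ys" "length xs = b" by (auto simp: placed_def)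
  from * obtain xs' ys' where b: "P = xs' @ D @ ys'" "length xs' = b + length C"
    by (auto simp: placed_def)
  have "(xs @ C) @ ys = xs' @ (D @ ys')" "length (xs @ C) = length xs'" using a b by simp_all
  then have "ys = D @ ys'" by (metis append_eq_append_conv)
  then show "placed P b (C @ D)" using a unfolding placed_def by auto
qed

lemma placed_Cons: "placed P b (x # D) \<longleftrightarrow> (b < length P \<and> P ! b = x) \<and> placed P (b + 1) D"
proof -
  have "placed P b [x] \<longleftrightarrow> b < length P \<and> P ! b = x"
  proof
    assume "b < length P \<and> P ! b = x"
    then have "P = take b P @ [x] @ drop (Suc b) P" "length (take b P) = b"
      using id_take_nth_drop[of b P] by auto
    then show "placed P b [x]" unfolding placed_def by blast
  qed (auto simp: placed_def)
  then show ?thesis using placed_append[of P b "[x]" D] by simp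
qed

lemma store_tapes_update:
  assumes "store_tapes n s ts" "0 < i" "i < n" "stack_tape xs T"
  shows "store_tapes n (s(i := xs)) (ts[i - 1 := T])"
  using assms by (auto simp: store_tapes_def nth_list_update)

text \<open>The induction runs over executions, not programs, because a \<open>Loop\<close> that is
  entered executes itself again. The machine needs exactly the \<open>t\<close> steps counted by
  \<open>exec\<close>.\<close>

theorem compile_correct:
  assumes "exec c s t s'" "placed P b (compile b c)" "\<forall>x \<in> set P. instr_ok n S (length P) x"
    "store_tapes n s ts"
  shows "\<exists>ts'. store_tapes n s' ts' \<and>
    reaches (machine n S P) (b, ts) t (b + length (compile b c), ts')"
  using assms
proof (induction arbitrary: b ts rule: exec.induct)
  case (Skip s)
  then show ?case by (auto simp: reaches_def)
next
  case (Push i a s)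
  have p: "b < length P" "P ! b = Act i None Lft" "b + 1 < length P" "P ! (b + 1) = Act i (Some a) Stay"
    using Push.prems(1) by (auto simp: placed_Cons)
  have "Act i None Lft \<in> set P" using p nth_mem by metis
  then have i: "i < n" using Push.prems(2) by (auto simp: instr_ok_def)
  have l: "length ts = n" using Push.prems by (simp add: store_tapes_def)
  let ?T = "ts ! (i - 1)"
  let ?ts1 = "ts[i - 1 := tape_act (tape_read ?T, Lft) ?T]"
  let ?ts2 = "?ts1[i - 1 := tape_act (a, Stay) (tape_act (tape_read ?T, Lft) ?T)]"
  have st: "stack_tape (s i) ?T" using Push i by (simp add: store_tapes_def)
  have "tm_step (machine n S P) (b, ts) = (b + 1, ?ts1)"
    using step_Act[OF p(1,2) l i] Push.hyps by (simp add: tape_of_def)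
  moreover have "tm_step (machine n S P) (b + 1, ?ts1) = (b + 2, ?ts2)"
    using step_Act[OF p(3,4) _ i, of ?ts1] Push.hyps l i by (simp add: tape_of_def)
  ultimately have "reaches (machine n S P) (b, ts) (1 + 1) (b + 2, ?ts2)"
    by (intro reaches_trans[OF reaches_step reaches_step])
  moreover have "store_tapes n (s(i := a # s i)) ?ts2"
    using store_tapes_update[OF Push.prems(3) Push.hyps i stack_tape_push[OF st]] by simp
  ultimately show ?case by (auto simp: numeral_2_eq_2 fun_upd_def)
next
  case (Pop i s)
  have p: "b < length P" "P ! b = Act i (Some 0) Rgt"
    using Pop.prems(1) by (auto simp: placed_Cons)
  have "Act i (Some 0) Rgt \<in> set P" using p nth_mem by metis
  then have i: "i < n" using Pop.prems(2) by (auto simp: instr_ok_def)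
  have l: "length ts = n" using Pop.prems by (simp add: store_tapes_def)
  let ?T = "ts ! (i - 1)"
  have st: "stack_tape (s i) ?T" using Pop i by (simp add: store_tapes_def)
  have "tm_step (machine n S P) (b, ts) = (b + 1, ts[i - 1 := tape_act (0, Rgt) ?T])"
    using step_Act[OF p(1,2) l i] Pop.hyps by (simp add: tape_of_def)
  from reaches_step[OF this] store_tapes_update[OF Pop.prems(3) Pop.hyps i stack_tape_pop[OF st]]
  show ?case by (auto simp: fun_upd_def)
next
  case (Emit a s)
  have p: "b < length P" "P ! b = Act 0 (Some a) Rgt"
    using Emit.prems(1) by (auto simp: placed_Cons)
  have "Act 0 (Some a) Rgt \<in> set P" using p nth_mem by metis
  then have i: "0 < n" using Emit.prems(2) by (auto simp: instr_ok_def)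
  have l: "length ts = n" using Emit.prems by (simp add: store_tapes_def)
  let ?T = "ts ! (n - 1)"
  have st: "output_tape (s 0) ?T" using Emit i by (simp add: store_tapes_def)
  have "tm_step (machine n S P) (b, ts) = (b + 1, ts[n - 1 := tape_act (a, Rgt) ?T])"
    using step_Act[OF p(1,2) l i] by (simp add: tape_of_def)
  from reaches_step[OF this]
  have 1: "reaches (machine n S P) (b, ts) 1 (b + 1, ts[n - 1 := tape_act (a, Rgt) ?T])" .
  have "store_tapes n (s(0 := s 0 @ [a])) (ts[n - 1 := tape_act (a, Rgt) ?T])"
    using Emit.prems(3) output_tape_emit[OF st] i by (auto simp: store_tapes_def nth_list_update)
  with 1 show ?case by (auto simp: fun_upd_def)
next
  case (Seq c s t s' d t' s'')
  obtain ts1 where 1: "store_tapes n s' ts1"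
      "reaches (machine n S P) (b, ts) t (b + length (compile b c), ts1)"
    using Seq.IH(1)[OF _ Seq.prems(2,3)] Seq.prems(1) by (auto simp: Let_def placed_append)
  obtain ts2 where 2: "store_tapes n s'' ts2" "reaches (machine n S P) (b + length (compile b c), ts1) t'
      (b + length (compile b c) + length (compile (b + length (compile b c)) d), ts2)"
    using Seq.IH(2)[OF _ Seq.prems(2) 1(1)] Seq.prems(1) by (auto simp: Let_def placed_append)
  show ?case using reaches_trans[OF 1(2) 2(2)] 2(1) by (auto simp: Let_def add.assoc)
next
  case (CondT i s A c t s' d)
  let ?C = "compile (b + 1) c"
  let ?D = "compile (b + 2 + length ?C) d"
  let ?e = "b + 2 + length ?C + length ?D"
  have p: "b < length P" "P ! b = Br i A (b + 1) (b + 2 + length ?C)" "placed P (b + 1) ?C"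
      "b + 1 + length ?C < length P" "P ! (b + 1 + length ?C) = Br 0 {} ?e ?e"
    using CondT.prems(1) by (auto simp: placed_Cons placed_append Let_def)
  have "P ! b \<in> set P" using p nth_mem by metis
  then have i: "i < n" "0 < n" using CondT.prems(2) p(2) by (auto simp: instr_ok_def)
  have l: "length ts = n" using CondT.prems by (simp add: store_tapes_def)
  have "tape_read (ts ! tape_of n i) = peek (s i)"
    using CondT.prems(3) CondT.hyps(1) i by (intro stack_tape_peek) (auto simp: store_tapes_def tape_of_def)
  then have 1: "tm_step (machine n S P) (b, ts) = (b + 1, ts)"
    using step_Br[OF p(1,2) l i(1)] CondT.hyps(2) by simp
  obtain ts1 where 2: "store_tapes n s' ts1"
      "reaches (machine n S P) (b + 1, ts) t (b + 1 + length ?C, ts1)"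
    using CondT.IH[OF p(3) CondT.prems(2,3)] by auto
  have l1: "length ts1 = n" using 2 by (simp add: store_tapes_def)
  have 3: "tm_step (machine n S P) (b + 1 + length ?C, ts1) = (?e, ts1)"
    using step_Br[OF p(4,5) l1 i(2)] by simp
  have "reaches (machine n S P) (b, ts) (1 + (t + 1)) (?e, ts1)"
    by (rule reaches_trans[OF reaches_step[OF 1] reaches_trans[OF 2(2) reaches_step[OF 3]]])
  then show ?case using 2(1) by (auto simp: Let_def add.assoc)
next
  case (CondF i s A d t s' c)
  let ?C = "compile (b + 1) c"
  let ?D = "compile (b + 2 + length ?C) d"
  let ?e = "b + 2 + length ?C + length ?D"
  have p: "b < length P" "P ! b = Br i A (b + 1) (b + 2 + length ?C)" "placed P (b + 2 + length ?C) ?D"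
    using CondF.prems(1) by (auto simp: placed_Cons placed_append Let_def)
  have "P ! b \<in> set P" using p nth_mem by metis
  then have i: "i < n" using CondF.prems(2) p(2) by (auto simp: instr_ok_def)
  have l: "length ts = n" using CondF.prems by (simp add: store_tapes_def)
  have "tape_read (ts ! tape_of n i) = peek (s i)"
    using CondF.prems(3) CondF.hyps(1) i by (intro stack_tape_peek) (auto simp: store_tapes_def tape_of_def)
  then have 1: "tm_step (machine n S P) (b, ts) = (b + 2 + length ?C, ts)"
    using step_Br[OF p(1,2) l i(1)] CondF.hyps(2) by simp
  obtain ts1 where 2: "store_tapes n s' ts1"
      "reaches (machine n S P) (b + 2 + length ?C, ts) t (?e, ts1)"
    using CondF.IH[OF p(3) CondF.prems(2,3)] by auto
  show ?case using reaches_trans[OF reaches_step[OF 1] 2(2)] 2(1) by (auto simp: Let_def add.assoc)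
next
  case (LoopT i s A c t s' t' s'')
  let ?C = "compile (b + 1) c"
  have p: "b < length P" "P ! b = Br i A (b + 1) (b + 2 + length ?C)" "placed P (b + 1) ?C"
      "b + 1 + length ?C < length P" "P ! (b + 1 + length ?C) = Br 0 {} b b"
    using LoopT.prems(1) by (auto simp: placed_Cons placed_append Let_def)
  have "P ! b \<in> set P" using p nth_mem by metis
  then have i: "i < n" "0 < n" using LoopT.prems(2) p(2) by (auto simp: instr_ok_def)
  have l: "length ts = n" using LoopT.prems by (simp add: store_tapes_def)
  have "tape_read (ts ! tape_of n i) = peek (s i)"
    using LoopT.prems(3) LoopT.hyps(1) i by (intro stack_tape_peek) (auto simp: store_tapes_def tape_of_def)
  then have 1: "tm_step (machine n S P) (b, ts) = (b + 1, ts)"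
    using step_Br[OF p(1,2) l i(1)] LoopT.hyps(2) by simp
  obtain ts1 where 2: "store_tapes n s' ts1"
      "reaches (machine n S P) (b + 1, ts) t (b + 1 + length ?C, ts1)"
    using LoopT.IH(1)[OF p(3) LoopT.prems(2,3)] by auto
  have l1: "length ts1 = n" using 2 by (simp add: store_tapes_def)
  have 3: "tm_step (machine n S P) (b + 1 + length ?C, ts1) = (b, ts1)"
    using step_Br[OF p(4,5) l1 i(2)] by simp
  obtain ts2 where 4: "store_tapes n s'' ts2"
      "reaches (machine n S P) (b, ts1) t' (b + length (compile b (Loop i A c)), ts2)"
    using LoopT.IH(2)[OF LoopT.prems(1,2) 2(1)] by auto
  have "reaches (machine n S P) (b, ts) (1 + (t + (1 + t'))) (b + length (compile b (Loop i A c)), ts2)"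
    by (rule reaches_trans[OF reaches_step[OF 1]
          reaches_trans[OF 2(2) reaches_trans[OF reaches_step[OF 3] 4(2)]]])
  then show ?case using 4(1) by auto
next
  case (LoopF i s A c)
  let ?C = "compile (b + 1) c"
  have p: "b < length P" "P ! b = Br i A (b + 1) (b + 2 + length ?C)"
    using LoopF.prems(1) by (auto simp: placed_Cons placed_append Let_def)
  have "P ! b \<in> set P" using p nth_mem by metis
  then have i: "i < n" using LoopF.prems(2) p(2) by (auto simp: instr_ok_def)
  have l: "length ts = n" using LoopF.prems by (simp add: store_tapes_def)
  have "tape_read (ts ! tape_of n i) = peek (s i)"
    using LoopF.prems(3) LoopF.hyps(1) i by (intro stack_tape_peek) (auto simp: store_tapes_def tape_of_def)
  then have "tm_step (machine n S P) (b, ts) = (b + 2 + length ?C, ts)"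
    using step_Br[OF p(1,2) l i(1)] LoopF.hyps(2) by simp
  from reaches_step[OF this] show ?case using LoopF.prems(3) by (auto simp: Let_def)
qed

section \<open>Bounds on the tapes, symbols and jump targets of compiled code\<close>

fun instr_bound :: "instr \<Rightarrow> nat" where
  "instr_bound (Act i w d) = i + (case w of None \<Rightarrow> 0 | Some a \<Rightarrow> a)"
| "instr_bound (Br i A q1 q2) = i"

definition targets_le :: "nat \<Rightarrow> instr list \<Rightarrow> bool" where
  "targets_le l C \<longleftrightarrow> (\<forall>i A q1 q2. Br i A q1 q2 \<in> set C \<longrightarrow> q1 \<le> l \<and> q2 \<le> l)"

lemma targets_le_simps [simp]:
  "targets_le l []"
  "targets_le l (Act i w d # C) \<longleftrightarrow> targets_le l C"
  "targets_le l (Br i A q1 q2 # C) \<longleftrightarrow> q1 \<le> l \<and> q2 \<le> l \<and> targets_le l C"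
  "targets_le l (C @ D) \<longleftrightarrow> targets_le l C \<and> targets_le l D"
  by (auto simp: targets_le_def)

lemma targets_le_mono: "targets_le l C \<Longrightarrow> l \<le> l' \<Longrightarrow> targets_le l' C"
  unfolding targets_le_def using order_trans by blast

lemma compile_targets: "targets_le (b + length (compile b c)) (compile b c)"
proof (induction c arbitrary: b)
  case (Seq c d)
  show ?case using targets_le_mono[OF Seq(1)[of b]] Seq(2)[of "b + length (compile b c)"]
    by (simp add: Let_def add.assoc)
next
  case (Cond i A c d)
  show ?case using targets_le_mono[OF Cond(1)[of "b + 1"]]
      Cond(2)[of "b + 2 + length (compile (b + 1) c)"]
    by (simp add: Let_def ac_simps)
next
  case (Loop i A c)
  show ?case using targets_le_mono[OF Loop(1)[of "b + 1"]] by (simp add: Let_def)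
qed simp_all

lemma reaches_halted:
  "reaches M C t (halt M, ts) \<Longrightarrow> t \<le> t' \<Longrightarrow> reaches M C t' (halt M, ts)"
proof -
  assume *: "reaches M C t (halt M, ts)" "t \<le> t'"
  have "(tm_step M ^^ d) (halt M, ts) = (halt M, ts)" for d by (induction d) auto
  then show ?thesis using reaches_trans[OF *(1), of "t' - t"] *(2) by (simp add: reaches_def)
qed

definition initial_store :: "nat list \<Rightarrow> store" where
  "initial_store w = (\<lambda>_. [])(1 := w)"

theorem prog_machine:
  "\<exists>M. turing_machine M \<and> {..<S0} \<subseteq> alphabet M \<and>
     (\<forall>w s t t'. exec c (initial_store w) t s \<longrightarrow> t \<le> t' \<longrightarrow> outputs_within M w (s 0) t')"
proof -
  define P where "P = compile 0 c"
  define N where "N = sum_list (map instr_bound P)"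
  \<comment> \<open>\<open>N\<close> bounds every stack index and every written symbol. Having at
    least two tapes keeps the input tape apart from the output tape.\<close>
  define M where "M = machine (N + 2) (N + 1 + S0) P"
  have b: "instr_bound x \<le> N" if "x \<in> set P" for x
    unfolding N_def by (rule member_le_sum_list) (use that in auto)
  have ok: "\<forall>x \<in> set P. instr_ok (N + 2) (N + 1 + S0) (length P) x"
  proof
    fix x assume x: "x \<in> set P"
    show "instr_ok (N + 2) (N + 1 + S0) (length P) x"
    proof (cases x)
      case (Act i w d)
      then show ?thesis using b[OF x] by (auto simp: instr_ok_def split: option.splits)
    next
      case (Br i A q1 q2)
      then show ?thesis using b[OF x] compile_targets[of 0 c] x
        by (auto simp: instr_ok_def P_def targets_le_def)
    qed
  qed
  have "turing_machine M" unfolding M_def by (rule turing_machine_machine[OF _ _ ok]) auto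
  moreover have "{..<S0} \<subseteq> alphabet M" by (auto simp: M_def machine_def)
  moreover have "outputs_within M w (s 0) t'" if e: "exec c (initial_store w) t s" and t: "t \<le> t'" for w s t t'
  proof -
    have 0: "snd (init_config M w) = (tape_content w, 0) # replicate (N + 1) (tape_content [], 0)"
      by (simp add: init_config_def M_def machine_def)
    have 1: "stack_tape [] (tape_content [], 0)" "output_tape [] (tape_content [], 0)"
      "stack_tape w (tape_content w, 0)"
      by (simp_all add: stack_tape_def output_tape_def tape_content_def fun_eq_iff)
    have "store_tapes (N + 2) (initial_store w) (snd (init_config M w))"
      unfolding 0 store_tapes_def using 1
      by (simp add: initial_store_def nth_Cons' del: replicate_Suc)
    from compile_correct[OF e _ ok this, of 0] obtain ts' where
      1: "store_tapes (N + 2) s ts'" "reaches M (0, snd (init_config M w)) t (length P, ts')"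
      by (auto simp: P_def placed_def M_def)
    have "reaches M (init_config M w) t (halt M, ts')"
      using 1(2) by (simp add: init_config_def M_def machine_def)
    then have "reaches M (init_config M w) t' (halt M, ts')" by (rule reaches_halted[OF _ t])
    moreover have "fst (last ts') = tape_content (s 0)"
      using 1(1) by (subst last_conv_nth) (auto simp: store_tapes_def output_tape_def)
    ultimately show ?thesis by (simp add: outputs_within_def reaches_def)
  qed
  ultimately show ?thesis by blast
qed

section \<open>Unary numbers on stacks\<close>


text \<open>The times of \<open>exec\<close> are exact; an upper bound allows rounding when programs
  are composed.\<close>

definition runs :: "prog \<Rightarrow> store \<Rightarrow> store \<Rightarrow> nat \<Rightarrow> bool" where
  "runs c s s' T \<longleftrightarrow> (\<exists>t \<le> T. exec c s t s')"

lemma runs_le: "runs c s s1 T \<Longrightarrow> s1 = s2 \<Longrightarrow> T \<le> T' \<Longrightarrow> runs c s s2 T'"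
  unfolding runs_def using order_trans by blast

lemma runs_skip: "runs Skip s s 0"
  by (auto simp: runs_def intro: exec.intros)

lemma runs_push: "0 < i \<Longrightarrow> runs (Push i a) s (s(i := a # s i)) 2"
  unfolding runs_def by (blast intro: exec.Push)

lemma runs_pop: "0 < i \<Longrightarrow> s i = a # X \<Longrightarrow> runs (Pop i) s (s(i := X)) 1"
  unfolding runs_def using exec.Pop[of i s] by auto

lemma runs_emit: "runs (Emit a) s (s(0 := s 0 @ [a])) 1"
  unfolding runs_def by (blast intro: exec.Emit)

lemma runs_seq: "runs c s s1 T1 \<Longrightarrow> runs d s1 s2 T2 \<Longrightarrow> runs (c ;; d) s s2 (T1 + T2)"
  unfolding runs_def by (meson exec.Seq add_mono)

lemma runs_cond:
  assumes "0 < i" "runs (if peek (s i) \<in> A then c else d) s s' T"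
  shows "runs (Cond i A c d) s s' (T + 2)"
proof (cases "peek (s i) \<in> A")
  case True
  then obtain t where "t \<le> T" "exec c s t s'" using assms by (auto simp: runs_def)
  then show ?thesis using exec.CondT[of i s A c t s' d, OF assms(1) True]
    unfolding runs_def by (intro exI[of _ "1 + (t + 1)"]) auto
next
  case False
  then obtain t where "t \<le> T" "exec d s t s'" using assms by (auto simp: runs_def)
  then show ?thesis using exec.CondF[of i s A d t s' c, OF assms(1) False]
    unfolding runs_def by (intro exI[of _ "1 + t"]) auto
qed

lemma runs_loopT:
  assumes "0 < i" "peek (s i) \<in> A" "runs c s s1 T1" "runs (Loop i A c) s1 s2 T2"
  shows "runs (Loop i A c) s s2 (T1 + T2 + 2)"
proof -
  obtain t t' where "t \<le> T1" "exec c s t s1" "t' \<le> T2" "exec (Loop i A c) s1 t' s2"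
    using assms by (auto simp: runs_def)
  then show ?thesis using exec.LoopT[of i s A c t s1 t' s2, OF assms(1,2)] unfolding runs_def
    by (intro exI[of _ "1 + (t + (1 + t'))"]) auto
qed

lemma runs_loopF: "0 < i \<Longrightarrow> peek (s i) \<notin> A \<Longrightarrow> runs (Loop i A c) s s 1"
  unfolding runs_def by (blast intro: exec.LoopF)

text \<open>Unary digits on top, closed by the delimiter 3, so numbers can be stacked without gaps.
  The top symbol tells zero (3), a positive number (1) and an empty stack (0) apart.\<close>

definition num :: "nat \<Rightarrow> nat list" where
  "num n = replicate n 1 @ [3]"

lemma num_0 [simp]: "num 0 @ X = 3 # X"
  by (simp add: num_def)

lemma num_Suc [simp]: "num (Suc n) @ X = 1 # num n @ X"
  by (simp add: num_def)

lemma replicate_3: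
  "replicate n (Suc 0) @ 3 # X = num n @ X" "replicate n (Suc 0) @ [3] = num n"
  by (simp_all add: num_def)

lemma peek_num [simp]: "peek (num n @ X) = (if n = 0 then 3 else 1)"
  by (cases n) auto

text \<open>Only the digits are moved and the delimiter stays behind, so the number is added to the
  one on top of \<open>j\<close>.\<close>

definition mvl :: "nat \<Rightarrow> nat \<Rightarrow> prog" where
  "mvl i j = Loop i {1} (Pop i ;; Push j 1)"

lemma runs_mvl:
  assumes "0 < i" "0 < j" "i \<noteq> j" "s i = num n @ X"
  shows "runs (mvl i j) s (s(i := 3 # X, j := replicate n 1 @ s j)) (5 * n + 1)"
  using assms(4)
proof (induction n arbitrary: s)
  case 0
  then show ?case unfolding mvl_def using assms(1,3)
    by (intro runs_le[OF runs_loopF]) (auto simp: fun_eq_iff)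
next
  case (Suc n)
  have s: "s i = 1 # num n @ X" using Suc.prems by simp
  have "runs (Loop i {1} (Pop i ;; Push j 1)) s (s(i := 3 # X, j := replicate (Suc n) 1 @ s j))
      ((1 + 2) + (5 * n + 1) + 2)"
  proof (rule runs_loopT)
    show "runs (Pop i ;; Push j 1) s (s(i := num n @ X, j := 1 # s j)) (1 + 2)"
      using runs_seq[OF runs_pop[of i s 1 "num n @ X"] runs_push[of j]] s assms by simp
    show "runs (Loop i {1} (Pop i ;; Push j 1)) (s(i := num n @ X, j := 1 # s j))
      (s(i := 3 # X, j := replicate (Suc n) 1 @ s j)) (5 * n + 1)"
      using assms
      by (intro runs_le[OF Suc.IH[unfolded mvl_def]])
        (auto simp: fun_eq_iff replicate_append_same[symmetric])
  qed (use assms s in auto)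
  then show ?case unfolding mvl_def by (rule runs_le) auto
qed

text \<open>All digits are alike, so the reversal caused by moving them is harmless; only the
  delimiter has to be placed first.\<close>

definition mv :: "nat \<Rightarrow> nat \<Rightarrow> prog" where
  "mv i j = Push j 3 ;; mvl i j ;; Pop i"

lemma runs_mv:
  assumes "0 < i" "0 < j" "i \<noteq> j" "s i = num n @ X"
  shows "runs (mv i j) s (s(i := X, j := num n @ s j)) (5 * n + 4)"
  unfolding mv_def using assms
  by (intro runs_le[OF runs_seq[OF runs_push runs_seq[OF runs_mvl[where n = n and X = X] runs_pop[where a = 3 and X = X]]]])
    (auto simp: fun_eq_iff replicate_3)

definition clr :: "nat \<Rightarrow> prog" where
  "clr i = Loop i {1} (Pop i) ;; Pop i"

lemma runs_clr:
  assumes "0 < i" "s i = num n @ X"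
  shows "runs (clr i) s (s(i := X)) (3 * n + 2)"
proof -
  have "runs (Loop i {1} (Pop i)) s (s(i := 3 # X)) (3 * n + 1)" using assms(2)
  proof (induction n arbitrary: s)
    case 0
    then show ?case using assms(1)
      by (intro runs_le[OF runs_loopF]) (auto simp: fun_eq_iff)
  next
    case (Suc n)
    show ?case
      by (rule runs_le[OF runs_loopT[OF _ _ runs_pop[where a = 1 and X = "num n @ X"] Suc.IH]])
        (use Suc.prems assms(1) in auto)
  qed
  then show ?thesis unfolding clr_def
    by (rule runs_le[OF runs_seq[OF _ runs_pop[where a = 3 and X = X]]]) (use assms in auto)
qed

definition emit_num :: "nat \<Rightarrow> prog" where
  "emit_num i = Loop i {1} (Pop i ;; Emit 1) ;; Pop i"

lemma runs_emit_num:
  assumes "0 < i" "s i = num n @ X"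
  shows "runs (emit_num i) s (s(i := X, 0 := s 0 @ replicate n 1)) (4 * n + 2)"
proof -
  have "runs (Loop i {1} (Pop i ;; Emit 1)) s (s(i := 3 # X, 0 := s 0 @ replicate n 1)) (4 * n + 1)"
    using assms(2)
  proof (induction n arbitrary: s)
    case 0
    then show ?case using assms(1)
      by (intro runs_le[OF runs_loopF]) (auto simp: fun_eq_iff)
  next
    case (Suc n)
    show ?case
      by (rule runs_le[OF runs_loopT[OF _ _
              runs_seq[OF runs_pop[where a = 1 and X = "num n @ X"] runs_emit] Suc.IH]])
        (use Suc.prems assms(1) in \<open>auto simp: fun_eq_iff\<close>)
  qed
  then show ?thesis unfolding emit_num_def
    by (rule runs_le[OF runs_seq[OF _ runs_pop[where a = 3 and X = X]]])
      (use assms in \<open>auto simp: fun_eq_iff\<close>)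
qed

text \<open>Reading destroys, so every digit goes to \<open>j\<close> and also to the scratch stack
  \<open>z\<close>, from which the original is rebuilt.\<close>

definition cp :: "nat \<Rightarrow> nat \<Rightarrow> nat \<Rightarrow> prog" where
  "cp i j z = Push j 3 ;; Push z 3 ;; Loop i {1} (Pop i ;; Push j 1 ;; Push z 1) ;; mvl z i ;; Pop z"

lemma runs_cp:
  assumes "0 < i" "0 < j" "0 < z" "i \<noteq> j" "i \<noteq> z" "j \<noteq> z" "s i = num n @ X"
  shows "runs (cp i j z) s (s(j := num n @ s j)) (12 * n + 7)"
proof -
  have loop: "runs (Loop i {1} (Pop i ;; Push j 1 ;; Push z 1)) s
      (s(i := 3 # X, j := replicate n 1 @ s j, z := replicate n 1 @ s z)) (7 * n + 1)"
    if "s i = num n @ X" for s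
    using that
  proof (induction n arbitrary: s)
    case 0
    then show ?case using assms
      by (intro runs_le[OF runs_loopF]) (auto simp: fun_eq_iff)
  next
    case (Suc n)
    have *: "runs (Pop i ;; Push j 1 ;; Push z 1) s (s(i := num n @ X, j := 1 # s j, z := 1 # s z)) 5"
      by (rule runs_le[OF runs_seq[OF runs_pop[where a = 1 and X = "num n @ X"] runs_seq[OF runs_push runs_push]]])
        (use Suc.prems assms in \<open>auto simp: fun_eq_iff\<close>)
    show ?case
      by (rule runs_le[OF runs_loopT[OF _ _ * Suc.IH]])
        (use Suc.prems assms in \<open>auto simp: fun_eq_iff replicate_append_same[symmetric]\<close>)
  qed
  show ?thesis unfolding cp_def
    by (rule runs_le[OF runs_seq[OF runs_push runs_seq[OF runs_push runs_seq[OF loop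
          runs_seq[OF runs_mvl[where n = n and X = "s z"] runs_pop[where a = 3 and X = "s z"]]]]]])
      (use assms in \<open>auto simp: fun_eq_iff replicate_3\<close>)
qed

text \<open>Consumes two numbers and adds their distance in unary to a third stack.\<close>

definition eqacc :: "nat \<Rightarrow> nat \<Rightarrow> nat \<Rightarrow> prog" where
  "eqacc i j f = Loop i {1} (Pop i ;; Cond j {1} (Pop j) (Push f 1)) ;; Pop i ;; mvl j f ;; Pop j"

text \<open>With truncated subtraction this is the absolute difference. A sum of such distances
  vanishes only if all of them do, so one accumulator decides a conjunction of equalities.\<close>

definition ndist :: "nat \<Rightarrow> nat \<Rightarrow> nat" where
  "ndist m n = (m - n) + (n - m)"

lemma ndist_0 [simp]: "ndist m n = 0 \<longleftrightarrow> m = n"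
  by (auto simp: ndist_def)

lemma ndist_le: "m \<le> M \<Longrightarrow> n \<le> M \<Longrightarrow> ndist m n \<le> M"
  by (auto simp: ndist_def)

lemma runs_eqacc:
  assumes "0 < i" "0 < j" "0 < f" "i \<noteq> j" "i \<noteq> f" "j \<noteq> f" "s i = num m @ X" "s j = num n @ Y"
  shows "runs (eqacc i j f) s (s(i := X, j := Y, f := replicate (ndist m n) 1 @ s f)) (7 * m + 5 * n + 4)"
proof -
  have loop: "runs (Loop i {1} (Pop i ;; Cond j {1} (Pop j) (Push f 1))) s
      (s(i := 3 # X, j := num (n - m) @ Y, f := replicate (m - n) 1 @ s f)) (7 * m + 1)"
    if "s i = num m @ X" "s j = num n @ Y" for s
    using that
  proof (induction m arbitrary: s n)
    case 0
    then show ?case using assms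
      by (intro runs_le[OF runs_loopF]) (auto simp: fun_eq_iff)
  next
    case (Suc m)
    show ?case
    proof (cases n)
      case 0
      have *: "runs (Pop i ;; Cond j {1} (Pop j) (Push f 1)) s (s(i := num m @ X, f := 1 # s f)) 5"
        by (rule runs_le[OF runs_seq[OF runs_pop[where a = 1 and X = "num m @ X"] runs_cond[where T = 2]]])
          (use Suc.prems assms 0 in \<open>auto simp: fun_eq_iff intro!: runs_le[OF runs_push]\<close>)
      show ?thesis
        by (rule runs_le[OF runs_loopT[OF _ _ * Suc.IH[of _ 0]]])
          (use Suc.prems assms 0 in \<open>auto simp: fun_eq_iff replicate_append_same[symmetric]\<close>)
    next
      case (Suc n')
      have *: "runs (Pop i ;; Cond j {1} (Pop j) (Push f 1)) s (s(i := num m @ X, j := num n' @ Y)) 4"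
        by (rule runs_le[OF runs_seq[OF runs_pop[where a = 1 and X = "num m @ X"] runs_cond[where T = 1]]])
          (use Suc.prems assms Suc in \<open>auto simp: fun_eq_iff intro!: runs_le[OF runs_pop]\<close>)
      show ?thesis
        by (rule runs_le[OF runs_loopT[OF _ _ * Suc.IH[of _ n']]])
          (use Suc.prems assms Suc in \<open>auto simp: fun_eq_iff\<close>)
    qed
  qed
  show ?thesis unfolding eqacc_def
    by (rule runs_le[OF runs_seq[OF loop runs_seq[OF runs_pop[where a = 3 and X = X]
          runs_seq[OF runs_mvl[where n = "n - m" and X = Y] runs_pop[where a = 3 and X = Y]]]]])
      (use assms in \<open>auto simp: fun_eq_iff replicate_3 ndist_def add.commute replicate_add[symmetric]\<close>)
qed

fun mvs :: "nat \<Rightarrow> nat \<Rightarrow> nat \<Rightarrow> prog" where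
  "mvs 0 i j = Skip"
| "mvs (Suc n) i j = mv i j ;; mvs n i j"

definition nums :: "nat list \<Rightarrow> nat list" where
  "nums ns = concat (map num ns)"

lemma nums_simps [simp]: "nums [] = []" "nums (n # ns) = num n @ nums ns"
    "nums (ms @ ns) = nums ms @ nums ns"
  by (simp_all add: nums_def)

lemma runs_mvs:
  assumes "0 < i" "0 < j" "i \<noteq> j" "s i = nums ns @ X" "\<forall>n \<in> set ns. n \<le> M"
  shows "runs (mvs (length ns) i j) s (s(i := X, j := nums (rev ns) @ s j)) (length ns * (5 * M + 4))"
  using assms(4,5)
proof (induction ns arbitrary: s)
  case Nil
  then show ?case by (auto intro!: runs_le[OF runs_skip])
next
  case (Cons n ns)
  have 1: "runs (mv i j) s (s(i := nums ns @ X, j := num n @ s j)) (5 * n + 4)"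
    by (rule runs_mv) (use assms Cons.prems in auto)
  have 2: "runs (mvs (length ns) i j) (s(i := nums ns @ X, j := num n @ s j))
     (s(i := X, j := nums (rev (n # ns)) @ s j)) (length ns * (5 * M + 4))"
    by (rule runs_le[OF Cons.IH]) (use assms Cons.prems in \<open>auto simp: fun_eq_iff\<close>)
  have "5 * n + 4 \<le> 5 * M + 4" using Cons.prems by simp
  then show ?case using runs_le[OF runs_seq[OF 1 2] refl] by (simp del: fun_upd_apply)
qed

fun push_num :: "nat \<Rightarrow> nat \<Rightarrow> prog" where
  "push_num i 0 = Push i 3"
| "push_num i (Suc n) = push_num i n ;; Push i 1"

lemma runs_push_num: "0 < i \<Longrightarrow> runs (push_num i n) s (s(i := num n @ s i)) (2 * n + 2)"
proof (induction n)
  case 0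
  then show ?case by (auto intro!: runs_le[OF runs_push])
next
  case (Suc n)
  show ?case unfolding push_num.simps
    by (rule runs_le[OF runs_seq[OF Suc.IH runs_push]]) (use Suc.prems in \<open>auto simp: fun_eq_iff\<close>)
qed

text \<open>
  The input, the reversed input, the value stack, the heap entries (address and the addresses of the
  two components) and the next free address; the remaining stacks are scratch space.
\<close>

abbreviation (input) "IN \<equiv> 1 :: nat"
abbreviation (input) "RV \<equiv> 2 :: nat"
abbreviation (input) "VS \<equiv> 3 :: nat"
abbreviation (input) "HS \<equiv> 4 :: nat"
abbreviation (input) "CT \<equiv> 5 :: nat"
abbreviation (input) "YS \<equiv> 6 :: nat"
abbreviation (input) "ZS \<equiv> 7 :: nat"
abbreviation (input) "AS \<equiv> 8 :: nat"
abbreviation (input) "BS \<equiv> 9 :: nat"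
abbreviation (input) "CS \<equiv> 10 :: nat"
abbreviation (input) "FS \<equiv> 11 :: nat"
abbreviation (input) "GS \<equiv> 12 :: nat"
abbreviation (input) "RS \<equiv> 13 :: nat"
abbreviation (input) "XS \<equiv> 14 :: nat"

section \<open>The heap as a stack of entries, and linear search in it\<close>

type_synonym entry = "nat \<times> nat \<times> nat"

definition enc :: "entry list \<Rightarrow> nat list" where
  "enc es = nums (concat (map (\<lambda>(k, p, q). [k, p, q]) es))"

lemma enc_simps [simp]: "enc [] = []" "enc ((k, p, q) # es) = num k @ num p @ num q @ enc es"
  by (simp_all add: enc_def)

definition restore :: prog where
  "restore = Loop GS {1, 3} (mv GS HS)"

lemma runs_restore:
  assumes "s GS = nums ns" "\<forall>n \<in> set ns. n \<le> M"
  shows "runs restore s (s(GS := [], HS := nums (rev ns) @ s HS)) (length ns * (5 * M + 6) + 1)"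
  using assms
proof (induction ns arbitrary: s)
  case Nil
  then show ?case unfolding restore_def
    by (intro runs_le[OF runs_loopF]) (auto simp: fun_eq_iff)
next
  case (Cons n ns)
  have "runs restore s (s(GS := [], HS := nums (rev (n # ns)) @ s HS))
      ((5 * n + 4) + (length ns * (5 * M + 6) + 1) + 2)"
    unfolding restore_def
    by (rule runs_loopT[OF _ _ runs_mv[where n = n and X = "nums ns"]
          runs_le[OF Cons.IH[unfolded restore_def]]]) (use Cons.prems in \<open>auto simp: fun_eq_iff\<close>)
  then show ?case by (rule runs_le) (use Cons.prems in auto)
qed

text \<open>The induction runs over the unread rest \<open>es'\<close>, while the hypothesis on the
  body and its bound \<open>T\<close> stay tied to the whole table \<open>es\<close>. What the body
  finds accumulates on \<open>RS\<close>.\<close>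

lemma runs_scan:
  assumes body: "\<And>s k p q X. (k, p, q) \<in> set es \<Longrightarrow> s HS = num k @ num p @ num q @ X \<Longrightarrow>
      s YS = y \<Longrightarrow> s ZS = z \<Longrightarrow>
      runs body s (s(HS := X, GS := num q @ num p @ num k @ s GS, RS := f (k, p, q) @ s RS)) T"
    and "s HS = enc es" "s YS = y" "s ZS = z"
    and "set es' \<subseteq> set es"
  shows "s HS = enc es' \<Longrightarrow> runs (Loop HS {1, 3} body) s
     (s(HS := [], GS := nums (rev (concat (map (\<lambda>(k, p, q). [k, p, q]) es'))) @ s GS,
        RS := concat (map f (rev es')) @ s RS)) (length es' * (T + 2) + 1)"
  using assms(3-5)
proof (induction es' arbitrary: s)
  case Nil
  then show ?case
    by (intro runs_le[OF runs_loopF]) (auto simp: fun_eq_iff)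
next
  case (Cons e es')
  obtain k p q where e: "e = (k, p, q)" by (cases e)
  have "runs (Loop HS {1, 3} body) s
     (s(HS := [], GS := nums (rev (concat (map (\<lambda>(k, p, q). [k, p, q]) (e # es')))) @ s GS,
        RS := concat (map f (rev (e # es'))) @ s RS)) (T + (length es' * (T + 2) + 1) + 2)"
    by (rule runs_loopT[OF _ _ body[of k p q _ "enc es'"] runs_le[OF Cons.IH]])
       (use Cons.prems e in \<open>auto simp: fun_eq_iff\<close>)
  then show ?case by (rule runs_le) auto
qed

text \<open>A stack is searched by dismantling it: \<open>body\<close> parks each entry on
  \<open>GS\<close>, in reverse, and \<open>restore\<close> brings all of them back.\<close>

definition scan :: "prog \<Rightarrow> prog" where
  "scan body = Loop HS {1, 3} body ;; restore"

lemma runs_scan_restore: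
  assumes body: "\<And>s k p q X. (k, p, q) \<in> set es \<Longrightarrow> s HS = num k @ num p @ num q @ X \<Longrightarrow>
      s YS = y \<Longrightarrow> s ZS = z \<Longrightarrow>
      runs body s (s(HS := X, GS := num q @ num p @ num k @ s GS, RS := f (k, p, q) @ s RS)) T"
    and s: "s HS = enc es" "s YS = y" "s ZS = z" "s GS = []"
    and M: "\<forall>(k, p, q) \<in> set es. k \<le> M \<and> p \<le> M \<and> q \<le> M"
  shows "runs (scan body) s (s(RS := concat (map f (rev es)) @ s RS)) (length es * (T + 15 * M + 20) + 2)"
proof -
  let ?ns = "concat (map (\<lambda>(k, p, q). [k, p, q]) es)"
  have l: "length ?ns = 3 * length es" by (induction es) auto
  have "\<forall>n \<in> set (rev ?ns). n \<le> M" using M by auto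
  note 2 = runs_restore[OF _ this]
  note 1 = runs_scan[of es y z body f T s es, OF body s(1-3) subset_refl s(1)]
  have "runs (scan body) s (s(RS := concat (map f (rev es)) @ s RS))
     ((length es * (T + 2) + 1) + (length (rev ?ns) * (5 * M + 6) + 1))"
    unfolding scan_def
    by (rule runs_le[OF runs_seq[OF 1 2]]) (use s in \<open>auto simp: fun_eq_iff enc_def\<close>)
  then show ?thesis by (rule runs_le) (auto simp: l algebra_simps)
qed


lemma replicate_num: "replicate m (Suc 0) @ num n @ X = num (m + n) @ X"
  by (simp add: num_def replicate_add)

text \<open>The distance between the address of the entry and the one sought is left on
  \<open>FS\<close>, so a digit on its top signals a mismatch.\<close>

definition find_name :: prog where
  "find_name = scan (cp HS BS XS ;; mv HS GS ;; cp YS CS XS ;; Push FS 3 ;; eqacc BS CS FS ;;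
     Cond FS {1} (clr FS ;; mv HS GS ;; mv HS GS)
       (clr FS ;; cp HS RS XS ;; mv HS GS ;; cp HS RS XS ;; mv HS GS))"

text \<open>Both distances are collected in the same number on \<open>FS\<close>; the address of the
  entry, kept on \<open>AS\<close>, is reported only if that number is zero.\<close>

definition find_pair :: prog where
  "find_pair = scan (cp HS AS XS ;; mv HS GS ;; Push FS 3 ;; cp HS BS XS ;; cp YS CS XS ;;
     eqacc BS CS FS ;; mv HS GS ;; cp HS BS XS ;; cp ZS CS XS ;; eqacc BS CS FS ;; mv HS GS ;;
     Cond FS {1} (clr FS ;; clr AS) (clr FS ;; mv AS RS))"

lemmas runs_steps = runs_seq runs_cp runs_mv runs_push runs_eqacc runs_clr runs_cond

lemma concat_map_filter:
  "(\<And>x. \<not> P x \<Longrightarrow> f x = []) \<Longrightarrow> concat (map f xs) = concat (map f (filter P xs))"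
  by (induction xs) auto

lemma runs_find_name:
  assumes s: "s HS = enc es" "s YS = num n @ y" "s GS = []"
    and M: "\<forall>(k, p, q) \<in> set es. k \<le> M \<and> p \<le> M \<and> q \<le> M" "n \<le> M"
    and f: "filter (\<lambda>e. fst e = n) es = [(k, p, q)]"
  shows "runs find_name s (s(RS := num q @ num p @ s RS)) (length es * (115 * M + 120) + 2)"
proof -
  let ?f = "\<lambda>(k, p, q). if k = n then num q @ num p else []"
  have "(k, p, q) \<in> set (filter (\<lambda>e. fst e = n) es)" using f by simp
  then have "k = n" by simp
  then have "concat (map ?f (rev es)) = num q @ num p"
    using concat_map_filter[of "\<lambda>e. fst e = n" ?f "rev es"] f by (auto simp: rev_filter[symmetric])
  moreover have "runs find_name s (s(RS := concat (map ?f (rev es)) @ s RS))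
     (length es * ((100 * M + 100) + 15 * M + 20) + 2)"
    unfolding find_name_def
  proof (rule runs_scan_restore[OF _ s(1) s(2) refl s(3) M(1)])
    fix s :: store and k p q X
    assume *: "(k, p, q) \<in> set es" "s HS = num k @ num p @ num q @ X" "s YS = num n @ y"
    have le: "k \<le> M" "p \<le> M" "q \<le> M" "ndist k n \<le> M" using * M by (auto intro: ndist_le)
    show "runs (cp HS BS XS ;; mv HS GS ;; cp YS CS XS ;; Push FS 3 ;; eqacc BS CS FS ;;
       Cond FS {1} (clr FS ;; mv HS GS ;; mv HS GS)
       (clr FS ;; cp HS RS XS ;; mv HS GS ;; cp HS RS XS ;; mv HS GS)) s
       (s(HS := X, GS := num q @ num p @ num k @ s GS, RS := ?f (k, p, q) @ s RS)) (100 * M + 100)"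
    proof (cases "k = n")
      case True
      show ?thesis
        \<comment> \<open>Final store and time are schematic here and are filled in by the rules;
          the two remaining goals compare them with the store and the bound claimed.\<close>
        apply (rule runs_le)
          apply ((rule runs_steps | (simp add: * True replicate_3; fail)
            | (simp add: * True replicate_3))+)[1]
         apply (auto simp: fun_eq_iff * True)[1]
        using le M(2) True apply simp
        done
    next
      case False
      show ?thesis
        apply (rule runs_le)
          apply ((rule runs_steps | (simp add: * False replicate_3; fail)
            | (simp add: * False replicate_3))+)[1]
         apply (auto simp: fun_eq_iff * False)[1]
        using le M(2) False apply simp
        done
    qed
  qed
  ultimately show ?thesis by (auto intro: runs_le)
qed

lemma runs_find_pair:
  assumes s: "s HS = enc es" "s YS = num m @ y" "s ZS = num n @ z" "s GS = []"
    and M: "\<forall>(k, p, q) \<in> set es. k \<le> M \<and> p \<le> M \<and> q \<le> M" "m \<le> M" "n \<le> M"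
  shows "runs find_pair s (s(RS :=
      nums (rev (map fst (filter (\<lambda>(k, p, q). p = m \<and> q = n) es))) @ s RS)) (length es * (215 * M + 120) + 2)"
proof -
  let ?f = "\<lambda>(k, p, q). if p = m \<and> q = n then num k else []"
  have "concat (map ?f es) = nums (map fst (filter (\<lambda>(k, p, q). p = m \<and> q = n) es))" for es
    by (induction es) (auto simp: nums_def split: if_splits)
  from this[of "rev es"]
  have "concat (map ?f (rev es)) = nums (rev (map fst (filter (\<lambda>(k, p, q). p = m \<and> q = n) es)))"
    by (simp add: rev_filter rev_map)
  moreover have "runs find_pair s (s(RS := concat (map ?f (rev es)) @ s RS))
     (length es * ((200 * M + 100) + 15 * M + 20) + 2)"
    unfolding find_pair_def
  proof (rule runs_scan_restore[OF _ s(1) s(2) s(3) s(4) M(1)])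
    fix s :: store and k p q X
    assume *: "(k, p, q) \<in> set es" "s HS = num k @ num p @ num q @ X" "s YS = num m @ y" "s ZS = num n @ z"
    have le: "k \<le> M" "p \<le> M" "q \<le> M" "ndist p m \<le> M" "ndist q n \<le> M"
      using * M by (auto intro: ndist_le)
    show "runs (cp HS AS XS ;; mv HS GS ;; Push FS 3 ;; cp HS BS XS ;; cp YS CS XS ;;
       eqacc BS CS FS ;; mv HS GS ;; cp HS BS XS ;; cp ZS CS XS ;; eqacc BS CS FS ;; mv HS GS ;;
       Cond FS {1} (clr FS ;; clr AS) (clr FS ;; mv AS RS)) s
       (s(HS := X, GS := num q @ num p @ num k @ s GS, RS := ?f (k, p, q) @ s RS)) (200 * M + 100)"
    proof (cases "p = m \<and> q = n")
      case True
      show ?thesis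
        apply (rule runs_le)
          apply ((rule runs_steps | (simp add: * True replicate_3 replicate_num; fail)
            | (simp add: * True replicate_3 replicate_num))+)[1]
         apply (auto simp: fun_eq_iff * True)[1]
        using le M(2,3) True apply simp
        done
    next
      case False
      then have F: "\<not> (q = n \<and> p = m)" by blast
      show ?thesis
        apply (rule runs_le)
          apply ((rule runs_steps | (simp add: * F replicate_3 replicate_num; fail)
            | (simp add: * F replicate_3 replicate_num))+)[1]
         apply (use F in \<open>auto simp: fun_eq_iff *\<close>)[1]
        using le M(2,3) apply simp
        done
    qed
  qed
  ultimately show ?thesis by (auto intro: runs_le)
qed


section \<open>Primitive operations on addresses\<close>

definition alloc :: prog where
  "alloc = cp CT RS XS ;; mv ZS HS ;; mv YS HS ;; cp CT HS XS ;; Push CT 1"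

definition uncons_prog :: prog where
  "uncons_prog = mv VS YS ;; find_name ;; clr YS ;; mv RS VS ;; mv RS VS"

text \<open>Cells have positive addresses, so a digit on top of \<open>RS\<close> means that the
  pair exists already; if \<open>RS\<close> is empty, a new entry is allocated.\<close>

definition cons_prog :: prog where
  "cons_prog = mv VS YS ;; mv VS ZS ;; find_pair ;; Cond RS {1} (clr YS ;; clr ZS) alloc ;; mv RS VS"

definition eq_prog :: prog where
  "eq_prog = mv VS YS ;; Push FS 3 ;; eqacc VS YS FS ;;
     Cond FS {1} (clr FS ;; Push VS 3 ;; Push VS 1) (clr FS ;; Push VS 3)"

definition pick_prog :: "nat \<Rightarrow> prog" where
  "pick_prog n = mvs n VS AS ;; cp VS BS XS ;; mvs n AS VS ;; mv BS VS"

definition del_prog :: "nat \<Rightarrow> prog" where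
  "del_prog n = mvs n VS AS ;; clr VS ;; mvs n AS VS"

lemma runs_uncons_prog:
  assumes s: "s VS = num n @ v" "s HS = enc es" "s YS = []" "s GS = []" "s RS = []"
    and M: "\<forall>(k, p, q) \<in> set es. k \<le> M \<and> p \<le> M \<and> q \<le> M" "n \<le> M"
    and f: "filter (\<lambda>e. fst e = n) es = [(k, p, q)]"
  shows "runs uncons_prog s (s(VS := num p @ num q @ v)) (length es * (115 * M + 120) + 20 * M + 20)"
proof -
  have "(k, p, q) \<in> set (filter (\<lambda>e. fst e = n) es)" using f by simp
  then have le: "p \<le> M" "q \<le> M" using M by auto
  show ?thesis unfolding uncons_prog_def
    apply (rule runs_le)
      apply ((rule runs_seq runs_mv runs_clr runs_find_name[OF _ _ _ M f, where y = "[]"]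
          | (simp add: s del: append_Nil2; fail))+)[1]
     apply (auto simp: fun_eq_iff s)[1]
    using le M(2) apply simp
    done
qed

lemma runs_cons_prog_old:
  assumes s: "s VS = num m @ num n @ v" "s HS = enc es" "s YS = []" "s ZS = []" "s GS = []" "s RS = []"
    and M: "\<forall>(k, p, q) \<in> set es. k \<le> M \<and> p \<le> M \<and> q \<le> M" "m \<le> M" "n \<le> M"
    and f: "filter (\<lambda>(k, p, q). p = m \<and> q = n) es = [(k, m, n)]" "0 < k"
  shows "runs cons_prog s (s(VS := num k @ v)) (length es * (215 * M + 120) + 100 * M + 100)"
proof -
  have k: "k \<noteq> 0" using f(2) by simp
  have "(k, m, n) \<in> set (filter (\<lambda>(k, p, q). p = m \<and> q = n) es)" using f by simp
  then have le: "k \<le> M" using M by auto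
  show ?thesis unfolding cons_prog_def
    apply (rule runs_le)
      apply ((rule runs_seq runs_mv runs_clr runs_cond
          runs_find_pair[OF _ _ _ _ M, where y = "[]" and z = "[]"]
          | (simp add: s f k del: append_Nil2; fail) | (simp add: s f k del: append_Nil2))+)[1]
     apply (use f(2) in \<open>auto simp: fun_eq_iff s f\<close>)[1]
    using le M apply simp
    done
qed

lemma runs_cons_prog_new:
  assumes s: "s VS = num m @ num n @ v" "s HS = enc es" "s YS = []" "s ZS = []" "s GS = []" "s RS = []"
      "s CT = num c @ []"
    and M: "\<forall>(k, p, q) \<in> set es. k \<le> M \<and> p \<le> M \<and> q \<le> M" "m \<le> M" "n \<le> M" "c \<le> M"
    and f: "filter (\<lambda>(k, p, q). p = m \<and> q = n) es = []"
  shows "runs cons_prog s (s(VS := num c @ v, HS := enc ((c, m, n) # es), CT := num (Suc c)))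
     (length es * (215 * M + 120) + 100 * M + 100)"
proof -
  have num: "num (Suc c) = 1 # num c" by (simp add: num_def)
  show ?thesis unfolding cons_prog_def alloc_def
    apply (rule runs_le)
      apply ((rule runs_seq runs_mv runs_clr runs_cond runs_push runs_cp
          runs_find_pair[OF _ _ _ _ M(1-3), where y = "[]" and z = "[]"]
          | (simp add: s f del: append_Nil2; fail) | (simp add: s f del: append_Nil2))+)[1]
     apply (auto simp: fun_eq_iff s f num)[1]
    using M apply simp
    done
qed

lemma runs_eq_prog:
  assumes s: "s VS = num m @ num n @ v" and M: "m \<le> M" "n \<le> M"
  shows "runs eq_prog s (s(VS := num (if m = n then 0 else 1) @ v)) (30 * M + 30)"
proof -
  have *: "num 1 @ v = 1 # 3 # v" for v by (simp add: num_def)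
  have M': "ndist n m \<le> M" using M by (intro ndist_le)
  show ?thesis
  proof (cases "m = n")
    case True
    show ?thesis unfolding eq_prog_def
      apply (rule runs_le)
        apply ((rule runs_steps | (simp add: s True replicate_3; fail)
            | (simp add: s True replicate_3))+)[1]
       apply (auto simp: fun_eq_iff s True)[1]
      using M M' True apply simp
      done
  next
    case False
    show ?thesis unfolding eq_prog_def
      apply (rule runs_le)
        apply ((rule runs_steps | (simp add: s False False[symmetric] replicate_3; fail)
            | (simp add: s False False[symmetric] replicate_3))+)[1]
       apply (use False * in \<open>auto simp: fun_eq_iff s\<close>)[1]
      using M M' apply simp
      done
  qed
qed

lemma runs_pick_prog:
  assumes s: "s VS = nums ns" and n: "n < length ns" and M: "\<forall>n \<in> set ns. n \<le> M"
  shows "runs (pick_prog n) s (s(VS := nums (ns ! n # ns))) ((n + 1) * (40 * M + 40))"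
proof -
  let ?xs = "take n ns" and ?ys = "drop (Suc n) ns"
  have ns: "nums ns = nums ?xs @ num (ns ! n) @ nums ?ys"
    using n by (metis id_take_nth_drop nums_simps(2,3))
  have l: "length ?xs = n" "length (rev ?xs) = n" using n by auto
  have M': "\<forall>n \<in> set ?xs. n \<le> M" "\<forall>n \<in> set (rev ?xs). n \<le> M" using M by (auto dest: in_set_takeD)
  note 1 = runs_mvs[of _ _ _ ?xs, unfolded l, OF _ _ _ _ M'(1)]
  note 2 = runs_mvs[of _ _ _ "rev ?xs", unfolded l, OF _ _ _ _ M'(2)]
  have le: "ns ! n \<le> M" using M n by auto
  show ?thesis unfolding pick_prog_def
    apply (rule runs_le)
      apply (rule runs_seq[OF 1[where X = "num (ns ! n) @ nums ?ys"]])
          apply (simp, simp, simp, simp add: s ns)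
      apply (rule runs_seq[OF runs_cp[where n = "ns ! n" and X = "nums ?ys"]])
            apply (simp, simp, simp, simp, simp, simp, simp)
      apply (rule runs_seq[OF 2[where X = "s AS"]])
          apply (simp, simp, simp, simp)
      apply (rule runs_mv[where n = "ns ! n" and X = "s BS"])
         apply (simp, simp, simp, simp)
     apply (simp add: fun_eq_iff ns)
    using le by (simp add: algebra_simps)
qed

lemma runs_del_prog:
  assumes s: "s VS = nums ns" and n: "n < length ns" and M: "\<forall>n \<in> set ns. n \<le> M"
  shows "runs (del_prog n) s (s(VS := nums (take n ns @ drop (Suc n) ns))) ((n + 1) * (40 * M + 40))"
proof -
  let ?xs = "take n ns" and ?ys = "drop (Suc n) ns"
  have ns: "nums ns = nums ?xs @ num (ns ! n) @ nums ?ys"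
    using n by (metis id_take_nth_drop nums_simps(2,3))
  have l: "length ?xs = n" "length (rev ?xs) = n" using n by auto
  have M': "\<forall>n \<in> set ?xs. n \<le> M" "\<forall>n \<in> set (rev ?xs). n \<le> M" using M by (auto dest: in_set_takeD)
  note 1 = runs_mvs[of _ _ _ ?xs, unfolded l, OF _ _ _ _ M'(1)]
  note 2 = runs_mvs[of _ _ _ "rev ?xs", unfolded l, OF _ _ _ _ M'(2)]
  have le: "ns ! n \<le> M" using M n by auto
  show ?thesis unfolding del_prog_def
    apply (rule runs_le)
      apply (rule runs_seq[OF 1[where X = "num (ns ! n) @ nums ?ys"]])
          apply (simp, simp, simp, simp add: s ns)
      apply (rule runs_seq[OF runs_clr[where n = "ns ! n" and X = "nums ?ys"]])
            apply (simp, simp)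
      apply (rule 2[where X = "s AS"])
          apply (simp, simp, simp, simp)
     apply (simp add: fun_eq_iff)
    using le by (simp add: algebra_simps)
qed

section \<open>A hash-consed heap of values\<close>


text \<open>Terms of every arity, lists and memo tables are all built from binary cells, so heap
  entries have a fixed format and one hash-consing operation serves all data.\<close>

datatype val = Atom nat | Cell (car: val) (cdr: val)

datatype op = OAtom nat | OPick nat | ODel nat | OCons | OUncons | OEq

fun op_prog :: "op \<Rightarrow> prog" where
  "op_prog (OAtom i) = push_num VS i"
| "op_prog (OPick n) = pick_prog n"
| "op_prog (ODel n) = del_prog n"
| "op_prog OCons = cons_prog"
| "op_prog OUncons = uncons_prog"
| "op_prog OEq = eq_prog"

fun op_cost :: "op \<Rightarrow> nat" where
  "op_cost (OPick n) = n + 1"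
| "op_cost (ODel n) = n + 1"
| "op_cost _ = 1"

text \<open>Heaps list the allocated cells, the most recent one first.\<close>

fun heap_index :: "val list \<Rightarrow> val \<Rightarrow> nat" where
  "heap_index [] v = 0"
| "heap_index (x # H) v = (if v = x then length H else heap_index H v)"

locale signature =
  fixes ars :: "nat list"
begin

text \<open>Atom 0 is the empty list, atom 1 is a tag, and atom \<open>i + 2\<close> stands for constructor \<open>i\<close>.\<close>

definition atoms :: nat where
  "atoms = length ars + 2"

definition addr :: "val list \<Rightarrow> val \<Rightarrow> nat" where
  "addr H v = (case v of Atom i \<Rightarrow> i | Cell _ _ \<Rightarrow> atoms + heap_index H v)"

definition known :: "val list \<Rightarrow> val \<Rightarrow> bool" where
  "known H v = (case v of Atom i \<Rightarrow> i < atoms | Cell _ _ \<Rightarrow> v \<in> set H)"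

text \<open>Distinctness is maximal sharing. Components are atoms or older cells, so the heap is
  closed under components.\<close>

fun heap_ok :: "val list \<Rightarrow> bool" where
  "heap_ok [] \<longleftrightarrow> True"
| "heap_ok (x # H) \<longleftrightarrow>
     heap_ok H \<and> x \<notin> set H \<and> (\<exists>a b. x = Cell a b \<and> known H a \<and> known H b)"

lemma known_mono: "known H v \<Longrightarrow> known (D @ H) v"
  by (auto simp: known_def split: val.splits)

lemma heap_okD: "heap_ok H \<Longrightarrow> x \<in> set H \<Longrightarrow> \<exists>a b. x = Cell a b \<and> known H a \<and> known H b"
proof (induction H)
  case (Cons y H)
  then have "\<exists>a b. x = Cell a b \<and> known H a \<and> known H b" by auto
  then show ?case using known_mono[of H _ "[y]"] by auto
qed simp

lemma heap_ok_distinct: "heap_ok H \<Longrightarrow> distinct H"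
  by (induction H) auto

lemma heap_index_less: "v \<in> set H \<Longrightarrow> heap_index H v < length H"
  by (induction H) auto

lemma heap_index_inj: "v \<in> set H \<Longrightarrow> w \<in> set H \<Longrightarrow> heap_index H v = heap_index H w \<Longrightarrow> v = w"
  by (induction H) (auto split: if_splits dest: heap_index_less)

lemma addr_less: "known H v \<Longrightarrow> addr H v < atoms + length H"
  by (auto simp: known_def addr_def heap_index_less split: val.splits)

lemma addr_inj: "known H v \<Longrightarrow> known H w \<Longrightarrow> addr H v = addr H w \<longleftrightarrow> v = w"
  by (auto simp: known_def addr_def dest: heap_index_inj split: val.splits)

text \<open>\<open>heap_index\<close> counts from the oldest cell, so allocation leaves all existing
  addresses valid.\<close>

lemma addr_Cons:
  assumes "heap_ok (x # H)" "known H v"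
  shows "addr (x # H) v = addr H v"
  using assms by (auto simp: addr_def known_def split: val.splits)

lemma addr_append:
  assumes "heap_ok (D @ H)" "known H v"
  shows "addr (D @ H) v = addr H v"
  using assms by (induction D) (auto simp: addr_Cons known_mono)

definition entries :: "val list \<Rightarrow> entry list" where
  "entries H = map (\<lambda>x. (addr H x, addr H (car x), addr H (cdr x))) H"

lemma entries_Cons:
  assumes "heap_ok (Cell a b # H)"
  shows "entries (Cell a b # H) = (atoms + length H, addr H a, addr H b) # entries H"
proof -
  have "addr (Cell a b # H) (Cell a b) = atoms + length H" by (simp add: addr_def)
  moreover have "addr (Cell a b # H) x = addr H x" "addr (Cell a b # H) (car x) = addr H (car x)"
    "addr (Cell a b # H) (cdr x) = addr H (cdr x)" if "x \<in> set H" for x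
    using heap_okD[of H x] that assms by (auto intro!: addr_Cons simp: known_def)
  ultimately show ?thesis using assms by (auto simp: entries_def addr_Cons)
qed

lemma entries_le:
  "heap_ok H \<Longrightarrow> \<forall>(k, p, q) \<in> set (entries H). k \<le> atoms + length H \<and> p \<le> atoms + length H \<and> q \<le> atoms + length H"
  using heap_okD addr_less by (fastforce simp: entries_def known_def intro: less_imp_le)

lemma filter_eq_distinct: "distinct xs \<Longrightarrow> filter (\<lambda>x. x = y) xs = (if y \<in> set xs then [y] else [])"
  by (induction xs) auto

lemma filter_entries_name:
  assumes "heap_ok H" "Cell a b \<in> set H"
  shows "filter (\<lambda>e. fst e = addr H (Cell a b)) (entries H)
    = [(addr H (Cell a b), addr H a, addr H b)]"
proof -
  have "filter (\<lambda>x. addr H x = addr H (Cell a b)) H = filter (\<lambda>x. x = Cell a b) H"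
  proof (rule filter_cong)
    fix x assume "x \<in> set H"
    then have "known H x" using heap_okD[OF assms(1)] by (fastforce simp: known_def)
    then show "(addr H x = addr H (Cell a b)) = (x = Cell a b)"
      using assms by (simp add: addr_inj known_def)
  qed simp
  also have "\<dots> = [Cell a b]" using assms heap_ok_distinct by (simp add: filter_eq_distinct)
  finally show ?thesis by (simp add: entries_def filter_map o_def)
qed

lemma filter_entries_pair:
  assumes "heap_ok H" "known H a" "known H b"
  shows "filter (\<lambda>(k, p, q). p = addr H a \<and> q = addr H b) (entries H)
    = (if Cell a b \<in> set H then [(addr H (Cell a b), addr H a, addr H b)] else [])"
proof -
  have "filter (\<lambda>x. addr H (car x) = addr H a \<and> addr H (cdr x) = addr H b) H
      = filter (\<lambda>x. x = Cell a b) H"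
  proof (rule filter_cong)
    fix x assume "x \<in> set H"
    then obtain c d where "x = Cell c d" "known H c" "known H d" using heap_okD[OF assms(1)] by blast
    then show "(addr H (car x) = addr H a \<and> addr H (cdr x) = addr H b) = (x = Cell a b)"
      using assms by (simp add: addr_inj)
  qed simp
  also have "\<dots> = (if Cell a b \<in> set H then [Cell a b] else [])"
    using assms heap_ok_distinct by (simp add: filter_eq_distinct)
  finally show ?thesis by (simp add: entries_def filter_map o_def case_prod_beta)
qed

text \<open>The shape of stores between operations, once the input has been reversed:
  \<open>IN\<close> and all scratch stacks are empty, and \<open>I\<close> is the unread reversed
  input.\<close>

definition st :: "val list \<Rightarrow> val list \<Rightarrow> nat list \<Rightarrow> nat list \<Rightarrow> store" where
  "st V H I out = (\<lambda>_. [])(0 := out, RV := I, VS := nums (map (addr H) V), HS := enc (entries H),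
     CT := num (atoms + length H))"

text \<open>A linear search visits \<open>h\<close> entries and compares unary addresses of size at
  most \<open>atoms + h\<close>, hence the square. The factor 1000 only has to dominate the
  constants in \<open>Q_ge\<close>.\<close>

definition Q :: "nat \<Rightarrow> nat" where
  "Q h = 1000 * (atoms + h + 2)^2"

lemma Q_mono: "h \<le> h' \<Longrightarrow> Q h \<le> Q h'"
  by (auto simp: Q_def intro: power_mono)

lemma Q_ge: "h * (215 * (atoms + h) + 120) + 100 * (atoms + h) + 100 \<le> Q h"
proof -
  define M where "M = atoms + h + 2"
  have "h * (215 * (atoms + h) + 120) \<le> M * (335 * M)"
    unfolding M_def by (intro mult_mono) auto
  moreover have "100 * (atoms + h) + 100 \<le> 100 * M * M" unfolding M_def by (simp add: algebra_simps)
  ultimately show ?thesis unfolding Q_def M_def[symmetric] by (simp add: power2_eq_square)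
qed

fun op_app :: "op \<Rightarrow> val list \<Rightarrow> val list option" where
  "op_app (OAtom i) V = (if i < atoms then Some (Atom i # V) else None)"
| "op_app (OPick n) V = (if n < length V then Some (V ! n # V) else None)"
| "op_app (ODel n) V = (if n < length V then Some (take n V @ drop (Suc n) V) else None)"
| "op_app OCons (a # b # V) = Some (Cell a b # V)"
| "op_app OUncons (Cell a b # V) = Some (a # b # V)"
| "op_app OEq (a # b # V) = Some ((if a = b then Atom 0 else Atom 1) # V)"
| "op_app _ _ = None"

definition heap_ext :: "val list \<Rightarrow> val list \<Rightarrow> bool" where
  "heap_ext H H' \<longleftrightarrow> heap_ok H' \<and> (\<exists>D. H' = D @ H)"

definition all_known :: "val list \<Rightarrow> val list \<Rightarrow> bool" where
  "all_known H V \<longleftrightarrow> (\<forall>v \<in> set V. known H v)"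

lemma heap_ext_refl: "heap_ok H \<Longrightarrow> heap_ext H H"
  by (simp add: heap_ext_def)

lemma heap_ext_trans: "heap_ext H H' \<Longrightarrow> heap_ext H' H'' \<Longrightarrow> heap_ext H H''"
  by (auto simp: heap_ext_def)

lemma all_known_ext: "all_known H V \<Longrightarrow> heap_ext H H' \<Longrightarrow> all_known H' V"
  by (auto simp: all_known_def heap_ext_def known_mono)

lemma addr_ext: "heap_ext H H' \<Longrightarrow> known H v \<Longrightarrow> addr H' v = addr H v"
  by (auto simp: heap_ext_def addr_append)

lemma st_simps [simp]:
  "st V H I out 0 = out" "st V H I out RV = I" "st V H I out VS = nums (map (addr H) V)"
  "st V H I out HS = enc (entries H)" "st V H I out CT = num (atoms + length H)"
  "st V H I out IN = []" "st V H I out YS = []" "st V H I out ZS = []" "st V H I out AS = []"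
  "st V H I out BS = []" "st V H I out CS = []" "st V H I out FS = []" "st V H I out GS = []"
  "st V H I out RS = []" "st V H I out XS = []"
  by (simp_all add: st_def)

lemma st_upd_VS: "(st V H I out)(VS := nums (map (addr H) V')) = st V' H I out"
  by (auto simp: st_def fun_eq_iff)

text \<open>Only \<open>OCons\<close> allocates; every other operation works on the same
  heap.\<close>

lemma runs_op_pure:
  assumes H: "heap_ok H" and V: "all_known H V" and o: "op_app x V = Some V'"
    and x: "x \<noteq> OCons"
  shows "runs (op_prog x) (st V H I out) (st V' H I out) (op_cost x * Q (length H)) \<and> all_known H V'"
proof -
  let ?M = "atoms + length H"
  have M: "\<forall>n \<in> set (map (addr H) V). n \<le> ?M"
    using V addr_less by (auto simp: all_known_def intro: less_imp_le)
  have l: "length (entries H) = length H" by (simp add: entries_def)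
  have Q1: "40 * ?M + 40 \<le> Q (length H)" using Q_ge[of "length H"] by simp
  show ?thesis
  proof (cases x)
    case (OAtom i)
    then have V': "V' = Atom i # V" and i: "i < atoms" using o by (auto split: if_splits)
    have "runs (push_num VS i) (st V H I out) (st V' H I out) (op_cost x * Q (length H))"
      by (rule runs_le[OF runs_push_num])
        (use V' i Q1 OAtom st_upd_VS[of V H I out V'] in \<open>auto simp: addr_def\<close>)
    then show ?thesis using OAtom V' V i by (simp add: all_known_def known_def)
  next
    case (OPick n)
    then have V': "V' = V ! n # V" and n: "n < length V" using o by (auto split: if_splits)
    have "runs (pick_prog n) (st V H I out) (st V' H I out) ((n + 1) * Q (length H))"
      by (rule runs_le[OF runs_pick_prog[OF _ _ M]])
        (use V' n Q1 st_upd_VS[of V H I out V'] in \<open>auto simp: mult_mono intro!: add_mono mult_mono\<close>)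
    then show ?thesis using OPick V' V n by (simp add: all_known_def)
  next
    case (ODel n)
    then have V': "V' = take n V @ drop (Suc n) V" and n: "n < length V" using o by (auto split: if_splits)
    have "runs (del_prog n) (st V H I out) (st V' H I out) ((n + 1) * Q (length H))"
      by (rule runs_le[OF runs_del_prog[OF _ _ M]])
        (use V' n Q1 st_upd_VS[of V H I out V'] in \<open>auto simp: take_map drop_map intro!: add_mono mult_mono\<close>)
    then show ?thesis using ODel V' V n by (auto simp: all_known_def dest: in_set_takeD in_set_dropD)
  next
    case OCons
    then show ?thesis using x by simp
  next
    case OUncons
    obtain a b V0 where Ve: "V = Cell a b # V0" and V': "V' = a # b # V0"
      using o OUncons by (cases "(OUncons, V)" rule: op_app.cases) auto
    have p: "Cell a b \<in> set H" using V Ve by (simp add: all_known_def known_def)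
    have "runs uncons_prog (st V H I out) (st V' H I out) (Q (length H))"
      by (rule runs_le[OF runs_uncons_prog[OF _ _ _ _ _ entries_le[OF H] _ filter_entries_name[OF H p]]])
        (use V' Ve M st_upd_VS[of V H I out V'] Q_ge[of "length H"] in \<open>auto simp: l algebra_simps\<close>)
    then show ?thesis using OUncons Ve V' V heap_okD[OF H p] by (auto simp: all_known_def)
  next
    case OEq
    obtain a b V0 where Ve: "V = a # b # V0" and V': "V' = (if a = b then Atom 0 else Atom 1) # V0"
      using o OEq by (cases "(OEq, V)" rule: op_app.cases) auto
    have "addr H a = addr H b \<longleftrightarrow> a = b" using V Ve addr_inj by (auto simp: all_known_def)
    then have "runs eq_prog (st V H I out) (st V' H I out) (Q (length H))"
      by (intro runs_le[OF runs_eq_prog[where M = ?M and m = "addr H a" and n = "addr H b"]])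
        (use V' Ve M Q1 st_upd_VS[of V H I out V'] in \<open>auto simp: addr_def\<close>)
    then show ?thesis using OEq Ve V' V by (auto simp: all_known_def known_def atoms_def)
  qed
qed

lemma runs_op:
  assumes H: "heap_ok H" and V: "all_known H V" and o: "op_app x V = Some V'"
  shows "\<exists>H'. heap_ext H H' \<and> all_known H' V' \<and> length H' \<le> length H + 1 \<and>
    runs (op_prog x) (st V H I out) (st V' H' I out) (op_cost x * Q (length H))"
proof (cases "x = OCons")
  case False
  then show ?thesis using runs_op_pure[OF H V o False] heap_ext_refl[OF H]
    by (intro exI[of _ H]) auto
next
  case True
  let ?M = "atoms + length H"
  obtain a b V0 where Ve: "V = a # b # V0" and V': "V' = Cell a b # V0"
    using o True by (cases "(OCons, V)" rule: op_app.cases) auto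
  have k: "known H a" "known H b" "all_known H V0" using V Ve by (auto simp: all_known_def)
  have l: "length (entries H) = length H" by (simp add: entries_def)
  have M: "addr H a \<le> ?M" "addr H b \<le> ?M" using k addr_less by (auto intro: less_imp_le)
  show ?thesis
  proof (cases "Cell a b \<in> set H")
    case True
    have "runs cons_prog (st V H I out) (st V' H I out) (Q (length H))"
      by (rule runs_le[OF runs_cons_prog_old[where k = "addr H (Cell a b)", OF _ _ _ _ _ _ entries_le[OF H] M]])
        (use V' Ve filter_entries_pair[OF H k(1,2)] True st_upd_VS[of V H I out V'] Q_ge[of "length H"] in
          \<open>auto simp: l addr_def atoms_def\<close>)
    then show ?thesis using \<open>x = OCons\<close> V' k True heap_ext_refl[OF H]
      by (intro exI[of _ H]) (auto simp: all_known_def known_def)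
  next
    case False
    let ?H = "Cell a b # H"
    have H': "heap_ok ?H" using H False k by simp
    then have ext: "heap_ext H ?H" unfolding heap_ext_def using append_Cons[of "Cell a b" "[]" H] by auto
    have ad: "map (addr ?H) V0 = map (addr H) V0"
      using k(3) addr_ext[OF ext] by (auto simp: all_known_def)
    have ap: "addr ?H (Cell a b) = ?M" by (simp add: addr_def)
    have "runs cons_prog (st V H I out) ((st V H I out)(VS := num ?M @ nums (map (addr H) V0),
        HS := enc ((?M, addr H a, addr H b) # entries H), CT := num (Suc ?M)))
      (length (entries H) * (215 * ?M + 120) + 100 * ?M + 100)"
      by (rule runs_cons_prog_new[OF _ _ _ _ _ _ _ entries_le[OF H] M])
        (use Ve filter_entries_pair[OF H k(1,2)] False in auto)
    moreover have "(st V H I out)(VS := num ?M @ nums (map (addr H) V0),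
        HS := enc ((?M, addr H a, addr H b) # entries H), CT := num (Suc ?M)) = st V' ?H I out"
      by (auto simp: st_def fun_eq_iff V' ad ap entries_Cons[OF H'] simp del: enc_simps)
    ultimately have "runs cons_prog (st V H I out) (st V' ?H I out) (Q (length H))"
      using Q_ge[of "length H"] by (auto simp: l intro: runs_le)
    then show ?thesis using \<open>x = OCons\<close> V' all_known_ext[OF k(3) ext] ext
      by (intro exI[of _ ?H]) (auto simp: all_known_def known_def)
  qed
qed

end

section \<open>Programs on a stack of values\<close>


fun lst :: "val list \<Rightarrow> val" where
  "lst [] = Atom 0"
| "lst (x # xs) = Cell x (lst xs)"

lemma lst_eq_Nil [simp]: "lst xs = Atom 0 \<longleftrightarrow> xs = []"
  by (cases xs) auto

lemma lst_inj [simp]: "lst xs = lst ys \<longleftrightarrow> xs = ys"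
proof (induction xs arbitrary: ys)
  case Nil
  then show ?case by (cases ys) auto
next
  case (Cons x xs)
  then show ?case by (cases ys) auto
qed

text \<open>Argument lists are stored in reverse order, so that unpacking one onto the stack restores the order.\<close>

fun ev :: "trm \<Rightarrow> val" where
  "ev (Con i ts) = Cell (Atom (i + 2)) (lst (rev (map ev ts)))"

lemma ev_inj [simp]: "ev t = ev u \<longleftrightarrow> t = u"
proof (induction t arbitrary: u)
  case (Con i ts)
  obtain j us where u: "u = Con j us" by (cases u)
  have "map ev ts = map ev us \<longleftrightarrow> ts = us"
    using list.inj_map_strong[of ts us ev ev] Con by auto
  then show ?case by (simp add: u)
qed

lemma ev_neq_Atom [simp]: "ev t \<noteq> Atom i" "Atom i \<noteq> ev t"
  by (cases t; simp)+

fun blk :: "op list \<Rightarrow> prog" where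
  "blk [] = Skip"
| "blk (x # xs) = op_prog x ;; blk xs"

text \<open>Among known values only \<open>Atom 0\<close> has address 0, whose unary form starts
  with the delimiter 3, so the test reads a single symbol.\<close>

definition ifnil :: "prog \<Rightarrow> prog \<Rightarrow> prog" where
  "ifnil c d = Cond VS {3} c d"

definition while_nonnil :: "prog \<Rightarrow> prog" where
  "while_nonnil c = Loop VS {1} c"

fun rep :: "(nat \<Rightarrow> prog) \<Rightarrow> nat \<Rightarrow> prog" where
  "rep p 0 = Skip"
| "rep p (Suc c) = rep p c ;; p c"

text \<open>The indices refer to the stack before any copying; the copies made so far push
  everything down by \<open>length is\<close>.\<close>

fun picks :: "nat list \<Rightarrow> prog" where
  "picks [] = Skip"
| "picks (i # is) = picks is ;; op_prog (OPick (i + length is))"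

fun picks_cost :: "nat list \<Rightarrow> nat" where
  "picks_cost [] = 0"
| "picks_cost (i # is) = picks_cost is + (i + length is + 1)"

definition nip :: "nat \<Rightarrow> prog" where
  "nip n = blk (replicate n (ODel 1))"

definition mklist :: "nat \<Rightarrow> prog" where
  "mklist n = rep (\<lambda>_. blk [OPick 1, OCons, ODel 1]) n"

definition unlist :: "nat \<Rightarrow> prog" where
  "unlist n = rep (\<lambda>_. blk [OUncons, OPick 1, ODel 2]) n"

fun switch :: "(nat \<Rightarrow> prog) \<Rightarrow> nat list \<Rightarrow> prog" where
  "switch c [] = Skip"
| "switch c (i # is) = blk [OPick 0, OUncons, ODel 1, OAtom (i + 2), OEq] ;;
     ifnil (blk [ODel 0] ;; c i) (blk [ODel 0] ;; switch c is)"

definition mkcon :: "nat \<Rightarrow> nat \<Rightarrow> prog" where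
  "mkcon i a = blk [OAtom 0] ;; mklist a ;; blk [OAtom (i + 2), OCons]"

definition decon :: "nat \<Rightarrow> prog" where
  "decon a = blk [OUncons, ODel 0] ;; unlist a ;; blk [ODel 0]"

text \<open>Searches the association list on top of the stack for the key two places below.\<close>

definition assoc :: prog where
  "assoc = while_nonnil (blk [OUncons, OUncons, OPick 4, OEq] ;;
     ifnil (blk [ODel 0, ODel 1, ODel 1, OAtom 0]) (blk [ODel 0, ODel 0])) ;; blk [ODel 0]"

definition al :: "(val \<times> val) list \<Rightarrow> val" where
  "al M = lst (map (\<lambda>(k, v). Cell k v) M)"

text \<open>\<open>Atom 0\<close> stands for a missing key, which is why memo values are required to
  differ from it.\<close>

definition found :: "(val \<times> val) list \<Rightarrow> val \<Rightarrow> val" where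
  "found M k = (case map_of M k of None \<Rightarrow> Atom 0 | Some v \<Rightarrow> v)"

context signature
begin

text \<open>
  Here \<open>n\<close> counts operations on values. It also bounds the number of cells allocated, and a single
  operation costs at most \<open>Q\<close> of the heap size.
\<close>

definition run :: "prog \<Rightarrow> val list \<Rightarrow> val list \<Rightarrow> nat \<Rightarrow> bool" where
  "run c V V' n \<longleftrightarrow> (\<forall>H I out. heap_ok H \<longrightarrow> all_known H V \<longrightarrow>
     (\<exists>H'. heap_ext H H' \<and> all_known H' V' \<and> length H' \<le> length H + n \<and>
        runs c (st V H I out) (st V' H' I out) (n * Q (length H + n))))"

lemma run_mono:
  assumes "run c V V' n" "n \<le> n'"
  shows "run c V V' n'"
  unfolding run_def
proof (intro allI impI)
  fix H I out assume "heap_ok H" "all_known H V"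
  with assms(1) obtain H' where 1: "heap_ext H H'" "all_known H' V'" "length H' \<le> length H + n"
    "runs c (st V H I out) (st V' H' I out) (n * Q (length H + n))" unfolding run_def by blast
  have "n * Q (length H + n) \<le> n' * Q (length H + n')"
    using assms(2) by (intro mult_le_mono Q_mono) simp_all
  from runs_le[OF 1(4) refl this] show "\<exists>H'. heap_ext H H' \<and> all_known H' V' \<and>
      length H' \<le> length H + n' \<and> runs c (st V H I out) (st V' H' I out) (n' * Q (length H + n'))"
    using 1 assms(2) by (intro exI[of _ H']) simp
qed

lemma run_skip: "run Skip V V 0"
  unfolding run_def using heap_ext_refl runs_skip by (intro allI impI exI conjI) auto

lemma run_seq:
  assumes "run c V V1 n1" "run d V1 V2 n2"
  shows "run (c ;; d) V V2 (n1 + n2)"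
  unfolding run_def
proof (intro allI impI)
  fix H I out assume "heap_ok H" "all_known H V"
  with assms(1) obtain H1 where 1: "heap_ext H H1" "all_known H1 V1" "length H1 \<le> length H + n1"
    "runs c (st V H I out) (st V1 H1 I out) (n1 * Q (length H + n1))" unfolding run_def by blast
  then have "heap_ok H1" by (simp add: heap_ext_def)
  with assms(2) 1 obtain H2 where 2: "heap_ext H1 H2" "all_known H2 V2" "length H2 \<le> length H1 + n2"
    "runs d (st V1 H1 I out) (st V2 H2 I out) (n2 * Q (length H1 + n2))" unfolding run_def by blast
  \<comment> \<open>The first part leaves at most \<open>length H + n1\<close> cells, so both parts
    pay at most \<open>Q (length H + (n1 + n2))\<close> per operation.\<close>
  have "n1 * Q (length H + n1) + n2 * Q (length H1 + n2)
      \<le> n1 * Q (length H + (n1 + n2)) + n2 * Q (length H + (n1 + n2))"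
    by (rule add_mono[OF mult_le_mono2[OF Q_mono] mult_le_mono2[OF Q_mono]]) (use 1 2 in simp_all)
  then have "runs (c ;; d) (st V H I out) (st V2 H2 I out) ((n1 + n2) * Q (length H + (n1 + n2)))"
    by (intro runs_le[OF runs_seq[OF 1(4) 2(4)]]) (simp_all add: algebra_simps)
  then show "\<exists>H'. heap_ext H H' \<and> all_known H' V2 \<and> length H' \<le> length H + (n1 + n2) \<and>
        runs (c ;; d) (st V H I out) (st V2 H' I out) ((n1 + n2) * Q (length H + (n1 + n2)))"
    using 1 2 heap_ext_trans by (intro exI[of _ H2]) force
qed

lemma op_cost_pos: "1 \<le> op_cost x"
  by (cases x) auto

lemma run_op:
  assumes "op_app x V = Some V'"
  shows "run (op_prog x) V V' (op_cost x)"
  unfolding run_def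
proof (intro allI impI)
  fix H I out assume "heap_ok H" "all_known H V"
  from runs_op[OF this assms, of I out] obtain H' where
    1: "heap_ext H H'" "all_known H' V'" "length H' \<le> length H + 1"
    "runs (op_prog x) (st V H I out) (st V' H' I out) (op_cost x * Q (length H))" by blast
  have "runs (op_prog x) (st V H I out) (st V' H' I out) (op_cost x * Q (length H + op_cost x))"
    by (rule runs_le[OF 1(4) refl]) (intro mult_le_mono Q_mono; simp)
  then show "\<exists>H'. heap_ext H H' \<and> all_known H' V' \<and> length H' \<le> length H + op_cost x \<and>
     runs (op_prog x) (st V H I out) (st V' H' I out) (op_cost x * Q (length H + op_cost x))"
    using 1 op_cost_pos[of x] by (intro exI[of _ H']) auto
qed

lemma peek_VS:
  assumes "all_known H (v # V)"
  shows "peek (st (v # V) H I out VS) = (if v = Atom 0 then 3 else 1)"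
proof -
  have "addr H v = 0 \<longleftrightarrow> v = Atom 0"
    using assms by (auto simp: all_known_def addr_def atoms_def split: val.splits)
  then show ?thesis by simp
qed

lemma Q_ge_2: "2 \<le> Q h"
  by (simp add: Q_def power2_eq_square)

lemma run_ifnil:
  assumes "run (if v = Atom 0 then c else d) (v # V) V' n"
  shows "run (ifnil c d) (v # V) V' (n + 1)"
  unfolding run_def
proof (intro allI impI)
  fix H I out assume H: "heap_ok H" and k: "all_known H (v # V)"
  with assms obtain H' where
    1: "heap_ext H H'" "all_known H' V'" "length H' \<le> length H + n"
    "runs (if v = Atom 0 then c else d) (st (v # V) H I out) (st V' H' I out) (n * Q (length H + n))"
    unfolding run_def by blast
  have "(if peek (st (v # V) H I out VS) \<in> {3} then c else d) = (if v = Atom 0 then c else d)"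
    using peek_VS[OF k, of I out] by simp
  with 1(4) have "runs (ifnil c d) (st (v # V) H I out) (st V' H' I out) (n * Q (length H + n) + 2)"
    unfolding ifnil_def by (intro runs_cond) simp_all
  moreover have "n * Q (length H + n) + 2 \<le> (n + 1) * Q (length H + (n + 1))"
  proof -
    have "n * Q (length H + n) \<le> n * Q (length H + (n + 1))" by (intro mult_le_mono Q_mono) simp_all
    moreover have "(n + 1) * Q (length H + (n + 1)) = n * Q (length H + (n + 1)) + Q (length H + (n + 1))"
      by simp
    ultimately show ?thesis using Q_ge_2[of "length H + (n + 1)"] by linarith
  qed
  ultimately have "runs (ifnil c d) (st (v # V) H I out) (st V' H' I out) ((n + 1) * Q (length H + (n + 1)))"
    by (rule runs_le[OF _ refl])
  then show "\<exists>H'. heap_ext H H' \<and> all_known H' V' \<and> length H' \<le> length H + (n + 1) \<and>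
     runs (ifnil c d) (st (v # V) H I out) (st V' H' I out) ((n + 1) * Q (length H + (n + 1)))"
    using 1 by (intro exI[of _ H']) auto
qed

lemma run_while_end: "run (while_nonnil c) (Atom 0 # V) (Atom 0 # V) 1"
  unfolding run_def
proof (intro allI impI)
  fix H I out assume H: "heap_ok H" and k: "all_known H (Atom 0 # V)"
  have "runs (while_nonnil c) (st (Atom 0 # V) H I out) (st (Atom 0 # V) H I out) 1"
    unfolding while_nonnil_def using peek_VS[OF k] by (intro runs_loopF) simp_all
  then have "runs (while_nonnil c) (st (Atom 0 # V) H I out) (st (Atom 0 # V) H I out) (1 * Q (length H + 1))"
    by (rule runs_le) (use Q_ge_2[of "length H + 1"] in simp_all)
  then show "\<exists>H'. heap_ext H H' \<and> all_known H' (Atom 0 # V) \<and> length H' \<le> length H + 1 \<and>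
     runs (while_nonnil c) (st (Atom 0 # V) H I out) (st (Atom 0 # V) H' I out) (1 * Q (length H + 1))"
    using k heap_ext_refl[OF H] by (intro exI[of _ H]) auto
qed

text \<open>Loops are verified by unrolling: each one has an induction of its own on the data that
  it consumes.\<close>

lemma run_while_step:
  assumes "v \<noteq> Atom 0" "run c (v # V) V1 n1" "run (while_nonnil c) V1 V2 n2"
  shows "run (while_nonnil c) (v # V) V2 (n1 + n2 + 1)"
  unfolding run_def
proof (intro allI impI)
  fix H I out assume H: "heap_ok H" and k: "all_known H (v # V)"
  obtain H2 where
    2: "heap_ext H H2" "all_known H2 V2" "length H2 \<le> length H + (n1 + n2)" and
    H1: "\<exists>H1 T1 T2. runs c (st (v # V) H I out) (st V1 H1 I out) T1 \<and>
     runs (while_nonnil c) (st V1 H1 I out) (st V2 H2 I out) T2 \<and>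
     T1 + T2 \<le> (n1 + n2) * Q (length H + (n1 + n2 + 1))"
  proof -
    from assms(2) H k obtain H1 where 1: "heap_ext H H1" "all_known H1 V1" "length H1 \<le> length H + n1"
      "runs c (st (v # V) H I out) (st V1 H1 I out) (n1 * Q (length H + n1))" unfolding run_def by blast
    then have "heap_ok H1" by (simp add: heap_ext_def)
    with assms(3) 1 obtain H2 where 2: "heap_ext H1 H2" "all_known H2 V2" "length H2 \<le> length H1 + n2"
      "runs (while_nonnil c) (st V1 H1 I out) (st V2 H2 I out) (n2 * Q (length H1 + n2))"
      unfolding run_def by blast
    have "n1 * Q (length H + n1) + n2 * Q (length H1 + n2)
        \<le> n1 * Q (length H + (n1 + n2 + 1)) + n2 * Q (length H + (n1 + n2 + 1))"
      by (rule add_mono[OF mult_le_mono2[OF Q_mono] mult_le_mono2[OF Q_mono]]) (use 1 2 in simp_all)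
    then have "n1 * Q (length H + n1) + n2 * Q (length H1 + n2)
        \<le> (n1 + n2) * Q (length H + (n1 + n2 + 1))" by (simp add: algebra_simps)
    with 1 2 show thesis by (intro that[of H2] heap_ext_trans[of H H1 H2]) (auto intro!: exI)
  qed
  then obtain H1 T1 T2 where T: "runs c (st (v # V) H I out) (st V1 H1 I out) T1"
     "runs (while_nonnil c) (st V1 H1 I out) (st V2 H2 I out) T2"
     "T1 + T2 \<le> (n1 + n2) * Q (length H + (n1 + n2 + 1))" by blast
  have "runs (while_nonnil c) (st (v # V) H I out) (st V2 H2 I out) (T1 + T2 + 2)"
    using T(1,2) peek_VS[OF k] assms(1) unfolding while_nonnil_def by (intro runs_loopT) simp_all
  then have "runs (while_nonnil c) (st (v # V) H I out) (st V2 H2 I out)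
     ((n1 + n2 + 1) * Q (length H + (n1 + n2 + 1)))"
    by (rule runs_le) (use T(3) Q_ge_2[of "length H + (n1 + n2 + 1)"] in simp_all)
  then show "\<exists>H'. heap_ext H H' \<and> all_known H' V2 \<and> length H' \<le> length H + (n1 + n2 + 1) \<and>
     runs (while_nonnil c) (st (v # V) H I out) (st V2 H' I out)
       ((n1 + n2 + 1) * Q (length H + (n1 + n2 + 1)))"
    using 2 by (intro exI[of _ H2]) auto
qed

fun exops :: "op list \<Rightarrow> val list \<Rightarrow> val list option" where
  "exops [] V = Some V"
| "exops (x # xs) V = Option.bind (op_app x V) (exops xs)"

lemma run_blk: "exops xs V = Some V' \<Longrightarrow> run (blk xs) V V' (sum_list (map op_cost xs))"
proof (induction xs arbitrary: V)
  case Nil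
  then show ?case by (simp add: run_skip)
next
  case (Cons x xs)
  then obtain V1 where "op_app x V = Some V1" "exops xs V1 = Some V'"
    by (auto simp: bind_eq_Some_conv)
  then show ?case using run_seq[OF run_op Cons.IH] by simp
qed

lemma run_blk_le: "exops xs V = Some V' \<Longrightarrow> sum_list (map op_cost xs) \<le> n \<Longrightarrow> run (blk xs) V V' n"
  by (rule run_mono[OF run_blk])

lemma run_rep: "(\<And>c. c < k \<Longrightarrow> run (p c) (S c) (S (Suc c)) (n c)) \<Longrightarrow> run (rep p k) (S 0) (S k) (\<Sum>c<k. n c)"
  by (induction k) (auto intro: run_skip run_seq)

lemma run_picks:
  "\<forall>i \<in> set is. i < length V \<Longrightarrow> run (picks is) V (map ((!) V) is @ V) (picks_cost is)"
proof (induction "is")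
  case Nil
  then show ?case by (simp add: run_skip)
next
  case (Cons i "is")
  have "run (op_prog (OPick (i + length is))) (map ((!) V) is @ V) (map ((!) V) (i # is) @ V) (i + length is + 1)"
    using run_op[of "OPick (i + length is)" "map ((!) V) is @ V"] Cons.prems by (simp add: nth_append)
  from run_seq[OF Cons.IH this] show ?case using Cons.prems by simp
qed

lemma run_nip: "length xs = n \<Longrightarrow> run (nip n) (r # xs @ V) (r # V) (2 * n)"
proof -
  assume n: "length xs = n"
  have "exops (replicate n (ODel 1)) (r # xs @ V) = Some (r # V)"
    using n by (induction xs arbitrary: n) auto
  from run_blk[OF this] show ?thesis
    unfolding nip_def by (rule run_mono) (simp add: sum_list_replicate)
qed

lemma run_mklist: "length xs = n \<Longrightarrow> run (mklist n) (lst ys # xs @ V) (lst (rev xs @ ys) # V) (5 * n)"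
proof -
  assume n: "length xs = n"
  have "run (mklist n) (lst (rev (take 0 xs) @ ys) # drop 0 xs @ V) (lst (rev (take n xs) @ ys) # drop n xs @ V)
     (\<Sum>c<n. 5)"
    unfolding mklist_def
  proof (rule run_rep)
    fix c assume "c < n"
    then have "drop c xs = xs ! c # drop (Suc c) xs" "take (Suc c) xs = take c xs @ [xs ! c]"
      using n by (simp_all add: Cons_nth_drop_Suc take_Suc_conv_app_nth)
    then show "run (blk [OPick 1, OCons, ODel 1]) (lst (rev (take c xs) @ ys) # drop c xs @ V)
        (lst (rev (take (Suc c) xs) @ ys) # drop (Suc c) xs @ V) 5"
      by (intro run_blk_le) simp_all
  qed
  then show ?thesis using n by (simp add: mult.commute)
qed

lemma run_unlist: "length xs = n \<Longrightarrow> run (unlist n) (lst (rev xs) # V) (Atom 0 # xs @ V) (6 * n)"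
proof -
  assume n: "length xs = n"
  have "run (unlist n) (lst (drop 0 (rev xs)) # rev (take 0 (rev xs)) @ V)
     (lst (drop n (rev xs)) # rev (take n (rev xs)) @ V) (\<Sum>c<n. 6)"
    unfolding unlist_def
  proof (rule run_rep)
    fix c assume "c < n"
    then have "drop c (rev xs) = rev xs ! c # drop (Suc c) (rev xs)"
      "take (Suc c) (rev xs) = take c (rev xs) @ [rev xs ! c]"
      using n by (simp_all only: Cons_nth_drop_Suc take_Suc_conv_app_nth length_rev)
    then show "run (blk [OUncons, OPick 1, ODel 2]) (lst (drop c (rev xs)) # rev (take c (rev xs)) @ V)
        (lst (drop (Suc c) (rev xs)) # rev (take (Suc c) (rev xs)) @ V) 6"
      by (intro run_blk_le) simp_all
  qed
  then show ?thesis using n by (simp add: mult.commute)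
qed

lemma run_mkcon:
  assumes "length ts = a" "i < length ars"
  shows "run (mkcon i a) (map ev ts @ V) (ev (Con i ts) # V) (5 * a + 3)"
proof -
  have 1: "run (blk [OAtom 0]) (map ev ts @ V) (lst [] # map ev ts @ V) 1"
    by (rule run_blk_le) (simp_all add: atoms_def)
  have 2: "run (mklist a) (lst [] # map ev ts @ V) (lst (rev (map ev ts)) # V) (5 * a)"
    using run_mklist[of "map ev ts" a "[]" V] assms by simp
  have 3: "run (blk [OAtom (i + 2), OCons]) (lst (rev (map ev ts)) # V) (ev (Con i ts) # V) 2"
    by (rule run_blk_le) (use assms in \<open>simp_all add: atoms_def\<close>)
  show ?thesis unfolding mkcon_def by (rule run_mono[OF run_seq[OF 1 run_seq[OF 2 3]]]) simp
qed

lemma run_decon: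
  assumes "length ts = a"
  shows "run (decon a) (ev (Con i ts) # V) (map ev ts @ V) (6 * a + 3)"
proof -
  have 1: "run (blk [OUncons, ODel 0]) (ev (Con i ts) # V) (lst (rev (map ev ts)) # V) 2"
    by (rule run_blk_le) simp_all
  have 2: "run (unlist a) (lst (rev (map ev ts)) # V) (Atom 0 # map ev ts @ V) (6 * a)"
    using run_unlist[of "map ev ts" a V] assms by simp
  have 3: "run (blk [ODel 0]) (Atom 0 # map ev ts @ V) (map ev ts @ V) 1"
    by (rule run_blk_le) simp_all
  show ?thesis unfolding decon_def by (rule run_mono[OF run_seq[OF 1 run_seq[OF 2 3]]]) simp
qed

lemma run_switch:
  assumes "i \<in> set is" "\<forall>j \<in> set is. j < length ars" "run (c i) (Cell (Atom (i + 2)) r # V) V' n"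
  shows "run (switch c is) (Cell (Atom (i + 2)) r # V) V' (n + 8 * length is)"
  using assms(1,2)
proof (induction "is")
  case (Cons j "is")
  let ?x = "Cell (Atom (i + 2)) r"
  have 1: "run (blk [OPick 0, OUncons, ODel 1, OAtom (j + 2), OEq]) (?x # V)
     ((if j = i then Atom 0 else Atom 1) # ?x # V) 6"
    by (rule run_blk_le) (use Cons.prems in \<open>simp_all add: atoms_def\<close>)
  have d: "run (blk [ODel 0]) (w # ?x # V) (?x # V) 1" for w by (rule run_blk_le) simp_all
  have 2: "run (ifnil (blk [ODel 0] ;; c j) (blk [ODel 0] ;; switch c is))
      ((if j = i then Atom 0 else Atom 1) # ?x # V) V' (1 + (n + 8 * length is) + 1)"
  proof (rule run_ifnil)
    show "run (if (if j = i then Atom 0 else Atom 1) = Atom 0 then blk [ODel 0] ;; c j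
        else blk [ODel 0] ;; switch c is)
       ((if j = i then Atom 0 else Atom 1) # ?x # V) V' (1 + (n + 8 * length is))"
    proof (cases "j = i")
      case True
      show ?thesis
        using run_seq[OF d[of "Atom 0"] run_mono[OF assms(3), of "n + 8 * length is"]] True by simp
    next
      case False
      then have "run (switch c is) (?x # V) V' (n + 8 * length is)" using Cons by simp
      from run_seq[OF d[of "Atom 1"] this] show ?thesis using False by simp
    qed
  qed
  show ?case unfolding switch.simps by (rule run_mono[OF run_seq[OF 1 2]]) simp
qed simp

text \<open>The \<open>Atom 0\<close> below the table is the default result. On a match the value
  takes its place and the rest of the table is replaced by the empty list, which ends the
  loop.\<close>

lemma run_assoc:
  "run assoc (al M # Atom 0 # k # V) (found M k # k # V) (18 * length M + 2)"
proof -
  have "run (while_nonnil (blk [OUncons, OUncons, OPick 4, OEq] ;;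
     ifnil (blk [ODel 0, ODel 1, ODel 1, OAtom 0]) (blk [ODel 0, ODel 0])))
     (al M # Atom 0 # k # V) (Atom 0 # found M k # k # V) (18 * length M + 1)"
  proof (induction M)
    case Nil
    have "al [] = Atom 0" "found [] k = Atom 0" by (simp_all add: al_def found_def)
    then show ?case using run_while_end by simp
  next
    case (Cons m M)
    obtain key v where m: "m = (key, v)" by (cases m)
    let ?f = "if k = key then Atom 0 else Atom 1"
    let ?S = "if k = key then Atom 0 # v # k # V else al M # Atom 0 # k # V"
    have 1: "run (blk [OUncons, OUncons, OPick 4, OEq]) (al (m # M) # Atom 0 # k # V)
      (?f # v # al M # Atom 0 # k # V) 8"
      by (rule run_blk_le) (simp_all add: al_def m)
    have 2: "run (ifnil (blk [ODel 0, ODel 1, ODel 1, OAtom 0]) (blk [ODel 0, ODel 0]))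
      (?f # v # al M # Atom 0 # k # V) ?S (6 + 1)"
    proof (rule run_ifnil)
      have "run (blk [ODel 0, ODel 1, ODel 1, OAtom 0]) (Atom 0 # v # al M # Atom 0 # k # V)
          (Atom 0 # v # k # V) 6"
        by (rule run_blk_le) (simp_all add: atoms_def)
      moreover have "run (blk [ODel 0, ODel 0]) (Atom 1 # v # al M # Atom 0 # k # V)
          (al M # Atom 0 # k # V) 6"
        by (rule run_blk_le) (simp_all add: atoms_def)
      ultimately show "run (if ?f = Atom 0 then blk [ODel 0, ODel 1, ODel 1, OAtom 0] else blk [ODel 0, ODel 0])
        (?f # v # al M # Atom 0 # k # V) ?S 6" by (cases "k = key") (simp_all del: blk.simps)
    qed
    have e: "al (m # M) = Cell (Cell key v) (al M)" by (simp add: al_def m)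
    have "run (while_nonnil (blk [OUncons, OUncons, OPick 4, OEq] ;;
     ifnil (blk [ODel 0, ODel 1, ODel 1, OAtom 0]) (blk [ODel 0, ODel 0])))
        ?S (Atom 0 # found (m # M) k # k # V) (18 * length M + 1)"
    proof (cases "k = key")
      case True
      then have "found (m # M) k = v" by (simp add: found_def m)
      then show ?thesis using True run_mono[OF run_while_end] by simp
    next
      case False
      then have "found (m # M) k = found M k" by (simp add: found_def m)
      then show ?thesis using False Cons.IH by simp
    qed
    moreover have "al (m # M) \<noteq> Atom 0" by (simp add: e)
    ultimately have "run (while_nonnil (blk [OUncons, OUncons, OPick 4, OEq] ;;
     ifnil (blk [ODel 0, ODel 1, ODel 1, OAtom 0]) (blk [ODel 0, ODel 0])))
        (al (m # M) # Atom 0 # k # V) (Atom 0 # found (m # M) k # k # V)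
        ((8 + (6 + 1)) + (18 * length M + 1) + 1)"
      using run_while_step[OF _ run_seq[OF 1 2]] by blast
    then show ?case by (rule run_mono) simp
  qed
  moreover have "run (blk [ODel 0]) (Atom 0 # found M k # k # V) (found M k # k # V) 1"
    by (rule run_blk_le) simp_all
  ultimately show ?thesis unfolding assoc_def by (rule run_mono[OF run_seq]) simp
qed

end

section \<open>Memoised depth-first search\<close>


fun subs :: "trm \<Rightarrow> trm set" where
  "subs (Con i ts) = insert (Con i ts) (\<Union>t \<in> set ts. subs t)"

lemma finite_subs [simp]: "finite (subs t)"
  by (induction t) auto

lemma self_in_subs [simp]: "t \<in> subs t"
  by (cases t) auto

lemma subs_size: "u \<in> subs t \<Longrightarrow> size u \<le> size t"
proof (induction t)
  case (Con i ts)
  show ?case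
  proof (cases "u = Con i ts")
    case False
    then obtain t where t: "t \<in> set ts" "u \<in> subs t" using Con.prems by auto
    then have "size t < size (Con i ts)" by (simp add: less_Suc_eq_le size_list_estimation' trans_le_add1 trans_le_add2)
    then show ?thesis using Con.IH[OF t] by simp
  qed simp
qed

definition sub_closed :: "trm set \<Rightarrow> bool" where
  "sub_closed S \<longleftrightarrow> (\<forall>i ts. Con i ts \<in> S \<longrightarrow> set ts \<subseteq> S)"

lemma sub_closed_subs: "sub_closed (subs t)"
proof (induction t)
  case (Con i ts)
  then show ?case unfolding sub_closed_def by fastforce
qed

lemma sub_closedD: "sub_closed S \<Longrightarrow> t \<in> S \<Longrightarrow> subs t \<subseteq> S"
proof (induction t)
  case (Con i ts)
  then have "set ts \<subseteq> S" unfolding sub_closed_def by blast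
  then show ?case using Con by auto
qed

lemma subs_trans: "u \<in> subs t \<Longrightarrow> subs u \<subseteq> subs t"
  by (rule sub_closedD[OF sub_closed_subs])

lemma subs_terms: "t \<in> terms ars \<Longrightarrow> subs t \<subseteq> terms ars"
proof (induction rule: terms.induct)
  case (1 i ts)
  then show ?case by (auto intro: terms.intros)
qed

text \<open>The order in which memo entries are made, the newest at the head: a term enters after
  its arguments, and these are handled from last to first, because \<open>mklist\<close> reverses
  them onto the worklist.\<close>

fun visit :: "trm \<Rightarrow> trm list \<Rightarrow> trm list" where
  "visit (Con i ts) Xs = (if Con i ts \<in> set Xs then Xs else Con i ts # fold visit (rev ts) Xs)"

text \<open>Closure under subterms justifies skipping a term that is already listed: its subterms
  are listed too.\<close>

lemma visit_props:
  "sub_closed (set Xs) \<Longrightarrow> sub_closed (set (visit t Xs)) \<and> set (visit t Xs) = set Xs \<union> subs t \<and>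
     (distinct Xs \<longrightarrow> distinct (visit t Xs)) \<and> length Xs \<le> length (visit t Xs)"
proof (induction t arbitrary: Xs)
  case (Con i ts)
  have fold: "sub_closed (set (fold visit us Xs)) \<and> set (fold visit us Xs) = set Xs \<union> (\<Union>t \<in> set us. subs t) \<and>
      (distinct Xs \<longrightarrow> distinct (fold visit us Xs)) \<and> length Xs \<le> length (fold visit us Xs)"
    if "set us \<subseteq> set ts" "sub_closed (set Xs)" for us Xs
    using that
  proof (induction us arbitrary: Xs)
    case (Cons u us)
    then have u: "sub_closed (set (visit u Xs))" "set (visit u Xs) = set Xs \<union> subs u"
      "distinct Xs \<longrightarrow> distinct (visit u Xs)" "length Xs \<le> length (visit u Xs)"
      using Con.IH[of u Xs] by auto
    from Cons.IH[OF _ u(1)] Cons.prems u show ?case by auto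
  qed simp
  show ?case
  proof (cases "Con i ts \<in> set Xs")
    case True
    then show ?thesis using Con.prems sub_closedD[OF Con.prems True] by auto
  next
    case False
    note f = fold[of "rev ts", OF _ Con.prems]
    \<comment> \<open>By size, a term does not occur in its own arguments, so it is still unlisted
      after they have been visited and no duplicate arises.\<close>
    have "Con i ts \<notin> subs t" if "t \<in> set ts" for t
    proof
      assume "Con i ts \<in> subs t"
      then have "size (Con i ts) \<le> size t" by (rule subs_size)
      moreover have "size t < size (Con i ts)"
        using that by (simp add: less_Suc_eq_le size_list_estimation')
      ultimately show False by simp
    qed
    with False have n: "Con i ts \<notin> set (fold visit (rev ts) Xs)" using f by auto
    have "sub_closed (insert (Con i ts) (set (fold visit (rev ts) Xs)))"
      using f unfolding sub_closed_def by auto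
    then show ?thesis using False n f by auto
  qed
qed

lemma fold_visit_props:
  "sub_closed (set Xs) \<Longrightarrow> sub_closed (set (fold visit us Xs)) \<and>
     set (fold visit us Xs) = set Xs \<union> (\<Union>t \<in> set us. subs t) \<and>
     (distinct Xs \<longrightarrow> distinct (fold visit us Xs)) \<and> length Xs \<le> length (fold visit us Xs)"
proof (induction us arbitrary: Xs)
  case (Cons u us)
  note u = visit_props[OF Cons.prems, of u]
  from Cons.IH[of "visit u Xs"] u show ?case by auto
qed simp

text \<open>The memo table as a value. \<open>r\<close> is left open, since the same search serves
  recursion and the final listing of subterms.\<close>

definition AL :: "(trm \<Rightarrow> val) \<Rightarrow> trm list \<Rightarrow> val" where
  "AL r Xs = al (map (\<lambda>t. (ev t, r t)) Xs)"

lemma AL_Cons: "AL r (t # Xs) = Cell (Cell (ev t) (r t)) (AL r Xs)"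
  by (simp add: AL_def al_def)

lemma AL_Nil: "AL r [] = Atom 0"
  by (simp add: AL_def al_def)

lemma found_AL: "found (map (\<lambda>t. (ev t, r t)) Xs) (ev t) = (if t \<in> set Xs then r t else Atom 0)"
  by (induction Xs) (auto simp: found_def)

context signature
begin

section \<open>The worklist program\<close>

definition push_args :: "nat \<Rightarrow> prog" where
  "push_args i = decon (ars ! i) ;; blk [OPick (ars ! i)] ;; mklist (ars ! i) ;; blk [ODel 1]"

text \<open>
  An item of the worklist is the value of a term yet to be visited, or, tagged with atom 1, of a term
  whose arguments have all been pushed above it, so that its memo entry can be computed when the
  item is reached.
\<close>

definition visit_prog :: prog where
  "visit_prog = blk [ODel 0, OAtom 0, OPick 3] ;; assoc ;;
     ifnil (blk [ODel 0, OPick 1, OPick 1, OAtom 1, OCons, OCons, ODel 2, OPick 1, ODel 2] ;;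
       switch push_args [0..<length ars]) (blk [ODel 0, ODel 0])"

definition finish_prog :: "prog \<Rightarrow> prog" where
  "finish_prog fin = blk [ODel 0, OUncons, ODel 0] ;; fin ;;
     blk [OPick 1, OCons, ODel 1, OPick 2, OPick 1, OCons, ODel 1, ODel 2, OPick 1, ODel 2]"

text \<open>Tagged items are recognisable because the first component of \<open>ev t\<close> is
  \<open>Atom (i + 2)\<close> for some \<open>i\<close>, never \<open>Atom 1\<close>.\<close>

definition dfs_body :: "prog \<Rightarrow> prog" where
  "dfs_body fin = blk [OUncons, OPick 0, OUncons, ODel 1, OAtom 1, OEq] ;;
     ifnil (finish_prog fin) visit_prog"

lemma run_finish:
  assumes "run fin (ev t # lst W # AL r Xs # E) (r t # ev t # lst W # AL r Xs # E) n"
  shows "run (dfs_body fin) (lst (Cell (Atom 1) (ev t) # W) # AL r Xs # E) (lst W # AL r (t # Xs) # E) (n + 40)"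
proof -
  have 1: "run (blk [OUncons, OPick 0, OUncons, ODel 1, OAtom 1, OEq])
    (lst (Cell (Atom 1) (ev t) # W) # AL r Xs # E)
    (Atom 0 # Cell (Atom 1) (ev t) # lst W # AL r Xs # E) 7"
    by (rule run_blk_le) (simp_all add: atoms_def)
  have 2: "run (blk [ODel 0, OUncons, ODel 0])
    (Atom 0 # Cell (Atom 1) (ev t) # lst W # AL r Xs # E) (ev t # lst W # AL r Xs # E) 3"
    by (rule run_blk_le) simp_all
  have 3: "run (blk [OPick 1, OCons, ODel 1, OPick 2, OPick 1, OCons, ODel 1, ODel 2, OPick 1, ODel 2])
    (r t # ev t # lst W # AL r Xs # E) (lst W # AL r (t # Xs) # E) 25"
    by (rule run_blk_le) (simp_all add: AL_Cons numeral_2_eq_2)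
  have "run (ifnil (finish_prog fin) visit_prog) (Atom 0 # Cell (Atom 1) (ev t) # lst W # AL r Xs # E)
    (lst W # AL r (t # Xs) # E) ((3 + (n + 25)) + 1)"
    by (rule run_ifnil) (use run_seq[OF 2 run_seq[OF assms 3]] in \<open>simp add: finish_prog_def del: blk.simps\<close>)
  from run_seq[OF 1 this] show ?thesis unfolding dfs_body_def by (rule run_mono) simp
qed

lemma run_visit_old:
  assumes "t \<in> set Xs" "r t \<noteq> Atom 0"
  shows "run (dfs_body fin) (lst (ev t # W) # AL r Xs # E) (lst W # AL r Xs # E) (18 * length Xs + 40)"
proof -
  obtain i ts where t: "t = Con i ts" by (cases t)
  have 1: "run (blk [OUncons, OPick 0, OUncons, ODel 1, OAtom 1, OEq])
    (lst (ev t # W) # AL r Xs # E) (Atom 1 # ev t # lst W # AL r Xs # E) 7"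
    by (rule run_blk_le) (simp_all add: atoms_def t)
  have 2: "run (blk [ODel 0, OAtom 0, OPick 3])
    (Atom 1 # ev t # lst W # AL r Xs # E) (AL r Xs # Atom 0 # ev t # lst W # AL r Xs # E) 6"
    by (rule run_blk_le) (simp_all add: atoms_def numeral_3_eq_3)
  have 3: "run assoc (AL r Xs # Atom 0 # ev t # lst W # AL r Xs # E)
    (r t # ev t # lst W # AL r Xs # E) (18 * length Xs + 2)"
    using run_assoc[of "map (\<lambda>t. (ev t, r t)) Xs" "ev t"] assms(1) by (simp add: found_AL AL_def)
  have 4: "run (blk [ODel 0, ODel 0]) (r t # ev t # lst W # AL r Xs # E) (lst W # AL r Xs # E) 2"
    by (rule run_blk_le) simp_all
  have 5: "run (ifnil c (blk [ODel 0, ODel 0])) (r t # ev t # lst W # AL r Xs # E) (lst W # AL r Xs # E) (2 + 1)" for c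
    by (rule run_ifnil) (use assms(2) 4 in \<open>simp del: blk.simps\<close>)
  have "run (ifnil c visit_prog) (Atom 1 # ev t # lst W # AL r Xs # E)
    (lst W # AL r Xs # E) ((6 + ((18 * length Xs + 2) + (2 + 1))) + 1)" for c
    by (rule run_ifnil) (use run_seq[OF 2 run_seq[OF 3 5]] in \<open>simp add: visit_prog_def del: blk.simps\<close>)
  from run_seq[OF 1 this] show ?thesis unfolding dfs_body_def by (rule run_mono) simp
qed

lemma run_visit_new:
  assumes t: "t = Con i ts" "i < length ars" "length ts = ars ! i" and "t \<notin> set Xs"
  shows "run (dfs_body fin) (lst (ev t # W) # AL r Xs # E)
    (lst (map ev (rev ts) @ Cell (Atom 1) (ev t) # W) # AL r Xs # E)
    (18 * length Xs + 8 * length ars + 12 * ars ! i + 60)"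
proof -
  let ?W = "Cell (Atom 1) (ev t) # W"
  let ?a = "ars ! i"
  have 1: "run (blk [OUncons, OPick 0, OUncons, ODel 1, OAtom 1, OEq])
    (lst (ev t # W) # AL r Xs # E) (Atom 1 # ev t # lst W # AL r Xs # E) 7"
    by (rule run_blk_le) (simp_all add: atoms_def t)
  have 2: "run (blk [ODel 0, OAtom 0, OPick 3])
    (Atom 1 # ev t # lst W # AL r Xs # E) (AL r Xs # Atom 0 # ev t # lst W # AL r Xs # E) 6"
    by (rule run_blk_le) (simp_all add: atoms_def numeral_3_eq_3)
  have 3: "run assoc (AL r Xs # Atom 0 # ev t # lst W # AL r Xs # E)
    (Atom 0 # ev t # lst W # AL r Xs # E) (18 * length Xs + 2)"
    using run_assoc[of "map (\<lambda>t. (ev t, r t)) Xs" "ev t"] assms(4) by (simp add: found_AL AL_def)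
  have 4: "run (blk [ODel 0, OPick 1, OPick 1, OAtom 1, OCons, OCons, ODel 2, OPick 1, ODel 2])
    (Atom 0 # ev t # lst W # AL r Xs # E) (ev t # lst ?W # AL r Xs # E) 18"
    by (rule run_blk_le) (simp_all add: atoms_def numeral_2_eq_2)
  have 5: "run (push_args i) (ev t # lst ?W # AL r Xs # E)
    (lst (map ev (rev ts) @ ?W) # AL r Xs # E) ((6 * ?a + 3) + ((?a + 1) + (5 * ?a + 2)))"
  proof -
    have a: "run (decon ?a) (ev t # lst ?W # AL r Xs # E) (map ev ts @ lst ?W # AL r Xs # E) (6 * ?a + 3)"
      unfolding t(1) by (rule run_decon[OF t(3)])
    have b: "run (blk [OPick ?a]) (map ev ts @ lst ?W # AL r Xs # E)
       (lst ?W # map ev ts @ lst ?W # AL r Xs # E) (?a + 1)"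
      by (rule run_blk_le) (use t(3) in \<open>simp_all add: nth_append\<close>)
    have c: "run (mklist ?a) (lst ?W # map ev ts @ lst ?W # AL r Xs # E)
       (lst (map ev (rev ts) @ ?W) # lst ?W # AL r Xs # E) (5 * ?a)"
      using run_mklist[of "map ev ts" ?a ?W] t(3) by (simp add: rev_map)
    have d: "run (blk [ODel 1]) (lst (map ev (rev ts) @ ?W) # lst ?W # AL r Xs # E)
       (lst (map ev (rev ts) @ ?W) # AL r Xs # E) 2"
      by (rule run_blk_le) simp_all
    show ?thesis unfolding push_args_def by (rule run_seq[OF a run_seq[OF b run_seq[OF c d]]])
  qed
  have 6: "run (switch push_args [0..<length ars]) (ev t # lst ?W # AL r Xs # E)
    (lst (map ev (rev ts) @ ?W) # AL r Xs # E) ((6 * ?a + 3) + ((?a + 1) + (5 * ?a + 2)) + 8 * length [0..<length ars])"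
    unfolding t(1) ev.simps using 5[unfolded t(1) ev.simps] t(2) by (intro run_switch) simp_all
  have 7: "run (ifnil (blk [ODel 0, OPick 1, OPick 1, OAtom 1, OCons, OCons, ODel 2, OPick 1, ODel 2] ;;
       switch push_args [0..<length ars]) c) (Atom 0 # ev t # lst W # AL r Xs # E)
     (lst (map ev (rev ts) @ ?W) # AL r Xs # E)
     ((18 + ((6 * ?a + 3) + ((?a + 1) + (5 * ?a + 2)) + 8 * length [0..<length ars])) + 1)" for c
    by (rule run_ifnil) (use run_seq[OF 4 6] in \<open>simp del: blk.simps\<close>)
  have "run (ifnil c visit_prog) (Atom 1 # ev t # lst W # AL r Xs # E)
    (lst (map ev (rev ts) @ ?W) # AL r Xs # E) ((6 + ((18 * length Xs + 2) +
     ((18 + ((6 * ?a + 3) + ((?a + 1) + (5 * ?a + 2)) + 8 * length [0..<length ars])) + 1))) + 1)" for c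
    by (rule run_ifnil) (use run_seq[OF 2 run_seq[OF 3 7]] in \<open>simp add: visit_prog_def del: blk.simps\<close>)
  from run_seq[OF 1 this] show ?thesis unfolding dfs_body_def by (rule run_mono) simp
qed

definition dfs :: "prog \<Rightarrow> prog" where
  "dfs fin = blk [OAtom 0, OPick 1, OCons, ODel 1, OAtom 0, OPick 1, ODel 2] ;;
     while_nonnil (dfs_body fin) ;; blk [ODel 0]"

lemma nth_le_sum_list: "i < length xs \<Longrightarrow> xs ! i \<le> sum_list (xs :: nat list)"
  by (rule member_le_sum_list) auto

text \<open>Bound for a single turn of the worklist loop, with at most \<open>N\<close> memo entries
  and cost \<open>n\<close> for computing a new one. The term \<open>18 * N\<close> is the search in
  the memo table.\<close>

definition dfs_step_cost :: "nat \<Rightarrow> nat \<Rightarrow> nat" where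
  "dfs_step_cost N n = 18 * N + n + 12 * sum_list ars + 8 * length ars + 61"

text \<open>The program is iterative, while \<open>visit\<close> recurses on the term. The two meet
  by assuming a run from the state after \<open>t\<close> has been visited and prepending the turns
  that handle \<open>t\<close>. One turn is charged to the item itself and
  \<open>sum_list ars + 2\<close> turns to every new memo entry: enough for its expansion, its
  completion and the items pushed for its arguments.\<close>

lemma run_dfs_loop:
  assumes U: "finite U" "sub_closed U" "U \<subseteq> terms ars" and r: "\<And>t. r t \<noteq> Atom 0"
    and fin: "\<And>i ts Xs W. Con i ts \<in> U \<Longrightarrow> set ts \<subseteq> set Xs \<Longrightarrow> set Xs \<subseteq> U \<Longrightarrow> distinct Xs \<Longrightarrow>
      run fin (ev (Con i ts) # lst W # AL r Xs # E) (r (Con i ts) # ev (Con i ts) # lst W # AL r Xs # E) n"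
    and "t \<in> U" "sub_closed (set Xs)" "set Xs \<subseteq> U" "distinct Xs"
    and "run (while_nonnil (dfs_body fin)) (lst W # AL r (visit t Xs) # E) V' c"
  shows "run (while_nonnil (dfs_body fin)) (lst (ev t # W) # AL r Xs # E) V'
    (c + dfs_step_cost (card U) n * (1 + (sum_list ars + 2) * (length (visit t Xs) - length Xs)))"
  using assms(6-)
proof (induction t arbitrary: Xs W c)
  case (Con i ts)
  let ?D = "dfs_step_cost (card U) n"
  let ?S = "sum_list ars + 2"
  let ?t = "Con i ts"
  have wf: "i < length ars" "length ts = ars ! i"
    using Con.prems(1) U(3) by (auto elim: terms.cases)
  have tsU: "set ts \<subseteq> U" using Con.prems(1) U(2) by (auto simp: sub_closed_def)
  have len: "length Xs \<le> card U" if "set Xs \<subseteq> U" "distinct Xs" for Xs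
    using that U(1) by (metis card_mono distinct_card)
  show ?case
  proof (cases "?t \<in> set Xs")
    case True
    have "run (while_nonnil (dfs_body fin)) (lst (ev ?t # W) # AL r Xs # E) V'
      ((18 * length Xs + 40) + c + 1)"
      using run_visit_old[where r = r and fin = fin, OF True r] Con.prems(5) True
      unfolding lst.simps by (intro run_while_step) simp_all
    moreover have "(18 * length Xs + 40) + c + 1 \<le> c + ?D * 1"
      using len[OF Con.prems(3,4)] by (simp add: dfs_step_cost_def)
    ultimately show ?thesis using True by (auto elim: run_mono)
  next
    case False
    let ?Xs = "fold visit (rev ts) Xs"
    \<comment> \<open>A block of items is handled by an inner induction; the numbers of new entries
      telescope, being differences of table lengths.\<close>
    have list: "run (while_nonnil (dfs_body fin)) (lst (map ev us @ W) # AL r Xs # E) V'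
        (c + ?D * (length us + ?S * (length (fold visit us Xs) - length Xs)))"
      if "set us \<subseteq> set ts" "sub_closed (set Xs)" "set Xs \<subseteq> U" "distinct Xs"
        "run (while_nonnil (dfs_body fin)) (lst W # AL r (fold visit us Xs) # E) V' c" for us Xs W c
      using that
    proof (induction us arbitrary: Xs)
      case Nil
      then show ?case by simp
    next
      case (Cons u us)
      have u: "u \<in> set ts" "u \<in> U" using Cons.prems(1) tsU by auto
      note p = visit_props[OF Cons.prems(2), of u]
      have sU: "set (visit u Xs) \<subseteq> U" using p Cons.prems(3) sub_closedD[OF U(2) u(2)] by blast
      have q: "length (visit u Xs) \<le> length (fold visit us (visit u Xs))"
        using fold_visit_props[of "visit u Xs"] p by blast
      have "run (while_nonnil (dfs_body fin)) (lst (map ev us @ W) # AL r (visit u Xs) # E) V'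
        (c + ?D * (length us + ?S * (length (fold visit us (visit u Xs)) - length (visit u Xs))))"
        by (rule Cons.IH) (use Cons.prems p sU in auto)
      note Con.IH[OF u(1) u(2) Cons.prems(2-4) this]
      moreover have "c + ?D * (length us + ?S * (length (fold visit us (visit u Xs)) - length (visit u Xs)))
           + ?D * (1 + ?S * (length (visit u Xs) - length Xs))
         = c + ?D * (length (u # us) + ?S * (length (fold visit (u # us) Xs) - length Xs))"
      proof -
        have "length (fold visit (u # us) Xs) - length Xs =
          (length (fold visit us (visit u Xs)) - length (visit u Xs)) + (length (visit u Xs) - length Xs)"
          using p q by simp
        then show ?thesis by (simp only: list.size) (simp add: algebra_simps)
      qed
      ultimately show ?case by (simp only: list.map append_Cons)
    qed
    note f = fold_visit_props[OF Con.prems(2), of "rev ts"]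
    have "subs u \<subseteq> U" if "u \<in> set ts" for u
      using sub_closedD[OF U(2)] tsU that by blast
    then have "(\<Union>u \<in> set (rev ts). subs u) \<subseteq> U" by auto
    then have fU: "set ?Xs \<subseteq> U" using f Con.prems(3) by simp
    have fd: "distinct ?Xs" using f Con.prems(4) by blast
    have "run fin (ev ?t # lst W # AL r ?Xs # E) (r ?t # ev ?t # lst W # AL r ?Xs # E) n"
      by (rule fin) (use f fU fd Con.prems in auto)
    note 3 = run_finish[OF this]
    have 3: "run (while_nonnil (dfs_body fin)) (lst (Cell (Atom 1) (ev ?t) # W) # AL r ?Xs # E) V'
       ((n + 40) + c + 1)"
      using 3 Con.prems(5) False unfolding lst.simps by (intro run_while_step) simp_all
    have 2: "run (while_nonnil (dfs_body fin)) (lst (map ev (rev ts) @ Cell (Atom 1) (ev ?t) # W) # AL r Xs # E) V'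
       (((n + 40) + c + 1) + ?D * (length (rev ts) + ?S * (length ?Xs - length Xs)))"
      by (rule list) (use Con.prems 3 in auto)
    have "run (while_nonnil (dfs_body fin)) (lst (ev ?t # W) # AL r Xs # E) V'
      ((18 * length Xs + 8 * length ars + 12 * ars ! i + 60) +
       (((n + 40) + c + 1) + ?D * (length (rev ts) + ?S * (length ?Xs - length Xs))) + 1)"
      using run_visit_new[OF refl wf False] 2 unfolding lst.simps by (intro run_while_step) simp_all
    then show ?thesis
    proof (rule run_mono)
      have d: "length (visit ?t Xs) - length Xs = 1 + (length ?Xs - length Xs)"
        using False f by (simp add: Suc_diff_le)
      have a: "ars ! i \<le> sum_list ars" using nth_le_sum_list wf by simp
      \<comment> \<open>The two turns spent on the node itself: its expansion and, later, its
        completion.\<close>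
      have "(18 * length Xs + 8 * length ars + 12 * ars ! i + 60) + (n + 40 + 1) + 1 \<le> ?D * 2"
        using len[OF Con.prems(3,4)] a by (simp add: dfs_step_cost_def)
      moreover have "?D * length (rev ts) \<le> ?D * sum_list ars" using a wf by simp
      ultimately have "(18 * length Xs + 8 * length ars + 12 * ars ! i + 60) +
         (((n + 40) + c + 1) + ?D * (length (rev ts) + ?S * (length ?Xs - length Xs))) + 1
        \<le> c + (?D * 2 + ?D * sum_list ars + ?D * (?S * (length ?Xs - length Xs)))"
        unfolding distrib_left by linarith
      also have "\<dots> \<le> c + ?D * (1 + ?S * (1 + (length ?Xs - length Xs)))"
        by (simp add: algebra_simps)
      finally show "(18 * length Xs + 8 * length ars + 12 * ars ! i + 60) +
         (((n + 40) + c + 1) + ?D * (length (rev ts) + ?S * (length ?Xs - length Xs))) + 1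
        \<le> c + ?D * (1 + ?S * (length (visit ?t Xs) - length Xs))" unfolding d .
    qed
  qed
qed

definition dfs_cost :: "nat \<Rightarrow> nat \<Rightarrow> nat" where
  "dfs_cost N n = 20 + dfs_step_cost N n * (1 + (sum_list ars + 2) * N)"

lemma run_dfs:
  assumes v: "v \<in> terms ars" and r: "\<And>t. r t \<noteq> Atom 0"
    and fin: "\<And>i ts Xs W. Con i ts \<in> subs v \<Longrightarrow> set ts \<subseteq> set Xs \<Longrightarrow> set Xs \<subseteq> subs v \<Longrightarrow> distinct Xs \<Longrightarrow>
      run fin (ev (Con i ts) # lst W # AL r Xs # E) (r (Con i ts) # ev (Con i ts) # lst W # AL r Xs # E) n"
  shows "run (dfs fin) (ev v # E) (AL r (visit v []) # E) (dfs_cost (card (subs v)) n)"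
proof -
  have 1: "run (blk [OAtom 0, OPick 1, OCons, ODel 1, OAtom 0, OPick 1, ODel 2]) (ev v # E)
     (lst (ev v # []) # AL r [] # E) 12"
    by (rule run_blk_le) (simp_all add: atoms_def AL_Nil numeral_2_eq_2)
  have "run (while_nonnil (dfs_body fin)) (lst [] # AL r (visit v []) # E) (Atom 0 # AL r (visit v []) # E) 1"
    using run_while_end by simp
  from run_dfs_loop[OF finite_subs sub_closed_subs subs_terms[OF v] r fin self_in_subs _ _ _ this]
  have 2: "run (while_nonnil (dfs_body fin)) (lst (ev v # []) # AL r [] # E) (Atom 0 # AL r (visit v []) # E)
    (1 + dfs_step_cost (card (subs v)) n * (1 + (sum_list ars + 2) * length (visit v [])))"
    by (simp add: sub_closed_def)
  have 3: "run (blk [ODel 0]) (Atom 0 # AL r (visit v []) # E) (AL r (visit v []) # E) 1"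
    by (rule run_blk_le) simp_all
  have "set (visit v []) = subs v" "distinct (visit v [])"
    using visit_props[of "[]" v] by (simp_all add: sub_closed_def)
  then have "length (visit v []) = card (subs v)" by (metis distinct_card)
  then show ?thesis unfolding dfs_def dfs_cost_def
    by (intro run_mono[OF run_seq[OF 1 run_seq[OF 2 3]]]) simp
qed

end

section \<open>Size bounds from tiers\<close>


text \<open>With base \<open>n + 2\<close>, which is at least 2, constants and coefficients are
  absorbed into the exponent.\<close>

definition pb :: "(nat \<Rightarrow> nat) \<Rightarrow> bool" where
  "pb T \<longleftrightarrow> (\<exists>c. \<forall>n. T n \<le> (n + 2) ^ c)"

lemma pbD: "pb T \<Longrightarrow> \<exists>c. \<forall>n. T n \<le> (n + 2) ^ c"
  by (simp add: pb_def)

lemma pb_const: "pb (\<lambda>_. k)"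
  unfolding pb_def
proof (intro exI allI)
  fix n :: nat
  have "k \<le> 2 ^ k" by simp
  also have "(2::nat) ^ k \<le> (n + 2) ^ k" by (intro power_mono) auto
  finally show "k \<le> (n + 2) ^ k" .
qed

lemma pb_id: "pb (\<lambda>n. n)"
  unfolding pb_def by (rule exI[of _ 1]) simp

lemma pb_mult: "pb S \<Longrightarrow> pb T \<Longrightarrow> pb (\<lambda>n. S n * T n)"
  unfolding pb_def by (metis mult_le_mono power_add)

lemma pb_add:
  assumes "pb S" "pb T"
  shows "pb (\<lambda>n. S n + T n)"
proof -
  obtain a b where ab: "\<And>n. S n \<le> (n + 2) ^ a" "\<And>n. T n \<le> (n + 2) ^ b"
    using assms unfolding pb_def by blast
  have "S n + T n \<le> (n + 2) ^ (a + b + 1)" for n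
  proof -
    have "S n \<le> (n + 2) ^ (a + b)" "T n \<le> (n + 2) ^ (a + b)"
      using ab[of n] by (auto intro: order_trans power_increasing)
    then have "S n + T n \<le> 2 * (n + 2) ^ (a + b)" by simp
    also have "\<dots> \<le> (n + 2) * (n + 2) ^ (a + b)" by (intro mult_le_mono) auto
    finally show ?thesis by simp
  qed
  then show ?thesis unfolding pb_def by blast
qed

lemma pb_power: "pb T \<Longrightarrow> pb (\<lambda>n. T n ^ k)"
  unfolding pb_def by (metis power_mono power_mult zero_le)

lemma pb_sum: "(\<And>i. i \<in> I \<Longrightarrow> pb (T i)) \<Longrightarrow> pb (\<lambda>n. \<Sum>i\<in>I. T i n)"
  by (induction I rule: infinite_finite_induct) (auto intro: pb_const pb_add)

lemmas pb_intros = pb_const pb_id pb_add pb_mult pb_power pb_sum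

section \<open>Counting distinct subterms\<close>

definition all_subs :: "trm list \<Rightarrow> trm set" where
  "all_subs vs = (\<Union>t \<in> set vs. subs t)"

lemma all_subs_simps [simp]:
  "all_subs [] = {}" "all_subs (v # vs) = subs v \<union> all_subs vs"
  "all_subs (vs @ ws) = all_subs vs \<union> all_subs ws" "finite (all_subs vs)"
  by (auto simp: all_subs_def)

text \<open>The number of nodes of the maximally shared graph of all arguments together; a subterm
  common to several arguments counts once.\<close>

definition dag_size :: "trm list \<Rightarrow> nat" where
  "dag_size vs = card (all_subs vs)"

lemma dag_size_mono: "all_subs vs \<subseteq> all_subs ws \<Longrightarrow> dag_size vs \<le> dag_size ws"
  by (simp add: dag_size_def card_mono)

lemma subs_Con: "subs (Con i ts) = insert (Con i ts) (all_subs ts)"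
  by (simp add: all_subs_def)

text \<open>\<open>P\<close> selects tiers: equality with \<open>m\<close> gives the part that is
  discounted, \<open>m < p\<close> the part that enters the polynomial.\<close>

fun tier_subs :: "(nat \<Rightarrow> bool) \<Rightarrow> nat list \<Rightarrow> trm list \<Rightarrow> trm set" where
  "tier_subs P (p # ps) (v # vs) = (if P p then subs v else {}) \<union> tier_subs P ps vs"
| "tier_subs P _ _ = {}"

lemma tier_subs_append:
  "length ps = length vs \<Longrightarrow> tier_subs P (ps @ qs) (vs @ ws) = tier_subs P ps vs \<union> tier_subs P qs ws"
  by (induction ps vs rule: list_induct2) auto

lemma tier_subs_replicate:
  "length vs = n \<Longrightarrow> tier_subs P (replicate n p) vs = (if P p then all_subs vs else {})"
  by (induction vs arbitrary: n) auto

lemma tier_subs_nth: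
  "length ps = length vs \<Longrightarrow> tier_subs P ps vs = (\<Union>i \<in> {i. i < length ps \<and> P (ps ! i)}. subs (vs ! i))"
proof (induction ps vs rule: list_induct2)
  case (Cons p ps v vs)
  have "{i. i < length (p # ps) \<and> P ((p # ps) ! i)} =
    (if P p then {0} else {}) \<union> Suc ` {i. i < length ps \<and> P (ps ! i)}"
    by (auto simp: less_Suc_eq_0_disj)
  then show ?case using Cons by simp
qed simp

lemma tier_subs_subset: "tier_subs P ps vs \<subseteq> all_subs vs"
  by (induction P ps vs rule: tier_subs.induct) auto

lemma finite_tier_subs [simp]: "finite (tier_subs P ps vs)"
  using finite_subset[OF tier_subs_subset] by simp

lemma tier_subs_mono: "(\<And>p. P p \<Longrightarrow> R p) \<Longrightarrow> tier_subs P ps vs \<subseteq> tier_subs R ps vs"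
  by (induction P ps vs rule: tier_subs.induct) auto

lemma tuples_append: "xs \<in> tuples ars m \<Longrightarrow> ys \<in> tuples ars n \<Longrightarrow> xs @ ys \<in> tuples ars (m + n)"
  by (auto simp: tuples_def)

lemma Con_in_terms: "Con i ts \<in> terms ars \<longleftrightarrow> i < length ars \<and> ts \<in> tuples ars (ars ! i)"
  by (auto simp: tuples_def elim: terms.cases intro: terms.intros)

lemma tuples_Cons: "v # vs \<in> tuples ars (Suc n) \<longleftrightarrow> v \<in> terms ars \<and> vs \<in> tuples ars n"
  by (auto simp: tuples_def)

lemma tuples_Suc_cases:
  assumes "vs \<in> tuples ars (Suc n)"
  obtains v ws where "vs = v # ws" "v \<in> terms ars" "ws \<in> tuples ars n"
  using assms by (cases vs) (auto simp: tuples_def)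

abbreviation rec_values :: "nat \<Rightarrow> (nat \<Rightarrow> tfun) \<Rightarrow> trm list \<Rightarrow> trm list \<Rightarrow> trm list" where
  "rec_values n gs xs ys \<equiv> concat (map (\<lambda>l. map (\<lambda>x. gs l (x # ys)) xs) [0..<n])"

lemma length_rec_values: "length (rec_values n gs xs ys) = n * length xs"
  by (induction n) auto

lemma all_subs_rec_values:
  "all_subs (rec_values n gs xs ys) = (\<Union>l<n. \<Union>x\<in>set xs. subs (gs l (x # ys)))"
  by (auto simp: all_subs_def atLeast0LessThan)

lemma power_le_sum_exponent:
  "finite I \<Longrightarrow> i \<in> I \<Longrightarrow> (n + 2 :: nat) ^ c i \<le> (n + 2) ^ (\<Sum>i\<in>I. c i)"
  by (intro power_increasing member_le_sum) auto

section \<open>New subterms along a tier derivation\<close>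

text \<open>
  Only the arguments of tier \<open>m\<close> contribute subterms without a polynomial bound: each of them at
  most once, since they are merely passed on.
\<close>

definition tier_bounded :: "nat list \<Rightarrow> tfun \<Rightarrow> nat list \<Rightarrow> nat \<Rightarrow> nat \<Rightarrow> bool" where
  "tier_bounded ars f ps m c \<longleftrightarrow> (\<forall>vs \<in> tuples ars (length ps). f vs \<in> terms ars \<and>
     card (subs (f vs) - tier_subs (\<lambda>p. p = m) ps vs) \<le> (card (tier_subs (\<lambda>p. m < p) ps vs) + 2) ^ c)"

text \<open>For a value of tier \<open>q > m\<close> the discounted arguments have tier
  \<open>q\<close>, hence above \<open>m\<close>, so the whole value is bounded and not only its new
  part. This supplies the higher-tier arguments in a composition.\<close>

lemma tier_bounded_total:
  assumes "tier_bounded ars f ps q c" "vs \<in> tuples ars (length ps)" "m < q"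
  shows "card (subs (f vs)) \<le> (card (tier_subs (\<lambda>p. m < p) ps vs) + 2) ^ c + card (tier_subs (\<lambda>p. m < p) ps vs)"
proof -
  let ?N = "card (tier_subs (\<lambda>p. m < p) ps vs)"
  have "card (subs (f vs)) \<le> card (subs (f vs) - tier_subs (\<lambda>p. p = q) ps vs) + card (tier_subs (\<lambda>p. p = q) ps vs)"
    by (metis Diff_subset card_Un_le card_mono finite_UnI finite_Diff finite_subs finite_tier_subs
        Un_Diff_cancel2 le_trans sup_ge1)
  moreover have "card (tier_subs (\<lambda>p. p = q) ps vs) \<le> ?N"
    using assms(3) by (intro card_mono tier_subs_mono) auto
  moreover have "card (subs (f vs) - tier_subs (\<lambda>p. p = q) ps vs) \<le> (card (tier_subs (\<lambda>p. q < p) ps vs) + 2) ^ c"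
    using assms(1,2) by (simp add: tier_bounded_def)
  moreover have "(card (tier_subs (\<lambda>p. q < p) ps vs) + 2) ^ c \<le> (?N + 2) ^ c"
    using assms(3) by (intro power_mono add_right_mono card_mono tier_subs_mono) auto
  ultimately show ?thesis by linarith
qed

text \<open>The only possible new subterm is the root, whence the exponent 0.\<close>

lemma tier_bounded_constr:
  assumes "i < length ars" "is_constr ars i h"
  shows "tier_bounded ars h (replicate (ars ! i) n) n 0"
proof -
  have "h vs \<in> terms ars \<and> card (subs (h vs) - tier_subs (\<lambda>p. p = n) (replicate (ars ! i) n) vs) \<le> 1"
    if vs: "vs \<in> tuples ars (ars ! i)" for vs
  proof -
    have h: "h vs = Con i vs" using assms(2) vs by (simp add: is_constr_def)
    have "tier_subs (\<lambda>p. p = n) (replicate (ars ! i) n) vs = all_subs vs"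
      using vs by (subst tier_subs_replicate) (auto simp: tuples_def)
    then have "subs (h vs) - tier_subs (\<lambda>p. p = n) (replicate (ars ! i) n) vs \<subseteq> {Con i vs}"
      unfolding h subs_Con by auto
    from card_mono[OF _ this] show ?thesis using h vs assms(1) by (simp add: Con_in_terms)
  qed
  then show ?thesis by (simp add: tier_bounded_def)
qed

lemma tier_bounded_proj:
  assumes "n < length ps" "is_proj ars (length ps) n h"
  shows "tier_bounded ars h ps (ps ! n) 0"
proof -
  have "h vs \<in> terms ars \<and> card (subs (h vs) - tier_subs (\<lambda>p. p = ps ! n) ps vs) \<le> 1"
    if vs: "vs \<in> tuples ars (length ps)" for vs
  proof -
    have 1: "subs (h vs) - tier_subs (\<lambda>p. p = ps ! n) ps vs = {}" "h vs \<in> terms ars"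
      using assms vs by (auto simp: is_proj_def tuples_def tier_subs_nth)
    show ?thesis unfolding 1(1) using 1(2) by simp
  qed
  then show ?thesis by (simp add: tier_bounded_def)
qed

text \<open>Opening the first argument replaces it by subterms of the same tier, so neither set of
  counted subterms grows.\<close>

lemma tier_bounded_case:
  assumes fs: "\<And>i. i < length ars \<Longrightarrow> tier_bounded ars (fs i) (replicate (ars ! i) p @ qs) m (c i)"
    and h: "is_case ars (length qs) fs h"
  shows "tier_bounded ars h (p # qs) m (\<Sum>i<length ars. c i)"
  unfolding tier_bounded_def
proof
  fix vs assume "vs \<in> tuples ars (length (p # qs))"
  then obtain v ys where vs: "vs = v # ys" "v \<in> terms ars" "ys \<in> tuples ars (length qs)"
    by (auto elim: tuples_Suc_cases)
  obtain i xs where v: "v = Con i xs" by (cases v)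
  have i: "i < length ars" "xs \<in> tuples ars (ars ! i)" using vs(2) by (simp_all add: v Con_in_terms)
  have l: "length xs = ars ! i" "length ys = length qs" using i vs by (simp_all add: tuples_def)
  have hv: "h vs = fs i (xs @ ys)" using h i vs v by (simp add: is_case_def)
  let ?ps = "replicate (ars ! i) p @ qs"
  have sub: "tier_subs P ?ps (xs @ ys) \<subseteq> tier_subs P (p # qs) vs" for P
    using l by (auto simp: tier_subs_append tier_subs_replicate vs v subs_Con simp del: subs.simps)
  have "xs @ ys \<in> tuples ars (length ?ps)" using tuples_append[OF i(2) vs(3)] by simp
  then have 1: "h vs \<in> terms ars" and
    2: "card (subs (h vs) - tier_subs (\<lambda>q. q = m) ?ps (xs @ ys)) \<le> (card (tier_subs (\<lambda>q. m < q) ?ps (xs @ ys)) + 2) ^ c i"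
    using fs[OF i(1)] unfolding tier_bounded_def hv by auto
  have "card (subs (h vs) - tier_subs (\<lambda>q. q = m) (p # qs) vs) \<le> card (subs (h vs) - tier_subs (\<lambda>q. q = m) ?ps (xs @ ys))"
    using sub by (intro card_mono) auto
  also note 2
  also have "(card (tier_subs (\<lambda>q. m < q) ?ps (xs @ ys)) + 2) ^ c i \<le> (card (tier_subs (\<lambda>q. m < q) (p # qs) vs) + 2) ^ c i"
    using sub by (intro power_mono add_right_mono card_mono) auto
  also have "\<dots> \<le> (card (tier_subs (\<lambda>q. m < q) (p # qs) vs) + 2) ^ (\<Sum>i<length ars. c i)"
    using i by (intro power_le_sum_exponent) auto
  finally show "h vs \<in> terms ars \<and> card (subs (h vs) - tier_subs (\<lambda>q. q = m) (p # qs) vs)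
      \<le> (card (tier_subs (\<lambda>q. m < q) (p # qs) vs) + 2) ^ (\<Sum>i<length ars. c i)"
    using 1 by simp
qed

text \<open>An inner value of tier above \<open>m\<close> is bounded as a whole and becomes input to
  the bound of \<open>f\<close>; an inner value of tier \<open>m\<close> is discounted in that
  bound, so its own new subterms are merely added. Inner values of lower tier enter no
  count.\<close>

lemma tier_bounded_comp:
  assumes f: "tier_bounded ars f ps m c" and l: "length gs = length ps"
    and gs: "\<And>i. i < length ps \<Longrightarrow> tier_bounded ars (gs ! i) qs (ps ! i) (d i)"
    and h: "is_comp ars (length qs) f gs h"
  shows "\<exists>e. tier_bounded ars h qs m e"
proof -
  let ?k = "length ps"
  define C where "C = (\<Sum>i<?k. d i)"
  \<comment> \<open>The first summand bounds the new nodes made by \<open>f\<close>, the second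
    those inherited from at most \<open>length ps\<close> inner values of tier
    \<open>m\<close>.\<close>
  define T where "T = (\<lambda>N. (?k * ((N + 2) ^ C + N) + 2) ^ c + ?k * (N + 2) ^ C)"
  have "pb T" unfolding T_def by (intro pb_intros)
  then obtain e where e: "\<And>N. T N \<le> (N + 2) ^ e" using pbD by blast
  have "h vs \<in> terms ars \<and> card (subs (h vs) - tier_subs (\<lambda>p. p = m) qs vs)
      \<le> T (card (tier_subs (\<lambda>p. m < p) qs vs))" if vs: "vs \<in> tuples ars (length qs)" for vs
  proof -
    let ?N = "card (tier_subs (\<lambda>p. m < p) qs vs)"
    let ?ws = "map (\<lambda>g. g vs) gs"
    have hv: "h vs = f ?ws" using h vs by (simp add: is_comp_def)
    have t: "(gs ! i) vs \<in> terms ars" if "i < ?k" for i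
      using gs[OF that] vs by (simp add: tier_bounded_def)
    then have ws: "?ws \<in> tuples ars (length ps)" using l by (auto simp: tuples_def in_set_conv_nth)
    have dC: "(?N + 2) ^ d i \<le> (?N + 2) ^ C" if "i < ?k" for i
      unfolding C_def using that by (intro power_le_sum_exponent) auto
    have hi: "card (subs ((gs ! i) vs)) \<le> (?N + 2) ^ C + ?N" if "i < ?k" "m < ps ! i" for i
      using tier_bounded_total[OF gs[OF that(1)] vs that(2)] dC[OF that(1)] by linarith
    let ?I = "{i. i < ?k \<and> m < ps ! i}"
    let ?J = "{i. i < ?k \<and> ps ! i = m}"
    have fin: "finite ?I" "finite ?J" by auto
    have nth: "tier_subs P ps ?ws = (\<Union>i\<in>{i. i < ?k \<and> P (ps ! i)}. subs ((gs ! i) vs))" for P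
      using l by (subst tier_subs_nth) auto
    have "card (tier_subs (\<lambda>p. m < p) ps ?ws) \<le> (\<Sum>i\<in>?I. card (subs ((gs ! i) vs)))"
      unfolding nth by (rule card_UN_le) (rule fin)
    also have "\<dots> \<le> (\<Sum>i\<in>?I. (?N + 2) ^ C + ?N)" using hi by (intro sum_mono) auto
    also have "\<dots> \<le> ?k * ((?N + 2) ^ C + ?N)"
      using card_mono[of "{..<?k}" ?I] by (auto intro!: mult_le_mono1)
    finally have b1: "card (tier_subs (\<lambda>p. m < p) ps ?ws) \<le> ?k * ((?N + 2) ^ C + ?N)" .
    let ?B = "\<Union>i\<in>?J. subs ((gs ! i) vs) - tier_subs (\<lambda>p. p = m) qs vs"
    have "card ?B \<le> (\<Sum>i\<in>?J. card (subs ((gs ! i) vs) - tier_subs (\<lambda>p. p = m) qs vs))"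
      by (rule card_UN_le) (rule fin)
    also have "\<dots> \<le> (\<Sum>i\<in>?J. (?N + 2) ^ C)"
    proof (rule sum_mono)
      fix i assume "i \<in> ?J"
      then have i: "i < ?k" "ps ! i = m" by auto
      have "card (subs ((gs ! i) vs) - tier_subs (\<lambda>p. p = m) qs vs) \<le> (?N + 2) ^ d i"
        using gs[OF i(1)] vs i(2) by (simp add: tier_bounded_def)
      with dC[OF i(1)] show "card (subs ((gs ! i) vs) - tier_subs (\<lambda>p. p = m) qs vs) \<le> (?N + 2) ^ C"
        by linarith
    qed
    also have "\<dots> \<le> ?k * (?N + 2) ^ C"
      using card_mono[of "{..<?k}" ?J] by (auto intro!: mult_le_mono1)
    finally have b2: "card ?B \<le> ?k * (?N + 2) ^ C" .
    let ?A = "subs (f ?ws) - tier_subs (\<lambda>p. p = m) ps ?ws"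
    have b3: "card ?A \<le> (card (tier_subs (\<lambda>p. m < p) ps ?ws) + 2) ^ c"
      using f ws by (simp add: tier_bounded_def)
    have b4: "(card (tier_subs (\<lambda>p. m < p) ps ?ws) + 2) ^ c \<le> (?k * ((?N + 2) ^ C + ?N) + 2) ^ c"
      using b1 by (intro power_mono) auto
    have "subs (h vs) - tier_subs (\<lambda>p. p = m) qs vs \<subseteq> ?A \<union> ?B"
      unfolding hv nth by auto
    then have "card (subs (h vs) - tier_subs (\<lambda>p. p = m) qs vs) \<le> card (?A \<union> ?B)"
      by (intro card_mono) auto
    also have "\<dots> \<le> card ?A + card ?B" by (rule card_Un_le)
    finally have "card (subs (h vs) - tier_subs (\<lambda>p. p = m) qs vs) \<le> T ?N"
      using b2 b3 b4 unfolding T_def by linarith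
    moreover have "h vs \<in> terms ars" using f ws by (simp add: hv tier_bounded_def)
    ultimately show ?thesis by blast
  qed
  then show ?thesis unfolding tier_bounded_def using e order_trans by blast
qed

lemma is_simrec_terms:
  assumes fs: "\<And>i j vs. i < length ars \<Longrightarrow> j < n \<Longrightarrow> vs \<in> tuples ars (ars ! i + n * ars ! i + m) \<Longrightarrow>
      fs i j vs \<in> terms ars"
    and g: "is_simrec ars n m fs gs" and ys: "ys \<in> tuples ars m" and "v \<in> terms ars"
  shows "\<forall>j<n. gs j (v # ys) \<in> terms ars"
  using assms(4)
proof (induction v rule: trm.induct)
  case (Con i xs)
  have i: "i < length ars" "xs \<in> tuples ars (ars ! i)" using Con.prems by (simp_all add: Con_in_terms)
  then have "rec_values n gs xs ys \<in> tuples ars (n * ars ! i)"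
    using Con.IH by (auto simp: tuples_def length_rec_values)
  then have "xs @ rec_values n gs xs ys @ ys \<in> tuples ars (ars ! i + n * ars ! i + m)"
    using i(2) ys tuples_append by (metis append.assoc)
  then show ?case using fs i g ys by (simp add: is_simrec_def)
qed

text \<open>Recursive results have tier \<open>m\<close>, so they are discounted and do not enter
  the polynomial of the step functions. Hence each pair of a subterm \<open>u\<close> of the
  recursion argument and a component \<open>l\<close> contributes a batch whose bound does not
  depend on the depth, and \<open>p > m\<close> places the number of these \<open>u\<close> among
  the quantities of higher tier.\<close>

lemma tier_bounded_simrec:
  assumes fs: "\<And>i j. i < length ars \<Longrightarrow> j < n \<Longrightarrow>
      tier_bounded ars (fs i j) (replicate (ars ! i) p @ replicate (n * ars ! i) m @ qs) m (c i j)"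
    and p: "p > m" and g: "is_simrec ars n (length qs) fs gs" and j: "j < n"
  shows "\<exists>e. tier_bounded ars (gs j) (p # qs) m e"
proof -
  define C where "C = (\<Sum>i<length ars. \<Sum>j<n. c i j)"
  define T where "T = (\<lambda>N. N * (n * (N + 2) ^ C))"
  have "pb T" unfolding T_def by (intro pb_intros)
  then obtain e where e: "\<And>N. T N \<le> (N + 2) ^ e" using pbD by blast
  have cC: "c i j \<le> C" if "i < length ars" "j < n" for i j
  proof -
    have "c i j \<le> (\<Sum>j<n. c i j)" using that by (intro member_le_sum) auto
    also have "\<dots> \<le> C" unfolding C_def using that by (intro member_le_sum) auto
    finally show ?thesis .
  qed
  have "gs j vs \<in> terms ars \<and> card (subs (gs j vs) - tier_subs (\<lambda>q. q = m) (p # qs) vs)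
      \<le> T (card (tier_subs (\<lambda>q. m < q) (p # qs) vs))"
    if "vs \<in> tuples ars (length (p # qs))" for vs
  proof -
    from that obtain v ys where vs: "vs = v # ys" "v \<in> terms ars" "ys \<in> tuples ars (length qs)"
      by (auto elim: tuples_Suc_cases)
    let ?G = "tier_subs (\<lambda>q. m < q) (p # qs) vs"
    let ?D = "tier_subs (\<lambda>q. q = m) qs ys"
    let ?ps = "\<lambda>i. replicate (ars ! i) p @ replicate (n * ars ! i) m @ qs"
    let ?args = "\<lambda>xs. xs @ rec_values n gs xs ys @ ys"
    have fst: "fs i j vs \<in> terms ars" if "i < length ars" "j < n" "vs \<in> tuples ars (ars ! i + n * ars ! i + length qs)" for i j vs
      using fs[OF that(1,2)] that(3) by (simp add: tier_bounded_def add.assoc)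
    have gt: "gs j (t # ys) \<in> terms ars" if "t \<in> terms ars" "j < n" for t j
      using is_simrec_terms[OF fst g vs(3) that(1)] that(2) by blast
    \<comment> \<open>The nodes made by component \<open>j\<close> at \<open>t\<close> itself,
      beyond all tier-\<open>m\<close> arguments of the step function, recursive results
      included.\<close>
    define New where "New = (\<lambda>t j. case t of Con i xs \<Rightarrow>
      subs (gs j (t # ys)) - tier_subs (\<lambda>q. q = m) (?ps i) (?args xs))"
    have tierP: "tier_subs P (?ps i) (?args xs) = (if P p then all_subs xs else {}) \<union>
        (if P m then all_subs (rec_values n gs xs ys) else {}) \<union> tier_subs P qs ys"
      if "length xs = ars ! i" for P i xs
      using that by (auto simp: tier_subs_append tier_subs_replicate length_rec_values)
    have args: "?args xs \<in> tuples ars (length (?ps i))" if "i < length ars" "xs \<in> tuples ars (ars ! i)" for i xs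
    proof -
      have "rec_values n gs xs ys \<in> tuples ars (n * ars ! i)"
        using that gt by (auto simp: tuples_def length_rec_values)
      then show ?thesis using that vs(3) tuples_append by (metis length_append length_replicate)
    qed
    \<comment> \<open>The discounted arguments are the recursive results, covered by the induction
      hypothesis, and the parameters of tier \<open>m\<close>.\<close>
    have cover: "subs (gs j (t # ys)) \<subseteq> ?D \<union> (\<Union>u\<in>subs t. \<Union>l<n. New u l)" if "t \<in> terms ars" "j < n" for t j
      using that
    proof (induction t arbitrary: j rule: trm.induct)
      case (Con i xs)
      have i: "i < length ars" "length xs = ars ! i" "set xs \<subseteq> terms ars"
        using Con.prems by (auto simp: Con_in_terms tuples_def)
      have "subs (gs j (Con i xs # ys)) \<subseteq> New (Con i xs) j \<union> tier_subs (\<lambda>q. q = m) (?ps i) (?args xs)"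
        by (auto simp: New_def)
      also have "tier_subs (\<lambda>q. q = m) (?ps i) (?args xs) = (\<Union>l<n. \<Union>x\<in>set xs. subs (gs l (x # ys))) \<union> ?D"
        using p unfolding tierP[OF i(2)] all_subs_rec_values by auto
      also have "(\<Union>l<n. \<Union>x\<in>set xs. subs (gs l (x # ys))) \<subseteq> ?D \<union> (\<Union>u\<in>subs (Con i xs). \<Union>l<n. New u l)"
        using Con.IH i(3) by fastforce
      finally show ?case using Con.prems(2) by auto
    qed
    have newcard: "card (New t l) \<le> (card ?G + 2) ^ C" if t: "t \<in> subs v" and l: "l < n" for t l
    proof -
      obtain i xs where tc: "t = Con i xs" by (cases t)
      have "t \<in> terms ars" using subs_terms[OF vs(2)] t by blast
      then have i: "i < length ars" "xs \<in> tuples ars (ars ! i)" by (simp_all add: tc Con_in_terms)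
      then have len: "length xs = ars ! i" by (simp add: tuples_def)
      have gl: "gs l (t # ys) = fs i l (?args xs)" using g i l vs(3) by (simp add: is_simrec_def tc)
      have "all_subs xs \<subseteq> subs v" using subs_trans[OF t] unfolding tc subs_Con by blast
      \<comment> \<open>Since \<open>m < m\<close> fails, the recursive results drop out here; what
        remains are subterms of \<open>v\<close> and of the parameters of higher tier.\<close>
      then have sub: "tier_subs (\<lambda>q. m < q) (?ps i) (?args xs) \<subseteq> ?G"
        unfolding tierP[OF len] using p by (auto simp: vs(1))
      have "card (New t l) \<le> (card (tier_subs (\<lambda>q. m < q) (?ps i) (?args xs)) + 2) ^ c i l"
        using fs[OF i(1) l] args[OF i] unfolding tier_bounded_def New_def tc trm.case gl[unfolded tc] by blast
      also have "\<dots> \<le> (card ?G + 2) ^ c i l"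
        using sub by (intro power_mono add_right_mono card_mono) auto
      also have "\<dots> \<le> (card ?G + 2) ^ C" using cC[OF i(1) l] by (intro power_increasing) auto
      finally show ?thesis .
    qed
    have fin: "finite (New u l)" for u l by (cases u) (simp add: New_def)
    have "subs v \<subseteq> ?G" using p by (simp add: vs(1))
    then have sv: "card (subs v) \<le> card ?G" by (intro card_mono) auto
    have "subs (gs j vs) - tier_subs (\<lambda>q. q = m) (p # qs) vs \<subseteq> (\<Union>u\<in>subs v. \<Union>l<n. New u l)"
      using cover[OF vs(2) j] p by (auto simp: vs(1))
    then have "card (subs (gs j vs) - tier_subs (\<lambda>q. q = m) (p # qs) vs) \<le> card (\<Union>u\<in>subs v. \<Union>l<n. New u l)"
      using fin by (intro card_mono) auto
    also have "\<dots> \<le> (\<Sum>u\<in>subs v. card (\<Union>l<n. New u l))" by (rule card_UN_le) simp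
    also have "\<dots> \<le> (\<Sum>u\<in>subs v. n * (card ?G + 2) ^ C)"
    proof (rule sum_mono)
      fix u assume u: "u \<in> subs v"
      have "card (\<Union>l<n. New u l) \<le> (\<Sum>l<n. card (New u l))" by (rule card_UN_le) simp
      also have "\<dots> \<le> (\<Sum>l<n. (card ?G + 2) ^ C)" using newcard[OF u] by (intro sum_mono) auto
      finally show "card (\<Union>l<n. New u l) \<le> n * (card ?G + 2) ^ C" by simp
    qed
    also have "\<dots> = card (subs v) * (n * (card ?G + 2) ^ C)" by simp
    also have "\<dots> \<le> T (card ?G)" unfolding T_def using sv by (rule mult_le_mono1)
    finally show ?thesis using gt[OF vs(2) j] by (simp add: vs(1))
  qed
  then show ?thesis unfolding tier_bounded_def using e order_trans by blast
qed

theorem tiered_bounded: "tiered ars f ps m \<Longrightarrow> \<exists>c. tier_bounded ars f ps m c"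
proof (induction rule: tiered.induct)
  case (constr i h n)
  then show ?case using tier_bounded_constr by blast
next
  case (proj n ps h)
  then show ?case using tier_bounded_proj by blast
next
  case (casedist fs p qs m h)
  then have "\<forall>i. \<exists>c. i < length ars \<longrightarrow> tier_bounded ars (fs i) (replicate (ars ! i) p @ qs) m c" by blast
  then obtain c where "\<And>i. i < length ars \<Longrightarrow> tier_bounded ars (fs i) (replicate (ars ! i) p @ qs) m (c i)"
    by metis
  from tier_bounded_case[OF this] casedist show ?case by blast
next
  case (comp f ps m gs qs h)
  then have "\<forall>i. \<exists>d. i < length ps \<longrightarrow> tier_bounded ars (gs ! i) qs (ps ! i) d" by blast
  then obtain d where "\<And>i. i < length ps \<Longrightarrow> tier_bounded ars (gs ! i) qs (ps ! i) (d i)" by metis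
  with comp tier_bounded_comp show ?case by blast
next
  case (simrec n fs p m qs gs j)
  then have "\<forall>i j. \<exists>c. i < length ars \<longrightarrow> j < n \<longrightarrow>
    tier_bounded ars (fs i j) (replicate (ars ! i) p @ replicate (n * ars ! i) m @ qs) m c" by blast
  then obtain c where "\<And>i j. i < length ars \<Longrightarrow> j < n \<Longrightarrow>
    tier_bounded ars (fs i j) (replicate (ars ! i) p @ replicate (n * ars ! i) m @ qs) m (c i j)"
    by metis
  from tier_bounded_simrec[of ars n fs p m qs c, OF this] simrec show ?case by blast
qed

text \<open>Forgets the tiers: both the new and the discounted subterms are polynomial in
  \<open>dag_size\<close>. Only in this form do tiers reach the evaluation.\<close>

corollary tiered_dag_size:
  assumes "tiered ars f ps m"
  shows "\<exists>c. \<forall>vs \<in> tuples ars (length ps). f vs \<in> terms ars \<and> card (subs (f vs)) \<le> (dag_size vs + 2) ^ c"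
proof -
  obtain c where c: "tier_bounded ars f ps m c" using tiered_bounded[OF assms] by blast
  have "pb (\<lambda>n. (n + 2) ^ c + n)" by (intro pb_intros)
  then obtain e where e: "\<And>n. (n + 2) ^ c + n \<le> (n + 2 :: nat) ^ e" using pbD by blast
  have "card (subs (f vs)) \<le> (dag_size vs + 2) ^ e" if "vs \<in> tuples ars (length ps)" for vs
  proof -
    let ?D = "tier_subs (\<lambda>p. p = m) ps vs"
    have le: "card (tier_subs P ps vs) \<le> dag_size vs" for P
      unfolding dag_size_def by (intro card_mono tier_subs_subset) simp
    have "card (subs (f vs)) \<le> card ((subs (f vs) - ?D) \<union> ?D)" by (intro card_mono) auto
    also have "\<dots> \<le> card (subs (f vs) - ?D) + card ?D" by (rule card_Un_le)
    also have "card (subs (f vs) - ?D) \<le> (card (tier_subs (\<lambda>p. m < p) ps vs) + 2) ^ c"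
      using c that by (simp add: tier_bounded_def)
    also have "\<dots> \<le> (dag_size vs + 2) ^ c" using le by (intro power_mono) auto
    finally show ?thesis using le[of "\<lambda>p. p = m"] e[of "dag_size vs"] by linarith
  qed
  then show ?thesis using c unfolding tier_bounded_def by blast
qed

section \<open>Evaluation of tiered functions\<close>


lemma length_concat_uniform:
  "(\<And>l. l < a \<Longrightarrow> length (f l) = n) \<Longrightarrow> length (concat (map f [0..<a])) = a * n"
  by (induction a) auto

lemma nth_concat_uniform:
  assumes "\<And>l. l < a \<Longrightarrow> length (f l) = n" "l < a" "j < n"
  shows "concat (map f [0..<a]) ! (l * n + j) = f l ! j"
  using assms
proof (induction a)
  case (Suc a)
  have len: "length (concat (map f [0..<a])) = a * n"
    using Suc.prems(1) by (intro length_concat_uniform) simp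
  show ?case
  proof (cases "l < a")
    case True
    then have "l * n + n \<le> a * n" by (metis Suc_leI add.commute mult_Suc mult_le_mono1)
    then have "l * n + j < a * n" using Suc.prems(3) by linarith
    then show ?thesis using Suc True len by (simp add: nth_append)
  next
    case False
    then have "l = a" using Suc.prems(2) by simp
    then show ?thesis using len by (simp add: nth_append)
  qed
qed simp

context signature
begin

text \<open>The cost is measured in distinct subterms, since the term sizes of intermediate values
  may be exponential. The rest \<open>V\<close> of the stack is arbitrary, so that programs can be
  nested.\<close>

definition computable :: "tfun \<Rightarrow> nat \<Rightarrow> bool" where
  "computable f k \<longleftrightarrow> (\<exists>c e. \<forall>vs \<in> tuples ars k. \<forall>V.
     run c (map ev vs @ V) (ev (f vs) # V) ((dag_size vs + 2) ^ e))"

lemma computableI: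
  assumes "pb T" "\<And>vs V. vs \<in> tuples ars k \<Longrightarrow> run c (map ev vs @ V) (ev (f vs) # V) (T (dag_size vs))"
  shows "computable f k"
proof -
  obtain e where "\<And>n. T n \<le> (n + 2) ^ e" using pbD[OF assms(1)] by blast
  then show ?thesis unfolding computable_def using assms(2) run_mono by blast
qed

lemma computable_constr:
  assumes "i < length ars" "is_constr ars i h"
  shows "computable h (ars ! i)"
proof (rule computableI[OF pb_const])
  fix vs V assume "vs \<in> tuples ars (ars ! i)"
  then show "run (mkcon i (ars ! i)) (map ev vs @ V) (ev (h vs) # V) (5 * (ars ! i) + 3)"
    using assms run_mkcon by (auto simp: is_constr_def tuples_def)
qed

lemma computable_proj:
  assumes "n < k" "is_proj ars k n h"
  shows "computable h k"
proof (rule computableI[OF pb_const])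
  fix vs V assume vs: "vs \<in> tuples ars k"
  then have l: "length vs = k" by (simp add: tuples_def)
  have 1: "run (blk [OPick n]) (map ev vs @ V) (ev (vs ! n) # map ev vs @ V) (n + 1)"
    by (rule run_blk_le) (use l assms(1) in \<open>simp_all add: nth_append\<close>)
  have 2: "run (nip k) (ev (vs ! n) # map ev vs @ V) (ev (vs ! n) # V) (2 * k)"
    by (rule run_nip) (simp add: l)
  from run_seq[OF 1 2] show "run (blk [OPick n] ;; nip k) (map ev vs @ V) (ev (h vs) # V) ((n + 1) + 2 * k)"
    using assms(2) vs by (simp add: is_proj_def del: blk.simps)
qed

lemma computable_case:
  assumes fs: "\<And>i. i < length ars \<Longrightarrow> computable (fs i) (ars ! i + n)" and h: "is_case ars n fs h"
  shows "computable h (Suc n)"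
proof -
  have "\<forall>i. \<exists>c e. i < length ars \<longrightarrow> (\<forall>vs \<in> tuples ars (ars ! i + n). \<forall>V.
     run c (map ev vs @ V) (ev (fs i vs) # V) ((dag_size vs + 2) ^ e))"
    using fs unfolding computable_def by blast
  then obtain c e where ce: "\<And>i vs V. i < length ars \<Longrightarrow> vs \<in> tuples ars (ars ! i + n) \<Longrightarrow>
     run (c i) (map ev vs @ V) (ev (fs i vs) # V) ((dag_size vs + 2) ^ e i)" by metis
  define E where "E = (\<Sum>i<length ars. e i)"
  show ?thesis
  proof (rule computableI)
    show "pb (\<lambda>N. (6 * sum_list ars + 3) + (N + 2) ^ E + 8 * length ars)" by (intro pb_intros)
    fix vs V assume "vs \<in> tuples ars (Suc n)"
    then obtain v ys where vs: "vs = v # ys" "v \<in> terms ars" "ys \<in> tuples ars n"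
      by (auto elim: tuples_Suc_cases)
    obtain i xs where v: "v = Con i xs" by (cases v)
    have i: "i < length ars" "xs \<in> tuples ars (ars ! i)" using vs(2) by (simp_all add: v Con_in_terms)
    then have l: "length xs = ars ! i" by (simp add: tuples_def)
    have "dag_size (xs @ ys) \<le> dag_size vs" by (intro dag_size_mono) (auto simp: vs v subs_Con simp del: subs.simps)
    then have "(dag_size (xs @ ys) + 2) ^ e i \<le> (dag_size vs + 2) ^ e i" by (intro power_mono) auto
    also have "\<dots> \<le> (dag_size vs + 2) ^ E" unfolding E_def using i(1) by (intro power_le_sum_exponent) auto
    finally have le: "(dag_size (xs @ ys) + 2) ^ e i \<le> (dag_size vs + 2) ^ E" .
    have 1: "run (decon (ars ! i)) (ev (Con i xs) # map ev ys @ V) (map ev (xs @ ys) @ V) (6 * ars ! i + 3)"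
      using run_decon[OF l] by simp
    have 2: "run (c i) (map ev (xs @ ys) @ V) (ev (fs i (xs @ ys)) # V) ((dag_size (xs @ ys) + 2) ^ e i)"
      by (rule ce[OF i(1)]) (rule tuples_append[OF i(2) vs(3)])
    have "run (switch (\<lambda>i. decon (ars ! i) ;; c i) [0..<length ars]) (ev (Con i xs) # map ev ys @ V)
      (ev (fs i (xs @ ys)) # V)
      (((6 * ars ! i + 3) + (dag_size (xs @ ys) + 2) ^ e i) + 8 * length [0..<length ars])"
      using run_seq[OF 1 2] i(1) unfolding ev.simps by (intro run_switch) auto
    then have "run (switch (\<lambda>i. decon (ars ! i) ;; c i) [0..<length ars]) (ev (Con i xs) # map ev ys @ V)
      (ev (fs i (xs @ ys)) # V) ((6 * sum_list ars + 3) + (dag_size vs + 2) ^ E + 8 * length ars)"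
      by (rule run_mono) (use le nth_le_sum_list[OF i(1)] in simp)
    moreover have "h vs = fs i (xs @ ys)" using h i vs(3) by (simp add: is_case_def vs(1) v)
    ultimately show "run (switch (\<lambda>i. decon (ars ! i) ;; c i) [0..<length ars]) (map ev vs @ V) (ev (h vs) # V)
       ((6 * sum_list ars + 3) + (dag_size vs + 2) ^ E + 8 * length ars)"
      by (simp add: vs(1) v)
  qed
qed

lemma map_nth_append_upt: "length xs = m \<Longrightarrow> map ((!) (zs @ xs @ ys)) [length zs..<length zs + m] = xs"
  by (rule nth_equalityI) (auto simp: nth_append)

text \<open>The cost of \<open>f\<close> is measured on the inner values, so their sizes must be
  polynomial. The inner functions run from last to first, each on a fresh copy of the arguments,
  which leaves their results in order on top.\<close>

lemma computable_comp:
  assumes f: "computable f (length gs)"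
    and gs: "\<And>i. i < length gs \<Longrightarrow> computable (gs ! i) m"
    and size: "\<And>i. i < length gs \<Longrightarrow> \<exists>d. \<forall>vs \<in> tuples ars m. (gs ! i) vs \<in> terms ars \<and>
       card (subs ((gs ! i) vs)) \<le> (dag_size vs + 2) ^ d"
    and h: "is_comp ars m f gs h"
  shows "computable h m"
proof -
  let ?k = "length gs"
  obtain cf ef where cf: "\<And>vs V. vs \<in> tuples ars ?k \<Longrightarrow>
      run cf (map ev vs @ V) (ev (f vs) # V) ((dag_size vs + 2) ^ ef)"
    using f unfolding computable_def by blast
  have "\<forall>i. \<exists>c e. i < ?k \<longrightarrow> (\<forall>vs \<in> tuples ars m. \<forall>V.
     run c (map ev vs @ V) (ev ((gs ! i) vs) # V) ((dag_size vs + 2) ^ e))"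
    using gs unfolding computable_def by blast
  then obtain c e where ce: "\<And>i vs V. i < ?k \<Longrightarrow> vs \<in> tuples ars m \<Longrightarrow>
     run (c i) (map ev vs @ V) (ev ((gs ! i) vs) # V) ((dag_size vs + 2) ^ e i)" by metis
  have "\<forall>i. \<exists>d. i < ?k \<longrightarrow> (\<forall>vs \<in> tuples ars m. (gs ! i) vs \<in> terms ars \<and>
       card (subs ((gs ! i) vs)) \<le> (dag_size vs + 2) ^ d)"
    using size by blast
  then obtain d where d: "\<And>i vs. i < ?k \<Longrightarrow> vs \<in> tuples ars m \<Longrightarrow> (gs ! i) vs \<in> terms ars"
    "\<And>i vs. i < ?k \<Longrightarrow> vs \<in> tuples ars m \<Longrightarrow> card (subs ((gs ! i) vs)) \<le> (dag_size vs + 2) ^ d i"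
    by metis
  define E where "E = (\<Sum>i<?k. e i)"
  define D where "D = (\<Sum>i<?k. d i)"
  define P where "P = rep (\<lambda>j. picks [j..<j + m] ;; c (?k - Suc j)) ?k ;; cf ;; nip m"
  define T where "T = (\<lambda>N. (\<Sum>j<?k. picks_cost [j..<j + m] + (N + 2) ^ E) + ((?k * (N + 2) ^ D + 2) ^ ef + 2 * m))"
  show ?thesis
  proof (rule computableI)
    show "pb T" unfolding T_def by (intro pb_intros)
    fix vs V assume vs: "vs \<in> tuples ars m"
    then have l: "length vs = m" by (simp add: tuples_def)
    let ?N = "dag_size vs"
    let ?ws = "map (\<lambda>g. g vs) gs"
    \<comment> \<open>The stack after \<open>j\<close> rounds: the results of the last
      \<open>j\<close> inner functions above the original arguments.\<close>
    define S where "S = (\<lambda>j. map (\<lambda>i. ev ((gs ! i) vs)) [?k - j..<?k] @ map ev vs @ V)"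
    have "run (rep (\<lambda>j. picks [j..<j + m] ;; c (?k - Suc j)) ?k) (S 0) (S ?k)
       (\<Sum>j<?k. picks_cost [j..<j + m] + (?N + 2) ^ E)"
    proof (rule run_rep)
      fix j assume j: "j < ?k"
      have "length (map (\<lambda>i. ev ((gs ! i) vs)) [?k - j..<?k]) = j" using j by simp
      with map_nth_append_upt[of "map ev vs" m "map (\<lambda>i. ev ((gs ! i) vs)) [?k - j..<?k]" V]
      have "map ((!) (S j)) [j..<j + m] = map ev vs" using l by (simp add: S_def add.commute)
      with run_picks[of "[j..<j + m]" "S j"]
      have 1: "run (picks [j..<j + m]) (S j) (map ev vs @ S j) (picks_cost [j..<j + m])"
        using l j by (simp add: S_def)
      have k: "?k - Suc j < ?k" using j by simp
      have "[?k - Suc j..<?k] = (?k - Suc j) # [?k - j..<?k]"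
        using j by (simp add: upt_conv_Cons Suc_diff_Suc)
      then have "S (Suc j) = ev ((gs ! (?k - Suc j)) vs) # S j" by (simp add: S_def)
      then have 2: "run (c (?k - Suc j)) (map ev vs @ S j) (S (Suc j)) ((?N + 2) ^ e (?k - Suc j))"
        using ce[OF k vs] by simp
      have "(?N + 2) ^ e (?k - Suc j) \<le> (?N + 2) ^ E"
        unfolding E_def using k by (intro power_le_sum_exponent) auto
      with run_seq[OF 1 2] show "run (picks [j..<j + m] ;; c (?k - Suc j)) (S j) (S (Suc j))
         (picks_cost [j..<j + m] + (?N + 2) ^ E)"
        by (auto elim: run_mono)
    qed
    moreover have "S 0 = map ev vs @ V" "S ?k = map ev ?ws @ map ev vs @ V"
      by (auto simp: S_def intro!: nth_equalityI)
    ultimately have 1: "run (rep (\<lambda>j. picks [j..<j + m] ;; c (?k - Suc j)) ?k) (map ev vs @ V)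
       (map ev ?ws @ map ev vs @ V) (\<Sum>j<?k. picks_cost [j..<j + m] + (?N + 2) ^ E)" by simp
    have ws: "?ws \<in> tuples ars ?k" using d(1)[OF _ vs] by (auto simp: tuples_def in_set_conv_nth)
    have "dag_size ?ws \<le> ?k * (?N + 2) ^ D"
    proof -
      have "all_subs ?ws = (\<Union>i<?k. subs ((gs ! i) vs))"
        by (auto simp: all_subs_def set_conv_nth)
      then have "dag_size ?ws \<le> (\<Sum>i<?k. card (subs ((gs ! i) vs)))"
        unfolding dag_size_def using card_UN_le[of "{..<?k}" "\<lambda>i. subs ((gs ! i) vs)"] by simp
      also have "\<dots> \<le> (\<Sum>i<?k. (?N + 2) ^ D)"
      proof (rule sum_mono)
        fix i assume i: "i \<in> {..<?k}"
        then have "card (subs ((gs ! i) vs)) \<le> (?N + 2) ^ d i" using d(2) vs by simp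
        also have "\<dots> \<le> (?N + 2) ^ D" unfolding D_def using i by (intro power_le_sum_exponent) auto
        finally show "card (subs ((gs ! i) vs)) \<le> (?N + 2) ^ D" .
      qed
      finally show ?thesis by simp
    qed
    then have "(dag_size ?ws + 2) ^ ef \<le> (?k * (?N + 2) ^ D + 2) ^ ef" by (intro power_mono) auto
    with cf[OF ws] have 2: "run cf (map ev ?ws @ map ev vs @ V) (ev (f ?ws) # map ev vs @ V)
        ((?k * (?N + 2) ^ D + 2) ^ ef)" using run_mono by blast
    have 3: "run (nip m) (ev (f ?ws) # map ev vs @ V) (ev (f ?ws) # V) (2 * m)"
      by (rule run_nip) (simp add: l)
    from run_seq[OF 1 run_seq[OF 2 3]] show "run P (map ev vs @ V) (ev (h vs) # V) (T ?N)"
      using h vs by (simp add: P_def T_def is_comp_def)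
  qed
qed

section \<open>Simultaneous recursion\<close>

text \<open>
  At a node with \<open>a\<close> arguments, the iterations \<open>gather n a 0, \<dots>, gather n a (a - 1)\<close> push the rows
  of the \<open>n\<close> memoised values at its arguments, the last argument first. The offsets below are
  positions in the resulting stack, which holds the \<open>a\<close> rows, the \<open>a\<close> arguments, the node, the
  worklist, the memo table, the recursion argument and the \<open>m\<close> parameters.
\<close>

definition gather :: "nat \<Rightarrow> nat \<Rightarrow> nat \<Rightarrow> prog" where
  "gather n a c = blk [OPick (c * n + (a - Suc c)), OAtom 0, OPick (c * n + a + 4)] ;; assoc ;;
     blk [ODel 1] ;; unlist n ;; blk [ODel 0]"

definition arg_offsets :: "nat \<Rightarrow> nat \<Rightarrow> nat \<Rightarrow> nat list" where
  "arg_offsets n a m = map (\<lambda>l. a * n + l) [0..<a] @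
     concat (map (\<lambda>j. map (\<lambda>l. l * n + j) [0..<a]) [0..<n]) @ map (\<lambda>q. a * n + a + 4 + q) [0..<m]"

definition rec_step :: "nat \<Rightarrow> nat \<Rightarrow> (nat \<Rightarrow> prog) \<Rightarrow> nat \<Rightarrow> prog" where
  "rec_step n m P a = blk [OPick 0] ;; decon a ;; rep (gather n a) a ;;
     rep (\<lambda>c. picks (map ((+) c) (arg_offsets n a m)) ;; P (n - Suc c)) n ;;
     blk [OAtom 0] ;; mklist n ;; nip (a * n + a)"

definition rec_step_cost :: "nat \<Rightarrow> nat \<Rightarrow> nat \<Rightarrow> nat \<Rightarrow> nat \<Rightarrow> nat" where
  "rec_step_cost n m a N B = 1 + (6 * a + 3) + a * (18 * N + 2 * (a * n + a) + 6 * n + 20) +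
     (\<Sum>c<n. picks_cost (map ((+) c) (arg_offsets n a m)) + B) + 1 + 5 * n + 2 * (a * n + a)"

text \<open>One memo entry holds the values of all \<open>n\<close> components, as each step
  function receives all of them at every argument.\<close>

definition rec_row :: "nat \<Rightarrow> (nat \<Rightarrow> tfun) \<Rightarrow> trm list \<Rightarrow> trm \<Rightarrow> val list" where
  "rec_row n gs ys t = map (\<lambda>j. ev (gs j (t # ys))) [0..<n]"

lemma length_rec_row [simp]: "length (rec_row n gs ys t) = n"
  by (simp add: rec_row_def)

lemma run_gather:
  fixes x w :: val and V :: "val list"
  assumes xs: "length xs = a" "set xs \<subseteq> set Xs" and c: "c < a"
    and r: "\<And>t. r t = lst (rev (rec_row n gs ys t))"
  defines "S \<equiv> \<lambda>c. concat (map (\<lambda>l. rec_row n gs ys (xs ! l)) [a - c..<a]) @ map ev xs @ x # w # AL r Xs # V"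
  shows "run (gather n a c) (S c) (S (Suc c)) (18 * length Xs + 2 * (a * n + a) + 6 * n + 20)"
proof -
  let ?t = "xs ! (a - Suc c)"
  have len: "length (concat (map (\<lambda>l. rec_row n gs ys (xs ! l)) [a - c..<a])) = c * n"
    using c by (simp add: length_concat o_def sum_list_triv)
  have t: "?t \<in> set Xs" using xs c by (metis diff_less nth_mem subsetD zero_less_Suc less_trans_Suc gr_implies_not0 neq0_conv)
  have cn: "c * n \<le> a * n" using c by simp
  have nth: "S c ! (c * n + l) = (map ev xs @ x # w # AL r Xs # V) ! l" for l
    unfolding S_def len[symmetric] by (rule nth_append_length_plus)
  have nth1: "S c ! (c * n + (a - Suc c)) = ev ?t"
    using nth[of "a - Suc c"] c xs by (simp add: nth_append)
  have nth2: "S c ! (c * n + a + 2) = AL r Xs"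
    using nth[of "a + 2"] xs by (simp add: nth_append add.assoc)
  have ls: "c * n + a + 2 < length (S c)" using xs len by (simp add: S_def)
  have "exops [OPick (c * n + (a - Suc c)), OAtom 0, OPick (c * n + a + 4)] (S c)
      = Some (AL r Xs # Atom 0 # ev ?t # S c)"
  proof -
    \<comment> \<open>The table lies below \<open>c * n\<close> row entries, \<open>a\<close>
      arguments, the node and the worklist; the two values just pushed raise its index by
      two.\<close>
    have "c * n + a + 4 = Suc (Suc (c * n + a + 2))" by simp
    then show ?thesis using nth1 nth2 ls by (simp add: atoms_def)
  qed
  then have 1: "run (blk [OPick (c * n + (a - Suc c)), OAtom 0, OPick (c * n + a + 4)]) (S c)
      (AL r Xs # Atom 0 # ev ?t # S c) (2 * (a * n + a) + 7)"
    by (rule run_blk_le) (simp, use cn in linarith)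
  have 2: "run assoc (AL r Xs # Atom 0 # ev ?t # S c) (r ?t # ev ?t # S c) (18 * length Xs + 2)"
    using run_assoc[of "map (\<lambda>t. (ev t, r t)) Xs" "ev ?t"] t by (simp add: found_AL AL_def)
  have 3: "run (blk [ODel 1]) (r ?t # ev ?t # S c) (lst (rev (rec_row n gs ys ?t)) # S c) 2"
    by (rule run_blk_le) (simp_all add: r)
  have 4: "run (unlist n) (lst (rev (rec_row n gs ys ?t)) # S c) (Atom 0 # rec_row n gs ys ?t @ S c) (6 * n)"
    by (rule run_unlist) simp
  have "[a - Suc c..<a] = (a - Suc c) # [a - c..<a]"
    using c by (simp add: upt_conv_Cons Suc_diff_Suc)
  then have "S (Suc c) = rec_row n gs ys ?t @ S c" by (simp add: S_def)
  then have 5: "run (blk [ODel 0]) (Atom 0 # rec_row n gs ys ?t @ S c) (S (Suc c)) 1"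
    by (intro run_blk_le) simp_all
  show ?thesis unfolding gather_def
    by (rule run_mono[OF run_seq[OF 1 run_seq[OF 2 run_seq[OF 3 run_seq[OF 4 5]]]]]) simp
qed

text \<open>Rows group the recursive results by argument, while the step functions expect them
  grouped by component; the index \<open>l * n + j\<close> transposes the two.\<close>

lemma arg_offsets_nth:
  fixes x w b z :: val and V :: "val list" and n :: nat and gs :: "nat \<Rightarrow> tfun"
  assumes xs: "length xs = a" and ys: "length ys = m"
  defines "S \<equiv> concat (map (\<lambda>l. rec_row n gs ys (xs ! l)) [0..<a]) @ map ev xs @ x # w # b # z # map ev ys @ V"
  shows "map ((!) S) (arg_offsets n a m) = map ev (xs @ rec_values n gs xs ys @ ys)"
    and "\<forall>i \<in> set (arg_offsets n a m). i < length S"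
proof -
  have len: "length (concat (map (\<lambda>l. rec_row n gs ys (xs ! l)) [0..<a])) = a * n"
    by (rule length_concat_uniform) simp
  have row: "S ! (l * n + j) = ev (gs j (xs ! l # ys))" "l * n + j < a * n" if "l < a" "j < n" for l j
  proof -
    have "l * n + n \<le> a * n" using that by (metis Suc_leI add.commute mult_Suc mult_le_mono1)
    then show *: "l * n + j < a * n" using that by linarith
    have "S ! (l * n + j) = concat (map (\<lambda>l. rec_row n gs ys (xs ! l)) [0..<a]) ! (l * n + j)"
      using * len by (simp add: S_def nth_append)
    also have "\<dots> = rec_row n gs ys (xs ! l) ! j" by (rule nth_concat_uniform) (use that in simp_all)
    finally show "S ! (l * n + j) = ev (gs j (xs ! l # ys))" using that by (simp add: rec_row_def)
  qed
  have "map ((!) S) (map (\<lambda>l. a * n + l) [0..<a]) = map ev xs"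
    using xs len by (intro nth_equalityI) (auto simp: S_def nth_append)
  moreover have "map ((!) S) (concat (map (\<lambda>j. map (\<lambda>l. l * n + j) [0..<a]) [0..<n])) =
      map ev (rec_values n gs xs ys)"
  proof -
    have "map ((!) S \<circ> (\<lambda>l. l * n + j)) [0..<a] = map (\<lambda>x. ev (gs j (x # ys))) xs" if "j < n" for j
      using xs row(1)[OF _ that] by (intro nth_equalityI) auto
    then have e: "map (\<lambda>j. map ((!) S \<circ> (\<lambda>l. l * n + j)) [0..<a]) [0..<n] =
        map (\<lambda>j. map (\<lambda>x. ev (gs j (x # ys))) xs) [0..<n]"
      by (intro map_cong[OF refl]) simp
    show ?thesis unfolding map_concat map_map o_def by (simp only: map_map e[unfolded o_def] o_def)
  qed
  moreover have "map ((!) S) (map (\<lambda>q. a * n + a + 4 + q) [0..<m]) = map ev ys"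
    using xs ys len by (intro nth_equalityI) (auto simp: S_def nth_append nth_Cons')
  ultimately show "map ((!) S) (arg_offsets n a m) = map ev (xs @ rec_values n gs xs ys @ ys)"
    by (simp only: arg_offsets_def map_append)
  show "\<forall>i \<in> set (arg_offsets n a m). i < length S"
    using row(2) xs ys len by (fastforce simp: arg_offsets_def S_def)
qed

lemma run_rec_step:
  assumes xs: "length xs = a" "set xs \<subseteq> set Xs" and ys: "length ys = m"
    and r: "\<And>t. r t = lst (rev (rec_row n gs ys t))"
    and P: "\<And>j V. j < n \<Longrightarrow> run (P j) (map ev (xs @ rec_values n gs xs ys @ ys) @ V)
        (ev (gs j (Con i xs # ys)) # V) B"
    and N: "length Xs \<le> N"
  shows "run (rec_step n m P a) (ev (Con i xs) # w # AL r Xs # z # map ev ys @ V)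
    (r (Con i xs) # ev (Con i xs) # w # AL r Xs # z # map ev ys @ V) (rec_step_cost n m a N B)"
proof -
  let ?t = "Con i xs"
  let ?B0 = "ev ?t # w # AL r Xs # z # map ev ys @ V"
  let ?os = "arg_offsets n a m"
  define S where "S = (\<lambda>c. concat (map (\<lambda>l. rec_row n gs ys (xs ! l)) [a - c..<a]) @ map ev xs @ ?B0)"
  have 1: "run (blk [OPick 0]) ?B0 (ev ?t # ?B0) 1"
    by (rule run_blk_le) simp_all
  have 2: "run (decon a) (ev ?t # ?B0) (S 0) (6 * a + 3)"
    using run_decon[OF xs(1)] by (simp add: S_def)
  have 3: "run (rep (gather n a) a) (S 0) (S a) (\<Sum>c<a. 18 * N + 2 * (a * n + a) + 6 * n + 20)"
  proof (rule run_rep)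
    fix c assume "c < a"
    from run_gather[where gs = gs and ys = ys and r = r, OF xs this r, of "ev ?t" w "z # map ev ys @ V"]
    show "run (gather n a c) (S c) (S (Suc c)) (18 * N + 2 * (a * n + a) + 6 * n + 20)"
      unfolding S_def by (rule run_mono) (use N in simp)
  qed
  \<comment> \<open>The results of the last \<open>c\<close> components, above the gathered values,
    which serve all components.\<close>
  define R where "R = (\<lambda>c. map (\<lambda>j. ev (gs j (?t # ys))) [n - c..<n] @ S a)"
  have Sa: "S a = concat (map (\<lambda>l. rec_row n gs ys (xs ! l)) [0..<a]) @ map ev xs @ ?B0"
    by (simp add: S_def)
  note os = arg_offsets_nth[OF xs(1) ys, of n gs "ev ?t" w "AL r Xs" z V, folded Sa]
  have 4: "run (rep (\<lambda>c. picks (map ((+) c) ?os) ;; P (n - Suc c)) n) (R 0) (R n)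
     (\<Sum>c<n. picks_cost (map ((+) c) ?os) + B)"
  proof (rule run_rep)
    fix c assume c: "c < n"
    have "length (map (\<lambda>j. ev (gs j (?t # ys))) [n - c..<n]) = c" using c by simp
    then have "map ((!) (R c)) (map ((+) c) ?os) = map ((!) (S a)) ?os"
      and "\<forall>i \<in> set (map ((+) c) ?os). i < length (R c)"
      using os(2) by (auto simp: R_def nth_append)
    with run_picks[of "map ((+) c) ?os" "R c"]
    have 1: "run (picks (map ((+) c) ?os)) (R c) (map ev (xs @ rec_values n gs xs ys @ ys) @ R c)
        (picks_cost (map ((+) c) ?os))"
      using os(1) by metis
    have "[n - Suc c..<n] = (n - Suc c) # [n - c..<n]"
      using c by (simp add: upt_conv_Cons Suc_diff_Suc)
    then have "R (Suc c) = ev (gs (n - Suc c) (?t # ys)) # R c" by (simp add: R_def)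
    with P[of "n - Suc c" "R c"] c have 2: "run (P (n - Suc c))
       (map ev (xs @ rec_values n gs xs ys @ ys) @ R c) (R (Suc c)) B" by simp
    from run_seq[OF 1 2] show "run (picks (map ((+) c) ?os) ;; P (n - Suc c)) (R c) (R (Suc c))
      (picks_cost (map ((+) c) ?os) + B)" .
  qed
  have 5: "run (blk [OAtom 0]) (R n) (lst [] # rec_row n gs ys ?t @ S a) 1"
    by (rule run_blk_le) (simp_all add: R_def rec_row_def atoms_def)
  have 6: "run (mklist n) (lst [] # rec_row n gs ys ?t @ S a) (r ?t # S a) (5 * n)"
    using run_mklist[of "rec_row n gs ys ?t" n "[]" "S a"] by (simp add: r)
  have "length (concat (map (\<lambda>l. rec_row n gs ys (xs ! l)) [0..<a]) @ map ev xs) = a * n + a"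
    using length_concat_uniform[of a "\<lambda>l. rec_row n gs ys (xs ! l)" n] xs(1) by simp
  from run_nip[OF this, of "r ?t" ?B0]
  have 7: "run (nip (a * n + a)) (r ?t # S a) (r ?t # ?B0) (2 * (a * n + a))" by (simp add: Sa)
  have "R 0 = S a" by (simp add: R_def)
  note 3 = 3[folded this]
  show ?thesis unfolding rec_step_def rec_step_cost_def
    by (rule run_mono[OF run_seq[OF 1 run_seq[OF 2 run_seq[OF 3 run_seq[OF 4 run_seq[OF 5 run_seq[OF 6 7]]]]]]]) simp
qed

lemma dfs_cost_mono: "N \<le> N' \<Longrightarrow> n \<le> n' \<Longrightarrow> dfs_cost N n \<le> dfs_cost N' n'"
  unfolding dfs_cost_def dfs_step_cost_def by (intro add_mono mult_le_mono) auto

text \<open>One search over the distinct subterms of the recursion argument computes all rows. At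
  each subterm every component is evaluated once, on arguments that have polynomially many distinct
  subterms by the hypothesis on \<open>gs\<close>, so this costs polynomially many
  operations.\<close>

lemma computable_simrec:
  assumes fs: "\<And>i j. i < length ars \<Longrightarrow> j < n \<Longrightarrow> computable (fs i j) (ars ! i + n * ars ! i + m)"
    and size: "\<And>j. j < n \<Longrightarrow> \<exists>d. \<forall>vs \<in> tuples ars (Suc m). gs j vs \<in> terms ars \<and>
       card (subs (gs j vs)) \<le> (dag_size vs + 2) ^ d"
    and g: "is_simrec ars n m fs gs" and j: "j < n"
  shows "computable (gs j) (Suc m)"
proof -
  have "\<forall>i j. \<exists>c e. i < length ars \<longrightarrow> j < n \<longrightarrow> (\<forall>vs \<in> tuples ars (ars ! i + n * ars ! i + m). \<forall>V.
     run c (map ev vs @ V) (ev (fs i j vs) # V) ((dag_size vs + 2) ^ e))"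
    using fs unfolding computable_def by blast
  then obtain P e where Pe: "\<And>i j vs V. i < length ars \<Longrightarrow> j < n \<Longrightarrow>
      vs \<in> tuples ars (ars ! i + n * ars ! i + m) \<Longrightarrow>
      run (P i j) (map ev vs @ V) (ev (fs i j vs) # V) ((dag_size vs + 2) ^ e i j)" by metis
  have "\<forall>j. \<exists>d. j < n \<longrightarrow> (\<forall>vs \<in> tuples ars (Suc m). gs j vs \<in> terms ars \<and>
       card (subs (gs j vs)) \<le> (dag_size vs + 2) ^ d)"
    using size by blast
  then obtain d where d: "\<And>j vs. j < n \<Longrightarrow> vs \<in> tuples ars (Suc m) \<Longrightarrow> gs j vs \<in> terms ars"
    "\<And>j vs. j < n \<Longrightarrow> vs \<in> tuples ars (Suc m) \<Longrightarrow> card (subs (gs j vs)) \<le> (dag_size vs + 2) ^ d j"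
    by metis
  define D where "D = (\<Sum>j<n. d j)"
  define E where "E = (\<Sum>i<length ars. \<Sum>j<n. e i j)"
  have eE: "e i j \<le> E" if "i < length ars" "j < n" for i j
  proof -
    have "e i j \<le> (\<Sum>j<n. e i j)" using that by (intro member_le_sum) auto
    also have "\<dots> \<le> E" unfolding E_def using that by (intro member_le_sum) auto
    finally show ?thesis .
  qed
  \<comment> \<open>The node's arguments and the parameters contribute at most \<open>N\<close>
    nodes; there are at most \<open>n * sum_list ars\<close> recursive results, each with at most
    \<open>(N + 2) ^ D\<close> nodes.\<close>
  define B where "B = (\<lambda>N. (N + n * (sum_list ars * (N + 2) ^ D) + 2) ^ E)"
  define nf where "nf = (\<lambda>N. (\<Sum>i<length ars. rec_step_cost n m (ars ! i) N (B N)) + 8 * length ars)"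
  define fin where "fin = switch (\<lambda>i. rec_step n m (P i) (ars ! i)) [0..<length ars]"
  define T where "T = (\<lambda>N. 1 + dfs_cost N (nf N) + 6 + (18 * N + 2) + 6 * n + (j + 2) + 2 * (n + 4 + m))"
  \<comment> \<open>After \<open>unlist n\<close> the empty list \<open>Atom 0\<close> lies above
    the row, hence the index \<open>j + 1\<close>. Under the copied result lie that atom, the row,
    two copies of the recursion argument with the table between them, and the parameters:
    \<open>n + 4 + m\<close> values.\<close>
  define M where "M = blk [OPick 0] ;; dfs fin ;; blk [OPick 1, OAtom 0, OPick 2] ;; assoc ;; unlist n ;;
    blk [OPick (j + 1)] ;; nip (n + 4 + m)"
  show ?thesis
  proof (rule computableI)
    show "pb T"
      unfolding T_def nf_def B_def dfs_cost_def dfs_step_cost_def rec_step_cost_def by (intro pb_intros)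
    fix vs V assume "vs \<in> tuples ars (Suc m)"
    then obtain v ys where vs: "vs = v # ys" "v \<in> terms ars" "ys \<in> tuples ars m"
      by (auto elim: tuples_Suc_cases)
    have ly: "length ys = m" using vs(3) by (simp add: tuples_def)
    let ?N = "dag_size vs"
    define r where "r = (\<lambda>t. lst (rev (rec_row n gs ys t)))"
    let ?E = "ev v # map ev ys @ V"
    have sv: "card (subs v) \<le> ?N" unfolding dag_size_def vs(1) by (intro card_mono) auto
    \<comment> \<open>As \<open>j < n\<close>, rows are nonempty lists, so a memo entry cannot be
      taken for a missing key.\<close>
    have r0: "r t \<noteq> Atom 0" for t using j by (simp add: r_def rec_row_def)
    have gt: "gs l (t # ys) \<in> terms ars" if "t \<in> terms ars" "l < n" for t l
      using d(1)[OF that(2)] that(1) vs(3) by (simp add: tuples_Cons)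
    have fin: "run fin (ev (Con i xs) # lst W # AL r Xs # ?E) (r (Con i xs) # ev (Con i xs) # lst W # AL r Xs # ?E) (nf ?N)"
      if t: "Con i xs \<in> subs v" and xs: "set xs \<subseteq> set Xs" "set Xs \<subseteq> subs v" "distinct Xs" for i xs Xs W
    proof -
      have "Con i xs \<in> terms ars" using subs_terms[OF vs(2)] t by blast
      then have i: "i < length ars" "xs \<in> tuples ars (ars ! i)" by (simp_all add: Con_in_terms)
      then have lx: "length xs = ars ! i" by (simp add: tuples_def)
      have "length Xs \<le> card (subs v)" using xs(2,3) by (metis card_mono distinct_card finite_subs)
      then have lX: "length Xs \<le> ?N" using sv by simp
      let ?args = "xs @ rec_values n gs xs ys @ ys"
      have xt: "set xs \<subseteq> terms ars" using i(2) by (simp add: tuples_def)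
      have "rec_values n gs xs ys \<in> tuples ars (n * ars ! i)"
        using lx xt gt by (auto simp: tuples_def length_rec_values)
      from tuples_append[OF i(2) tuples_append[OF this vs(3)]]
      have args: "?args \<in> tuples ars (ars ! i + n * ars ! i + m)" by (simp add: add.assoc)
      have xsv: "subs x \<subseteq> subs v" if "x \<in> set xs" for x
        using that subs_trans[OF t] by auto
      have "dag_size ?args \<le> ?N + n * (sum_list ars * (?N + 2) ^ D)"
      proof -
        have "all_subs ?args \<subseteq> all_subs vs \<union> (\<Union>l<n. \<Union>x\<in>set xs. subs (gs l (x # ys)))"
          using xsv unfolding all_subs_simps all_subs_rec_values vs(1) by (auto simp: all_subs_def)
        then have "dag_size ?args \<le> card (all_subs vs \<union> (\<Union>l<n. \<Union>x\<in>set xs. subs (gs l (x # ys))))"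
          unfolding dag_size_def by (intro card_mono) auto
        also have "\<dots> \<le> ?N + card (\<Union>l<n. \<Union>x\<in>set xs. subs (gs l (x # ys)))"
          unfolding dag_size_def by (rule card_Un_le)
        also have "card (\<Union>l<n. \<Union>x\<in>set xs. subs (gs l (x # ys))) \<le> (\<Sum>l<n. card (\<Union>x\<in>set xs. subs (gs l (x # ys))))"
          by (rule card_UN_le) simp
        also have "\<dots> \<le> (\<Sum>l<n. sum_list ars * (?N + 2) ^ D)"
        proof (rule sum_mono)
          fix l assume l: "l \<in> {..<n}"
          have "card (\<Union>x\<in>set xs. subs (gs l (x # ys))) \<le> (\<Sum>x\<in>set xs. card (subs (gs l (x # ys))))"
            by (rule card_UN_le) simp
          also have "\<dots> \<le> (\<Sum>x\<in>set xs. (?N + 2) ^ D)"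
          proof (rule sum_mono)
            fix x assume x: "x \<in> set xs"
            have "x # ys \<in> tuples ars (Suc m)" using x xt vs(3) by (auto simp: tuples_Cons)
            then have "card (subs (gs l (x # ys))) \<le> (dag_size (x # ys) + 2) ^ d l" using d(2) l by simp
            also have "(dag_size (x # ys) + 2) ^ d l \<le> (?N + 2) ^ d l"
            proof (rule power_mono)
              have "dag_size (x # ys) \<le> ?N" unfolding vs(1) using xsv[OF x] by (intro dag_size_mono) auto
              then show "dag_size (x # ys) + 2 \<le> ?N + 2" by simp
            qed simp
            also have "\<dots> \<le> (?N + 2) ^ D" unfolding D_def using l by (intro power_le_sum_exponent) auto
            finally show "card (subs (gs l (x # ys))) \<le> (?N + 2) ^ D" .
          qed
          also have "\<dots> = card (set xs) * (?N + 2) ^ D" by simp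
          also have "\<dots> \<le> sum_list ars * (?N + 2) ^ D"
            using card_length[of xs] nth_le_sum_list[OF i(1)] lx by (intro mult_le_mono1) simp
          finally show "card (\<Union>x\<in>set xs. subs (gs l (x # ys))) \<le> sum_list ars * (?N + 2) ^ D" .
        qed
        finally show ?thesis by simp
      qed
      then have szB: "(dag_size ?args + 2) ^ e i l \<le> B ?N" if "l < n" for l
        unfolding B_def using eE[OF i(1) that] by (intro order_trans[OF power_mono power_increasing]) auto
      have "run (P i l) (map ev ?args @ V') (ev (gs l (Con i xs # ys)) # V') (B ?N)" if "l < n" for l V'
        using run_mono[OF Pe[OF i(1) that args] szB[OF that]] g i vs(3) that by (simp add: is_simrec_def)
      from run_rec_step[where gs = gs and r = r, OF lx xs(1) ly r_def[THEN fun_cong, simplified] this lX]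
      have step: "run (rec_step n m (P i) (ars ! i)) (ev (Con i xs) # lst W # AL r Xs # ?E)
        (r (Con i xs) # ev (Con i xs) # lst W # AL r Xs # ?E) (rec_step_cost n m (ars ! i) ?N (B ?N))"
        by simp
      have "run fin (ev (Con i xs) # lst W # AL r Xs # ?E) (r (Con i xs) # ev (Con i xs) # lst W # AL r Xs # ?E)
        (rec_step_cost n m (ars ! i) ?N (B ?N) + 8 * length [0..<length ars])"
        unfolding fin_def ev.simps using step i(1) unfolding ev.simps by (intro run_switch) auto
      then show ?thesis
      proof (rule run_mono)
        have "rec_step_cost n m (ars ! i) ?N (B ?N) \<le> (\<Sum>i<length ars. rec_step_cost n m (ars ! i) ?N (B ?N))"
          using i(1) by (intro member_le_sum) auto
        then show "rec_step_cost n m (ars ! i) ?N (B ?N) + 8 * length [0..<length ars] \<le> nf ?N"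
          by (simp add: nf_def)
      qed
    qed
    have 1: "run (blk [OPick 0]) ?E (ev v # ?E) 1" by (rule run_blk_le) simp_all
    have 2: "run (dfs fin) (ev v # ?E) (AL r (visit v []) # ?E) (dfs_cost ?N (nf ?N))"
      by (rule run_mono[OF run_dfs[OF vs(2) r0 fin] dfs_cost_mono[OF sv order_refl]])
    let ?M = "AL r (visit v [])"
    have 3: "run (blk [OPick 1, OAtom 0, OPick 2]) (?M # ?E) (?M # Atom 0 # ev v # ?M # ?E) 6"
      by (rule run_blk_le) (simp_all add: atoms_def numeral_2_eq_2)
    have vp: "set (visit v []) = subs v" "distinct (visit v [])"
      using visit_props[of "[]" v] by (simp_all add: sub_closed_def)
    then have lv: "length (visit v []) \<le> ?N" using sv by (metis distinct_card)
    have 4: "run assoc (?M # Atom 0 # ev v # ?M # ?E) (r v # ev v # ?M # ?E) (18 * ?N + 2)"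
      using run_mono[OF run_assoc[of "map (\<lambda>t. (ev t, r t)) (visit v [])" "ev v"]] lv
      by (simp add: found_AL AL_def vp)
    have 5: "run (unlist n) (r v # ev v # ?M # ?E) (Atom 0 # rec_row n gs ys v @ ev v # ?M # ?E) (6 * n)"
      unfolding r_def by (rule run_unlist) simp
    have 6: "run (blk [OPick (j + 1)]) (Atom 0 # rec_row n gs ys v @ ev v # ?M # ?E)
       (ev (gs j vs) # (Atom 0 # rec_row n gs ys v @ ev v # ?M # ev v # map ev ys) @ V) (j + 2)"
      by (rule run_blk_le) (use j in \<open>simp_all add: nth_append rec_row_def vs(1)\<close>)
    have 7: "run (nip (n + 4 + m)) (ev (gs j vs) # (Atom 0 # rec_row n gs ys v @ ev v # ?M # ev v # map ev ys) @ V)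
       (ev (gs j vs) # V) (2 * (n + 4 + m))"
      by (rule run_nip) (simp add: ly)
    have "run M ?E (ev (gs j vs) # V) (T ?N)" unfolding M_def T_def
      by (rule run_mono[OF run_seq[OF 1 run_seq[OF 2 run_seq[OF 3 run_seq[OF 4 run_seq[OF 5 run_seq[OF 6 7]]]]]]]) simp
    then show "run M (map ev vs @ V) (ev (gs j vs) # V) (T ?N)" by (simp add: vs(1))
  qed
qed

theorem computable_tiered: "tiered ars f ps m \<Longrightarrow> computable f (length ps)"
proof (induction rule: tiered.induct)
  case (constr i h n)
  then show ?case using computable_constr by simp
next
  case (proj n ps h)
  then show ?case using computable_proj by blast
next
  case (casedist fs p qs m h)
  then show ?case using computable_case[of fs "length qs" h] by simp
next
  case (comp f ps m gs qs h)
  show ?case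
  proof (rule computable_comp)
    show "\<exists>d. \<forall>vs \<in> tuples ars (length qs). (gs ! i) vs \<in> terms ars \<and>
       card (subs ((gs ! i) vs)) \<le> (dag_size vs + 2) ^ d" if "i < length gs" for i
      using tiered_dag_size comp that by metis
  qed (use comp in auto)
next
  case (simrec n fs p m qs gs j)
  have "computable (gs j) (Suc (length qs))"
  proof (rule computable_simrec)
    \<comment> \<open>Every component of the recursion is tiered, not only the one in question, so
      all recursive results are bounded.\<close>
    show "\<exists>d. \<forall>vs \<in> tuples ars (Suc (length qs)). gs j vs \<in> terms ars \<and>
       card (subs (gs j vs)) \<le> (dag_size vs + 2) ^ d" if "j < n" for j
      using tiered_dag_size[OF tiered.simrec[OF simrec.hyps(1-3) that]] by simp
  qed (use simrec in \<open>auto simp: add.assoc\<close>)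
  then show ?case by simp
qed

end

section \<open>Input and output\<close>


fun writes :: "prog \<Rightarrow> nat set" where
  "writes Skip = {}"
| "writes (Push i a) = {i}"
| "writes (Pop i) = {i}"
| "writes (Emit a) = {0}"
| "writes (c ;; d) = writes c \<union> writes d"
| "writes (Cond i A c d) = writes c \<union> writes d"
| "writes (Loop i A c) = writes c"

lemma exec_frame: "exec c s t s' \<Longrightarrow> i \<notin> writes c \<Longrightarrow> s' i = s i"
  by (induction rule: exec.induct) auto

lemma writes_push_num: "writes (push_num i n) \<subseteq> {i}"
  by (induction n) auto

lemma writes_mvs: "writes (mvs n i j) \<subseteq> {i, j}"
  by (induction n) (auto simp: mv_def mvl_def)

lemma writes_op: "x \<noteq> OCons \<Longrightarrow> CT \<notin> writes (op_prog x)"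
  using writes_push_num[of VS] writes_mvs[of _ VS AS] writes_mvs[of _ AS VS]
  by (cases x) (fastforce simp: pick_prog_def del_prog_def uncons_prog_def eq_prog_def find_name_def
      scan_def restore_def cp_def mv_def mvl_def clr_def eqacc_def)+

lemma writes_blk: "OCons \<notin> set xs \<Longrightarrow> CT \<notin> writes (blk xs)"
  by (induction xs) (auto simp: writes_op simp del: op_prog.simps)

lemma writes_rep: "(\<And>c. i \<notin> writes (p c)) \<Longrightarrow> i \<notin> writes (rep p n)"
  by (induction n) auto

lemma writes_decon: "CT \<notin> writes (decon a)"
  using writes_blk[of "[OUncons, ODel 0]"] writes_blk[of "[ODel 0]"]
    writes_rep[OF writes_blk[of "[OUncons, OPick 1, ODel 2]"]]
  by (simp add: decon_def unlist_def del: blk.simps)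

lemma length_num: "length (num n) = n + 1"
  by (simp add: num_def)

context signature
begin

text \<open>\<open>CT\<close> shows the heap size in unary, so a program that does not write it
  cannot have extended the heap. Printing can thus be described on one fixed heap.\<close>

lemma run_pure:
  assumes "run c V V' n" "CT \<notin> writes c" "heap_ok H" "all_known H V"
  shows "all_known H V' \<and> runs c (st V H I out) (st V' H I out) (n * Q (length H + n))"
proof -
  obtain H' where 1: "heap_ext H H'" "all_known H' V'"
    "runs c (st V H I out) (st V' H' I out) (n * Q (length H + n))"
    using assms unfolding run_def by blast
  then obtain t where "exec c (st V H I out) t (st V' H' I out)" by (auto simp: runs_def)
  from exec_frame[OF this assms(2)] have "length (num (atoms + length H')) = length (num (atoms + length H))"
    by simp
  then have "length H' = length H" by (simp add: length_num)
  then have "H' = H" using 1(1) by (auto simp: heap_ext_def)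
  then show ?thesis using 1 by simp
qed

text \<open>Unlike \<open>run\<close>, this lets the output change; in return the heap is fixed and
  the input used up.\<close>

definition outp :: "val list \<Rightarrow> prog \<Rightarrow> val list \<Rightarrow> nat list \<Rightarrow> val list \<Rightarrow> nat list \<Rightarrow> nat \<Rightarrow> bool" where
  "outp H c V out V' out' T \<longleftrightarrow> (all_known H V \<longrightarrow> all_known H V' \<and>
     runs c (st V H [] out) (st V' H [] out') T)"

lemma outp_mono: "outp H c V out V' out' T \<Longrightarrow> T \<le> T' \<Longrightarrow> outp H c V out V' out' T'"
  unfolding outp_def using runs_le by blast

lemma outp_run: "run c V V' n \<Longrightarrow> CT \<notin> writes c \<Longrightarrow> heap_ok H \<Longrightarrow> outp H c V out V' out (n * Q (length H + n))"
  unfolding outp_def using run_pure by blast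

lemma outp_blk:
  assumes "exops xs V = Some V'" "OCons \<notin> set xs" "heap_ok H" "sum_list (map op_cost xs) \<le> n"
  shows "outp H (blk xs) V out V' out (n * Q (length H + n))"
  by (rule outp_run[OF run_blk_le writes_blk]) (use assms in auto)

lemma outp_seq: "outp H c V o1 V1 o2 T1 \<Longrightarrow> outp H d V1 o2 V2 o3 T2 \<Longrightarrow> outp H (c ;; d) V o1 V2 o3 (T1 + T2)"
  unfolding outp_def using runs_seq by blast

lemma outp_skip: "outp H Skip V out V out 0"
  unfolding outp_def using runs_skip by blast

lemma outp_rep:
  "(\<And>c. c < k \<Longrightarrow> outp H (p c) (S c) (w c) (S (Suc c)) (w (Suc c)) T) \<Longrightarrow>
     outp H (rep p k) (S 0) (w 0) (S k) (w k) (k * T)"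
proof (induction k)
  case 0
  then show ?case by (simp add: outp_skip)
next
  case (Suc k)
  then have "outp H (rep p k) (S 0) (w 0) (S k) (w k) (k * T)" by simp
  from outp_seq[OF this Suc.prems[of k]] show ?case by (simp add: add.commute)
qed

lemma outp_ifnil:
  assumes "outp H (if v = Atom 0 then c else d) (v # V) out V' out' T"
  shows "outp H (ifnil c d) (v # V) out V' out' (T + 2)"
  unfolding outp_def
proof
  assume k: "all_known H (v # V)"
  have "(if peek (st (v # V) H [] out VS) \<in> {3} then c else d) = (if v = Atom 0 then c else d)"
    using peek_VS[OF k] by simp
  then show "all_known H V' \<and> runs (ifnil c d) (st (v # V) H [] out) (st V' H [] out') (T + 2)"
    using assms k unfolding outp_def ifnil_def by (intro conjI runs_cond) simp_all
qed

lemma outp_while_end: "outp H (while_nonnil c) (Atom 0 # V) out (Atom 0 # V) out 1"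
  unfolding outp_def while_nonnil_def
proof
  assume k: "all_known H (Atom 0 # V)"
  have "runs (Loop VS {1} c) (st (Atom 0 # V) H [] out) (st (Atom 0 # V) H [] out) 1"
    by (rule runs_loopF) (use peek_VS[OF k] in simp_all)
  with k show "all_known H (Atom 0 # V) \<and>
    runs (Loop VS {1} c) (st (Atom 0 # V) H [] out) (st (Atom 0 # V) H [] out) 1" by blast
qed

lemma outp_while_step:
  assumes "v \<noteq> Atom 0" "outp H c (v # V) o1 V1 o2 T1" "outp H (while_nonnil c) V1 o2 V2 o3 T2"
  shows "outp H (while_nonnil c) (v # V) o1 V2 o3 (T1 + T2 + 2)"
  unfolding outp_def
proof
  assume k: "all_known H (v # V)"
  with assms have 1: "runs c (st (v # V) H [] o1) (st V1 H [] o2) T1"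
    "runs (Loop VS {1} c) (st V1 H [] o2) (st V2 H [] o3) T2" "all_known H V2"
    by (auto simp: outp_def while_nonnil_def)
  have "runs (Loop VS {1} c) (st (v # V) H [] o1) (st V2 H [] o3) (T1 + T2 + 2)"
    by (rule runs_loopT[OF _ _ 1(1,2)]) (use peek_VS[OF k] assms(1) in simp_all)
  with 1(3) show "all_known H V2 \<and> runs (while_nonnil c) (st (v # V) H [] o1) (st V2 H [] o3) (T1 + T2 + 2)"
    by (simp add: while_nonnil_def)
qed

lemma outp_emit: "outp H (Emit a) V out V (out @ [a]) 1"
proof -
  have "(st V H [] out)(0 := out @ [a]) = st V H [] (out @ [a])"
    by (simp add: st_def fun_eq_iff)
  then show ?thesis using runs_emit[of a "st V H [] out"] by (simp add: outp_def)
qed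

text \<open>The address in unary; the symbol 1 is the code of the bit \<open>False\<close>, so this
  is a legitimate node name.\<close>

definition name :: "val list \<Rightarrow> trm \<Rightarrow> nat list" where
  "name H t = replicate (addr H (ev t)) 1"

lemma outp_name: "outp H (emit_num VS) (ev t # V) out V (out @ name H t) (Q (length H))"
  unfolding outp_def
proof
  assume k: "all_known H (ev t # V)"
  have "(st (ev t # V) H [] out)(VS := nums (map (addr H) V), 0 := out @ name H t) = st V H [] (out @ name H t)"
    by (simp add: st_def fun_eq_iff)
  then have "runs (emit_num VS) (st (ev t # V) H [] out) (st V H [] (out @ name H t)) (4 * addr H (ev t) + 2)"
    using runs_emit_num[of VS "st (ev t # V) H [] out" "addr H (ev t)" "nums (map (addr H) V)"]
    by (simp add: name_def)
  moreover have "4 * addr H (ev t) + 2 \<le> Q (length H)"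
    using addr_less[of H "ev t"] k Q_ge[of "length H"] by (simp add: all_known_def)
  ultimately show "all_known H V \<and> runs (emit_num VS) (st (ev t # V) H [] out) (st V H [] (out @ name H t)) (Q (length H))"
    using k runs_le by (auto simp: all_known_def)
qed

lemma outp_switch:
  assumes "i \<in> set is" "\<forall>j \<in> set is. j < length ars" "heap_ok H"
    "outp H (c i) (Cell (Atom (i + 2)) r # V) out V' out' T"
  shows "outp H (switch c is) (Cell (Atom (i + 2)) r # V) out V' out' (T + length is * (10 * Q (length H + 10)))"
  using assms(1,2)
proof (induction "is")
  case (Cons j "is")
  let ?x = "Cell (Atom (i + 2)) r"
  let ?q = "Q (length H + 10)"
  have 1: "outp H (blk [OPick 0, OUncons, ODel 1, OAtom (j + 2), OEq]) (?x # V) out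
     ((if j = i then Atom 0 else Atom 1) # ?x # V) out (6 * Q (length H + 6))"
    by (rule outp_blk) (use Cons.prems assms(3) in \<open>simp_all add: atoms_def\<close>)
  have d: "outp H (blk [ODel 0]) (w # ?x # V) out (?x # V) out (1 * Q (length H + 1))" for w
    by (rule outp_blk) (use assms(3) in simp_all)
  let ?T = "1 * Q (length H + 1) + (T + length is * (10 * ?q))"
  have 2: "outp H (ifnil (blk [ODel 0] ;; c j) (blk [ODel 0] ;; switch c is))
      ((if j = i then Atom 0 else Atom 1) # ?x # V) out V' out' (?T + 2)"
  proof (rule outp_ifnil)
    show "outp H (if (if j = i then Atom 0 else Atom 1) = Atom 0 then blk [ODel 0] ;; c j
        else blk [ODel 0] ;; switch c is)
       ((if j = i then Atom 0 else Atom 1) # ?x # V) out V' out' ?T"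
    proof (cases "j = i")
      case True
      have "outp H (c i) (?x # V) out V' out' (T + length is * (10 * ?q))"
        using assms(4) by (rule outp_mono) simp
      from outp_seq[OF d[of "Atom 0"] this] show ?thesis using True by (simp del: blk.simps)
    next
      case False
      then have "outp H (switch c is) (?x # V) out V' out' (T + length is * (10 * ?q))" using Cons by simp
      from outp_seq[OF d[of "Atom 1"] this] show ?thesis using False by (simp del: blk.simps)
    qed
  qed
  have "Q (length H + 6) \<le> ?q" "Q (length H + 1) \<le> ?q" "2 \<le> ?q"
    by (auto intro: Q_mono Q_ge_2)
  then show ?case unfolding switch.simps by (intro outp_mono[OF outp_seq[OF 1 2]]) simp
qed simp

definition children_prog :: "nat \<Rightarrow> prog" where
  "children_prog i = Emit (4 + i) ;; decon (ars ! i) ;; rep (\<lambda>_. emit_num VS ;; Emit 3) (ars ! i)"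

definition node_prog :: prog where
  "node_prog = blk [OUncons, OUncons, ODel 1, OPick 0] ;; emit_num VS ;; switch children_prog [0..<length ars]"

fun node_string :: "val list \<Rightarrow> trm \<Rightarrow> nat list" where
  "node_string H (Con i ts) = name H (Con i ts) @ [4 + i] @ concat (map (\<lambda>u. name H u @ [3]) ts)"

lemma outp_children:
  assumes "heap_ok H" "length ts = ars ! i"
  shows "outp H (children_prog i) (ev (Con i ts) # V) out V (out @ [4 + i] @ concat (map (\<lambda>u. name H u @ [3]) ts))
    (1 + (6 * ars ! i + 3) * Q (length H + (6 * ars ! i + 3)) + ars ! i * (Q (length H) + 1))"
proof -
  let ?a = "ars ! i"
  have 1: "outp H (decon ?a) (ev (Con i ts) # V) (out @ [4 + i]) (map ev ts @ V) (out @ [4 + i])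
     ((6 * ?a + 3) * Q (length H + (6 * ?a + 3)))"
    by (rule outp_run[OF run_decon[OF assms(2)] writes_decon assms(1)])
  define S where "S = (\<lambda>c. map ev (drop c ts) @ V)"
  define w where "w = (\<lambda>c. (out @ [4 + i]) @ concat (map (\<lambda>u. name H u @ [3]) (take c ts)))"
  have 2: "outp H (rep (\<lambda>_. emit_num VS ;; Emit 3) ?a) (S 0) (w 0) (S ?a) (w ?a) (?a * (Q (length H) + 1))"
  proof (rule outp_rep)
    fix c assume "c < ?a"
    then have c: "drop c ts = ts ! c # drop (Suc c) ts" "take (Suc c) ts = take c ts @ [ts ! c]"
      using assms(2) by (simp_all add: Cons_nth_drop_Suc take_Suc_conv_app_nth)
    have "w (Suc c) = (w c @ name H (ts ! c)) @ [3]" "S c = ev (ts ! c) # S (Suc c)"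
      by (simp_all add: w_def S_def c)
    then show "outp H (emit_num VS ;; Emit 3) (S c) (w c) (S (Suc c)) (w (Suc c)) (Q (length H) + 1)"
      using outp_seq[OF outp_name outp_emit] by metis
  qed
  have S: "S 0 = map ev ts @ V" "S ?a = V" using assms(2) by (simp_all add: S_def)
  have w: "w 0 = out @ [4 + i]" "w ?a = out @ [4 + i] @ concat (map (\<lambda>u. name H u @ [3]) ts)"
    using assms(2) by (simp_all add: w_def)
  show ?thesis unfolding children_prog_def
    by (rule outp_mono[OF outp_seq[OF outp_emit outp_seq[OF 1 2[unfolded S w]]]]) simp
qed

definition node_cost :: nat where
  "node_cost = 20 + 10 * length ars + 10 * sum_list ars"

lemma outp_node:
  assumes "heap_ok H" "t \<in> terms ars"
  shows "outp H node_prog (AL (\<lambda>_. Atom 1) (t # Xs) # V) out (AL (\<lambda>_. Atom 1) Xs # V) (out @ node_string H t)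
    (node_cost * Q (length H + node_cost))"
proof -
  obtain i ts where t: "t = Con i ts" by (cases t)
  then have i: "i < length ars" "length ts = ars ! i" using assms(2) by (auto elim: terms.cases)
  let ?q = "Q (length H + node_cost)"
  let ?M = "AL (\<lambda>_. Atom 1) Xs"
  let ?T = "1 + (6 * ars ! i + 3) * Q (length H + (6 * ars ! i + 3)) + ars ! i * (Q (length H) + 1)"
  have 1: "outp H (blk [OUncons, OUncons, ODel 1, OPick 0]) (AL (\<lambda>_. Atom 1) (t # Xs) # V) out
     (ev t # ev t # ?M # V) out (5 * Q (length H + 5))"
    by (rule outp_blk) (use assms(1) in \<open>simp_all add: AL_Cons\<close>)
  have 2: "outp H (switch children_prog [0..<length ars]) (ev t # ?M # V) (out @ name H t) (?M # V)
     ((out @ name H t) @ [4 + i] @ concat (map (\<lambda>u. name H u @ [3]) ts))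
     (?T + length [0..<length ars] * (10 * Q (length H + 10)))"
    unfolding t ev.simps
    by (rule outp_switch) (use outp_children[OF assms(1) i(2), of "?M # V" "out @ name H t", unfolded t ev.simps] i(1) assms(1) in auto)
  have a: "ars ! i \<le> sum_list ars" using nth_le_sum_list i by simp
  have q: "Q (length H + 5) \<le> ?q" "Q (length H) \<le> ?q" "Q (length H + 10) \<le> ?q"
     "Q (length H + (6 * ars ! i + 3)) \<le> ?q" "1 \<le> ?q"
    using a Q_ge_2[of "length H + node_cost"] by (auto simp: node_cost_def intro!: Q_mono)
  have "ars ! i * (Q (length H) + 1) \<le> sum_list ars * (?q + ?q)"
    using a q by (intro mult_le_mono) auto
  moreover have "(6 * ars ! i + 3) * Q (length H + (6 * ars ! i + 3)) \<le> (6 * sum_list ars + 3) * ?q"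
    using a q by (intro mult_le_mono) auto
  moreover have "length ars * (10 * Q (length H + 10)) \<le> length ars * (10 * ?q)"
    using q by (intro mult_le_mono) auto
  moreover have "node_cost * ?q = 17 * ?q + 2 * (sum_list ars * ?q) + length ars * (10 * ?q)
      + (6 * sum_list ars + 3) * ?q + sum_list ars * (?q + ?q)"
    unfolding node_cost_def by (simp add: algebra_simps)
  \<comment> \<open>The products are replaced by variables, which turns the estimate into linear
    arithmetic.\<close>
  moreover have "5 * q5 + (q0 + (1 + x + y + l)) \<le> 17 * q + z + l' + x' + y'"
    if "y \<le> y'" "x \<le> x'" "l \<le> l'" "q5 \<le> q" "q0 \<le> q" "1 \<le> q" for x y l q5 q0 q x' y' l' z :: nat
    using that by simp
  ultimately have "5 * Q (length H + 5) + (Q (length H) + (?T + length [0..<length ars] * (10 * Q (length H + 10))))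
      \<le> node_cost * ?q" using q(1,2,5) unfolding length_upt diff_zero by metis
  from outp_mono[OF outp_seq[OF 1 outp_seq[OF outp_name 2]] this]
  show ?thesis by (simp add: node_prog_def t)
qed

lemma outp_nodes:
  assumes "heap_ok H" "set Xs \<subseteq> terms ars"
  shows "outp H (while_nonnil node_prog) (AL (\<lambda>_. Atom 1) Xs # V) out (Atom 0 # V)
    (out @ concat (map (node_string H) Xs)) (length Xs * (node_cost * Q (length H + node_cost) + 2) + 1)"
  using assms(2)
proof (induction Xs arbitrary: out)
  case Nil
  then show ?case using outp_while_end by (simp add: AL_Nil)
next
  case (Cons t Xs)
  have "outp H (while_nonnil node_prog) (AL (\<lambda>_. Atom 1) (t # Xs) # V) out (Atom 0 # V)
     ((out @ node_string H t) @ concat (map (node_string H) Xs))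
     (node_cost * Q (length H + node_cost) + (length Xs * (node_cost * Q (length H + node_cost) + 2) + 1) + 2)"
    by (rule outp_while_step[OF _ outp_node Cons.IH]) (use assms(1) Cons.prems in \<open>simp_all add: AL_Cons\<close>)
  moreover have "node_cost * Q (length H + node_cost) + (length Xs * (node_cost * Q (length H + node_cost) + 2) + 1) + 2
      \<le> length (t # Xs) * (node_cost * Q (length H + node_cost) + 2) + 1" by simp
  ultimately show ?case using outp_mono by fastforce
qed

section \<open>Reading the input\<close>

fun move_syms :: "nat list \<Rightarrow> prog" where
  "move_syms [] = Skip"
| "move_syms (a # as) = Cond IN {a} (Pop IN ;; Push RV a) (move_syms as)"

text \<open>A program can push only symbols fixed in its text, so an unknown symbol is moved by
  comparing it with all candidates.\<close>

lemma runs_move_syms: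
  "a \<in> set as \<Longrightarrow> s IN = a # I \<Longrightarrow> runs (move_syms as) s (s(IN := I, RV := a # s RV)) (3 + 2 * length as)"
proof (induction as)
  case (Cons b as)
  have 1: "runs (Pop IN ;; Push RV a) s (s(IN := I, RV := a # s RV)) (1 + 2)"
    by (rule runs_le[OF runs_seq[OF runs_pop[where a = a and X = I] runs_push]]) (use Cons.prems in auto)
  have "runs (Cond IN {b} (Pop IN ;; Push RV b) (move_syms as)) s (s(IN := I, RV := a # s RV))
    ((3 + 2 * length as) + 2)"
  proof (rule runs_cond)
    show "runs (if peek (s IN) \<in> {b} then Pop IN ;; Push RV b else move_syms as) s
       (s(IN := I, RV := a # s RV)) (3 + 2 * length as)"
    proof (cases "a = b")
      case True
      then show ?thesis using runs_le[OF 1 refl, of "3 + 2 * length as"] Cons.prems by simp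
    next
      case False
      then show ?thesis using Cons by (simp del: fun_upd_apply)
    qed
  qed simp
  then show ?case by (simp del: fun_upd_apply)
qed simp

text \<open>Prefix notation read backwards is a postfix notation: every constructor is met when the
  values of its arguments are already on the stack, so parsing needs no recursion.\<close>

definition reverse_input :: prog where
  "reverse_input = Loop IN (- {0}) (move_syms [3..<4 + length ars])"

lemma runs_reverse_input:
  "set I \<subseteq> {3..<4 + length ars} \<Longrightarrow> s IN = I \<Longrightarrow>
     runs reverse_input s (s(IN := [], RV := rev I @ s RV)) (length I * (2 * length ars + 10) + 1)"
proof (induction I arbitrary: s)
  case Nil
  have "runs reverse_input s s 1" unfolding reverse_input_def
    by (rule runs_loopF) (use Nil in simp_all)
  then show ?case by (rule runs_le) (use Nil in \<open>auto simp: fun_eq_iff\<close>)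
next
  case (Cons a I)
  have 1: "runs (move_syms [3..<4 + length ars]) s (s(IN := I, RV := a # s RV)) (3 + 2 * length [3..<4 + length ars])"
    by (rule runs_move_syms) (use Cons.prems in auto)
  have "runs reverse_input s ((s(IN := I, RV := a # s RV))(IN := [], RV := rev I @ (s(IN := I, RV := a # s RV)) RV))
     ((3 + 2 * length [3..<4 + length ars]) + (length I * (2 * length ars + 10) + 1) + 2)"
    unfolding reverse_input_def
    by (rule runs_loopT[OF _ _ 1 Cons.IH[unfolded reverse_input_def]]) (use Cons.prems in auto)
  then show ?case by (rule runs_le) (auto simp: fun_eq_iff)
qed

fun parse_cons :: "nat list \<Rightarrow> prog" where
  "parse_cons [] = Skip"
| "parse_cons (i # is) = Cond RV {4 + i} (Pop RV ;; mkcon i (ars ! i)) (parse_cons is)"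

definition parse_body :: prog where
  "parse_body = Cond RV {3} (Pop RV) (parse_cons [0..<length ars])"

definition parse :: prog where
  "parse = Loop RV (- {0}) parse_body"

lemma runs_pop_input: "runs (Pop RV) (st V H (x # I) out) (st V H I out) 1"
  by (rule runs_le[OF runs_pop[where a = x and X = I]]) (auto simp: st_def fun_eq_iff)

lemma runs_parse_cons:
  assumes "runs (mkcon i (ars ! i)) (st V H I out) s T"
  shows "i \<in> set is \<Longrightarrow> runs (parse_cons is) (st V H ((4 + i) # I) out) s (T + 1 + 2 * length is)"
proof (induction "is")
  case (Cons j "is")
  have 1: "runs (Pop RV ;; mkcon i (ars ! i)) (st V H ((4 + i) # I) out) s (1 + T)"
    by (rule runs_seq[OF runs_pop_input assms])
  have "runs (Cond RV {4 + j} (Pop RV ;; mkcon j (ars ! j)) (parse_cons is)) (st V H ((4 + i) # I) out) s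
    ((T + 1 + 2 * length is) + 2)"
  proof (rule runs_cond)
    show "runs (if peek (st V H ((4 + i) # I) out RV) \<in> {4 + j} then Pop RV ;; mkcon j (ars ! j)
      else parse_cons is) (st V H ((4 + i) # I) out) s (T + 1 + 2 * length is)"
    proof (cases "i = j")
      case True
      then show ?thesis using runs_le[OF 1 refl, of "T + 1 + 2 * length is"] by simp
    next
      case False
      then show ?thesis using Cons by simp
    qed
  qed simp
  then show ?case by simp
qed simp

text \<open>Speaks of the whole way from the current state to the end of the input:
  \<open>Vf\<close> is the final stack, \<open>V\<close> and \<open>I\<close> are the current stack
  and the unread input. Facts are built from the end of the input towards its start.\<close>

definition parses :: "val list \<Rightarrow> val list \<Rightarrow> nat list \<Rightarrow> nat \<Rightarrow> bool" where
  "parses Vf V I n \<longleftrightarrow> (\<forall>H. heap_ok H \<longrightarrow> all_known H V \<longrightarrow>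
     (\<exists>H'. heap_ext H H' \<and> all_known H' Vf \<and> length H' \<le> length H + n \<and>
        runs parse (st V H I []) (st Vf H' [] []) (n * Q (length H + n))))"

lemma parses_end: "parses V V [] 1"
  unfolding parses_def
proof (intro allI impI)
  fix H assume H: "heap_ok H" "all_known H V"
  have "runs parse (st V H [] []) (st V H [] []) 1" unfolding parse_def by (rule runs_loopF) simp_all
  then have "runs parse (st V H [] []) (st V H [] []) (1 * Q (length H + 1))"
    by (rule runs_le) (use Q_ge_2[of "length H + 1"] in simp_all)
  then show "\<exists>H'. heap_ext H H' \<and> all_known H' V \<and> length H' \<le> length H + 1 \<and>
        runs parse (st V H [] []) (st V H' [] []) (1 * Q (length H + 1))"
    using H heap_ext_refl by (intro exI[of _ H]) auto
qed

definition parse_cost :: nat where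
  "parse_cost = 5 * sum_list ars + 2 * length ars + 20"

lemma parses_sep:
  assumes "parses Vf V I n"
  shows "parses Vf V (3 # I) (n + parse_cost)"
  unfolding parses_def
proof (intro allI impI)
  fix H assume H: "heap_ok H" "all_known H V"
  let ?q = "Q (length H + (n + parse_cost))"
  obtain H' where 1: "heap_ext H H'" "all_known H' Vf" "length H' \<le> length H + n"
    "runs parse (st V H I []) (st Vf H' [] []) (n * Q (length H + n))"
    using assms H unfolding parses_def by blast
  have "runs parse_body (st V H (3 # I) []) (st V H I []) (1 + 2)"
    unfolding parse_body_def by (rule runs_cond) (use runs_pop_input in simp_all)
  then have "runs parse (st V H (3 # I) []) (st Vf H' [] []) ((1 + 2) + n * Q (length H + n) + 2)"
    using 1(4) unfolding parse_def by (intro runs_loopT) simp_all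
  moreover have "(1 + 2) + n * Q (length H + n) + 2 \<le> (n + parse_cost) * ?q"
  proof -
    have "n * Q (length H + n) \<le> n * ?q" by (intro mult_le_mono Q_mono) simp_all
    moreover have "20 * 1 \<le> parse_cost * ?q"
      using Q_ge_2[of "length H + (n + parse_cost)"] by (intro mult_le_mono) (simp_all add: parse_cost_def)
    ultimately show ?thesis unfolding distrib_right by linarith
  qed
  ultimately show "\<exists>H'. heap_ext H H' \<and> all_known H' Vf \<and> length H' \<le> length H + (n + parse_cost) \<and>
        runs parse (st V H (3 # I) []) (st Vf H' [] []) ((n + parse_cost) * ?q)"
    using 1 runs_le by (intro exI[of _ H']) auto
qed

lemma parses_con:
  assumes "parses Vf (ev (Con i ts) # V) I n" "i < length ars" "length ts = ars ! i"
  shows "parses Vf (map ev ts @ V) ((4 + i) # I) (n + parse_cost)"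
  unfolding parses_def
proof (intro allI impI)
  fix H assume H: "heap_ok H" "all_known H (map ev ts @ V)"
  let ?q = "Q (length H + (n + parse_cost))"
  let ?a = "5 * ars ! i + 3"
  have a: "ars ! i \<le> sum_list ars" using nth_le_sum_list assms(2) by simp
  obtain H1 where 1: "heap_ext H H1" "all_known H1 (ev (Con i ts) # V)" "length H1 \<le> length H + ?a"
    "runs (mkcon i (ars ! i)) (st (map ev ts @ V) H I []) (st (ev (Con i ts) # V) H1 I []) (?a * Q (length H + ?a))"
    using run_mkcon[OF assms(3,2), of V] H unfolding run_def by blast
  then have "heap_ok H1" by (simp add: heap_ext_def)
  with assms(1) 1 obtain H2 where 2: "heap_ext H1 H2" "all_known H2 Vf" "length H2 \<le> length H1 + n"
    "runs parse (st (ev (Con i ts) # V) H1 I []) (st Vf H2 [] []) (n * Q (length H1 + n))"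
    unfolding parses_def by blast
  have "runs parse_body (st (map ev ts @ V) H ((4 + i) # I) []) (st (ev (Con i ts) # V) H1 I [])
    ((?a * Q (length H + ?a) + 1 + 2 * length [0..<length ars]) + 2)"
    unfolding parse_body_def
    by (rule runs_cond) (use runs_parse_cons[OF 1(4), of "[0..<length ars]"] assms(2) in simp_all)
  then have "runs parse (st (map ev ts @ V) H ((4 + i) # I) []) (st Vf H2 [] [])
     (((?a * Q (length H + ?a) + 1 + 2 * length [0..<length ars]) + 2) + n * Q (length H1 + n) + 2)"
    using 2(4) unfolding parse_def by (intro runs_loopT) simp_all
  moreover have "((?a * Q (length H + ?a) + 1 + 2 * length [0..<length ars]) + 2) + n * Q (length H1 + n) + 2
      \<le> (n + parse_cost) * ?q"
  proof -
    have "n * Q (length H1 + n) \<le> n * ?q"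
      using 1(3) a by (intro mult_le_mono Q_mono) (simp_all add: parse_cost_def)
    moreover have "?a * Q (length H + ?a) \<le> (5 * sum_list ars + 3) * ?q"
      using a by (intro mult_le_mono Q_mono) (simp_all add: parse_cost_def)
    moreover have "(2 * length ars + 17) * 1 \<le> (2 * length ars + 17) * ?q"
      using Q_ge_2[of "length H + (n + parse_cost)"] by (intro mult_le_mono) simp_all
    moreover have "(n + parse_cost) * ?q = n * ?q + (5 * sum_list ars + 3) * ?q + (2 * length ars + 17) * ?q"
      unfolding parse_cost_def by (simp add: algebra_simps)
    moreover have "x + 1 + 2 * l + 2 + y + 2 \<le> y' + x' + z"
      if "y \<le> y'" "x \<le> x'" "(2 * l + 17) * 1 \<le> z" for x y l x' y' z :: nat
      using that by simp
    ultimately show ?thesis unfolding length_upt diff_zero by presburger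
  qed
  moreover have "length H2 \<le> length H + (n + parse_cost)"
    using 1(3) 2(3) a by (simp add: parse_cost_def)
  ultimately show "\<exists>H'. heap_ext H H' \<and> all_known H' Vf \<and> length H' \<le> length H + (n + parse_cost) \<and>
        runs parse (st (map ev ts @ V) H ((4 + i) # I) []) (st Vf H' [] []) ((n + parse_cost) * ?q)"
    using 1(1) 2(1,2) heap_ext_trans runs_le by (intro exI[of _ H2]) blast
qed

text \<open>The arguments are read from last to first, so the first one ends up on top, as
  \<open>mkcon\<close> expects.\<close>

lemma parses_term:
  "t \<in> terms ars \<Longrightarrow> parses Vf (ev t # V) I n \<Longrightarrow>
     parses Vf V (rev (term_code t) @ I) (n + parse_cost * tsize t)"
proof (induction t arbitrary: V I n rule: trm.induct)
  case (Con i ts)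
  have i: "i < length ars" "length ts = ars ! i" "set ts \<subseteq> terms ars"
    using Con.prems(1) by (auto elim: terms.cases)
  have list: "parses Vf V (rev (concat (map term_code us)) @ I) (n + parse_cost * sum_list (map tsize us))"
    if "set us \<subseteq> set ts" "parses Vf (map ev us @ V) I n" for us V I n
    using that
  proof (induction us arbitrary: V I n)
    case (Cons u us)
    have u: "u \<in> set ts" "u \<in> terms ars" using Cons.prems(1) i(3) by auto
    have "parses Vf (map ev us @ V) (rev (term_code u) @ I) (n + parse_cost * tsize u)"
    proof -
      have "parses Vf (ev u # map ev us @ V) I n" using Cons.prems(2) by simp
      then show ?thesis by (rule Con.IH[OF u])
    qed
    from Cons.IH[OF _ this] Cons.prems(1)
    show ?case by (simp add: algebra_simps)
  qed simp
  have "parses Vf (map ev ts @ V) ((4 + i) # I) (n + parse_cost)"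
    by (rule parses_con[OF Con.prems(2) i(1,2)])
  from list[OF subset_refl this] show ?case by (simp add: algebra_simps)
qed

lemma parses_input:
  "set vs \<subseteq> terms ars \<Longrightarrow> parses Vf (map ev vs @ V) I n \<Longrightarrow>
    parses Vf V (rev (input_code vs) @ I) (n + parse_cost * (sum_list (map tsize vs) + length vs))"
proof (induction vs arbitrary: V I n)
  case Nil
  then show ?case by (simp add: input_code_def)
next
  case (Cons v vs)
  have "parses Vf (map ev vs @ V) (rev (term_code v) @ I) (n + parse_cost * tsize v)"
    by (rule parses_term) (use Cons.prems in auto)
  from Cons.IH[OF _ parses_sep[OF this]] Cons.prems(1)
  have "parses Vf V (rev (input_code vs) @ 3 # rev (term_code v) @ I)
    (n + parse_cost * tsize v + parse_cost + parse_cost * (sum_list (map tsize vs) + length vs))" by simp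
  then show ?case by (simp add: input_code_def algebra_simps)
qed

end

section \<open>Polynomial time\<close>


lemma length_term_code: "length (term_code t) = tsize t"
proof (induction t)
  case (Con i ts)
  then show ?case by (auto simp: length_concat o_def intro!: arg_cong[of _ _ sum_list])
qed

lemma length_input_code: "length (input_code vs) = sum_list (map tsize vs) + length vs"
  by (induction vs) (simp_all add: input_code_def length_term_code)

lemma set_term_code: "t \<in> terms ars \<Longrightarrow> set (term_code t) \<subseteq> {4..<4 + length ars}"
proof (induction rule: terms.induct)
  case (1 i ts)
  then show ?case by auto
qed

lemma set_input_code: "set vs \<subseteq> terms ars \<Longrightarrow> set (input_code vs) \<subseteq> {3..<4 + length ars}"
proof -
  assume "set vs \<subseteq> terms ars"
  then have *: "set (term_code v) \<subseteq> {4..<4 + length ars}" if "v \<in> set vs" for v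
    using set_term_code that by blast
  show ?thesis
  proof
    fix x assume "x \<in> set (input_code vs)"
    then have "x = 3 \<or> (\<exists>v \<in> set vs. x \<in> set (term_code v))"
      by (auto simp: input_code_def split: if_splits)
    then have "x = 3 \<or> x \<in> {4..<4 + length ars}" using * by blast
    then show "x \<in> {3..<4 + length ars}" by auto
  qed
qed

lemma card_subs_le: "card (subs t) \<le> tsize t"
proof (induction t)
  case (Con i ts)
  have "card (\<Union>t \<in> set us. subs t) \<le> sum_list (map tsize us)" if "set us \<subseteq> set ts" for us
    using that
  proof (induction us)
    case (Cons u us)
    have "card (subs u \<union> (\<Union>t \<in> set us. subs t)) \<le> card (subs u) + card (\<Union>t \<in> set us. subs t)"
      by (rule card_Un_le)
    also have "\<dots> \<le> tsize u + sum_list (map tsize us)"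
      using Cons Con by (intro add_mono) auto
    finally show ?case by simp
  qed simp
  from this[of ts] show ?case
    using card_insert_if[of "\<Union>t \<in> set ts. subs t" "Con i ts"] by (simp split: if_splits)
qed

lemma dag_size_le: "dag_size vs \<le> sum_list (map tsize vs)"
proof (induction vs)
  case (Cons v vs)
  have "dag_size (v # vs) \<le> card (subs v) + dag_size vs"
    unfolding dag_size_def by (simp add: card_Un_le)
  then show ?case using Cons card_subs_le[of v] by simp
qed (simp add: dag_size_def)

section \<open>The graph of the distinct subterms of a term\<close>

fun con_of :: "trm \<Rightarrow> nat" where
  "con_of (Con i ts) = i"

fun args_of :: "trm \<Rightarrow> trm list" where
  "args_of (Con i ts) = ts"

text \<open>The nodes are the distinct subterms, renamed by \<open>nm\<close>; when
  \<open>nm\<close> is injective on them, \<open>inv_into\<close> recovers a subterm from its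
  name.\<close>

definition dag_of :: "(trm \<Rightarrow> 'n) \<Rightarrow> trm \<Rightarrow> 'n dag" where
  "dag_of nm v = \<lparr>nodes = nm ` subs v, label = (\<lambda>x. con_of (inv_into (subs v) nm x)),
     succs = (\<lambda>x. map nm (args_of (inv_into (subs v) nm x))), dag_root = nm v\<rparr>"

lemma dag_of_simps [simp]:
  "nodes (dag_of nm v) = nm ` subs v" "dag_root (dag_of nm v) = nm v"
  by (simp_all add: dag_of_def)

context
  fixes nm :: "trm \<Rightarrow> 'n" and v :: trm
  assumes inj: "inj_on nm (subs v)"
begin

lemma dag_of_node [simp]:
  assumes "t \<in> subs v"
  shows "label (dag_of nm v) (nm t) = con_of t" "succs (dag_of nm v) (nm t) = map nm (args_of t)"
  using inj assms by (simp_all add: dag_of_def)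

lemma args_of_subs: "t \<in> subs v \<Longrightarrow> u \<in> set (args_of t) \<Longrightarrow> u \<in> subs v"
  using sub_closed_subs[of v] by (cases t) (auto simp: sub_closed_def)

lemma dag_of_edges: "dag_edges (dag_of nm v) = {(nm t, nm u) |t u. t \<in> subs v \<and> u \<in> set (args_of t)}"
  by (auto simp: dag_edges_def) blast

text \<open>Every edge leads to a term of smaller size.\<close>

lemma dag_of_acyclic: "acyclic (dag_edges (dag_of nm v))"
proof -
  have "(dag_edges (dag_of nm v))\<inverse> \<subseteq> measure (\<lambda>x. size (inv_into (subs v) nm x))"
  proof (clarsimp simp: dag_of_edges)
    fix t u assume t: "t \<in> subs v" "u \<in> set (args_of t)"
    then have "size u < size t" by (cases t) (simp add: less_Suc_eq_le size_list_estimation')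
    then show "size (inv_into (subs v) nm (nm u)) < size (inv_into (subs v) nm (nm t))"
      using t inj args_of_subs[OF t] by simp
  qed
  then have "wf ((dag_edges (dag_of nm v))\<inverse>)" by (rule wf_subset[OF wf_measure])
  from wf_acyclic[OF this] show ?thesis by (simp only: acyclic_converse)
qed

lemma dag_of_reachable: "t \<in> subs v \<Longrightarrow> u \<in> subs t \<Longrightarrow> (nm t, nm u) \<in> (dag_edges (dag_of nm v))\<^sup>*"
proof (induction t)
  case (Con i ts)
  show ?case
  proof (cases "u = Con i ts")
    case False
    then obtain s where s: "s \<in> set ts" "u \<in> subs s" using Con.prems(2) by auto
    have "(nm (Con i ts), nm s) \<in> dag_edges (dag_of nm v)"
      using Con.prems(1) s(1) by (force simp: dag_of_edges)
    then show ?thesis using Con.IH[OF s(1) args_of_subs[OF Con.prems(1)] s(2)] s(1)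
      by (auto intro: converse_rtrancl_into_rtrancl)
  qed simp
qed

lemma dag_of_unfolds: "t \<in> subs v \<Longrightarrow> unfolds (dag_of nm v) (nm t) t"
proof (induction t)
  case (Con i ts)
  have "list_all2 (unfolds (dag_of nm v)) (map nm ts) ts"
    using Con.IH args_of_subs[OF Con.prems] by (auto simp: list_all2_conv_all_nth)
  then show ?case
    using unfolds.intros[of "dag_of nm v" "nm (Con i ts)" ts] Con.prems by simp
qed

lemma dag_of_represents:
  assumes "v \<in> terms ars"
  shows "dag_represents ars (dag_of nm v) v"
  unfolding dag_represents_def
proof (intro conjI ballI)
  fix x assume "x \<in> nodes (dag_of nm v)"
  then obtain t where t: "x = nm t" "t \<in> subs v" by auto
  have "t \<in> terms ars" using subs_terms[OF assms] t by blast
  then show "label (dag_of nm v) x < length ars"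
    "length (succs (dag_of nm v) x) = ars ! label (dag_of nm v) x"
    using t by (auto elim: terms.cases)
  show "set (succs (dag_of nm v) x) \<subseteq> nodes (dag_of nm v)"
    using t args_of_subs by auto
  show "(dag_root (dag_of nm v), x) \<in> (dag_edges (dag_of nm v))\<^sup>*"
    using t dag_of_reachable[of v t] by simp
next
  show "inj_on (\<lambda>x. (label (dag_of nm v) x, succs (dag_of nm v) x)) (nodes (dag_of nm v))"
  proof (rule inj_onI)
    fix x y assume "x \<in> nodes (dag_of nm v)" "y \<in> nodes (dag_of nm v)"
      and eq: "(label (dag_of nm v) x, succs (dag_of nm v) x) = (label (dag_of nm v) y, succs (dag_of nm v) y)"
    then obtain t u where t: "x = nm t" "t \<in> subs v" and u: "y = nm u" "u \<in> subs v" by auto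
    \<comment> \<open>Equal successor names mean equal arguments, by injectivity of
      \<open>nm\<close>; with equal labels the terms coincide.\<close>
    have "set (args_of t) \<union> set (args_of u) \<subseteq> subs v"
      using args_of_subs t u by blast
    then have "inj_on nm (set (args_of t) \<union> set (args_of u))" using inj inj_on_subset by blast
    then have "args_of t = args_of u" using eq t u by (simp add: inj_on_map_eq_map)
    then show "x = y" using eq t u by (cases t; cases u) simp
  qed
qed (simp_all add: dag_of_acyclic dag_of_unfolds)

end

context signature
begin

lemma known_lst: "heap_ok H \<Longrightarrow> known H (lst xs) \<Longrightarrow> x \<in> set xs \<Longrightarrow> known H x"
proof (induction xs)
  case (Cons y xs)
  then have "Cell y (lst xs) \<in> set H" by (simp add: known_def)
  from heap_okD[OF Cons.prems(1) this] Cons show ?case by auto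
qed simp

text \<open>The heap is closed under components, so a stored term brings addresses for all its
  subterms.\<close>

lemma known_subs: "heap_ok H \<Longrightarrow> known H (ev v) \<Longrightarrow> t \<in> subs v \<Longrightarrow> known H (ev t)"
proof (induction v)
  case (Con i ts)
  have "Cell (Atom (i + 2)) (lst (rev (map ev ts))) \<in> set H"
    using Con.prems(2) by (simp add: known_def)
  from heap_okD[OF Con.prems(1) this] have "known H (lst (rev (map ev ts)))" by simp
  from known_lst[OF Con.prems(1) this] have "known H (ev u)" if "u \<in> set ts" for u using that by simp
  then show ?case using Con by auto
qed

definition unary_name :: "val list \<Rightarrow> trm \<Rightarrow> bool list" where
  "unary_name H t = replicate (addr H (ev t)) False"

lemma bits_code_unary_name: "bits_code (unary_name H t) = name H t"
  by (simp add: bits_code_def unary_name_def name_def)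

lemma inj_on_unary_name:
  assumes "heap_ok H" "known H (ev v)"
  shows "inj_on (unary_name H) (subs v)"
proof (rule inj_onI)
  fix t u assume "t \<in> subs v" "u \<in> subs v" "unary_name H t = unary_name H u"
  then have "addr H (ev t) = addr H (ev u)" "known H (ev t)" "known H (ev u)"
    using known_subs[OF assms] by (simp_all add: unary_name_def replicate_eq_replicate)
  then show "t = u" by (simp add: addr_inj)
qed

lemma node_code_unary_name:
  assumes "heap_ok H" "known H (ev v)" "t \<in> subs v"
  shows "node_code (dag_of (unary_name H) v) (unary_name H t) = node_string H t"
  using dag_of_node[OF inj_on_unary_name[OF assms(1,2)] assms(3)]
  by (cases t) (simp add: node_code_def bits_code_unary_name o_def)

lemma dag_encoding_output:
  assumes "heap_ok H" "known H (ev v)" "distinct Xs" "set Xs = subs v"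
  shows "dag_encoding (dag_of (unary_name H) v) (name H v @ [3] @ concat (map (node_string H) Xs))"
  unfolding dag_encoding_def
proof (intro exI conjI)
  show "distinct (map (unary_name H) Xs)"
    using assms inj_on_unary_name by (simp add: distinct_map)
  show "set (map (unary_name H) Xs) = nodes (dag_of (unary_name H) v)" using assms by simp
  have "map (node_string H) Xs = map (node_code (dag_of (unary_name H) v)) (map (unary_name H) Xs)"
    using node_code_unary_name[OF assms(1,2)] assms(4) by simp
  then show "name H v @ [3] @ concat (map (node_string H) Xs) =
    bits_code (dag_root (dag_of (unary_name H) v)) @ [3] @
      concat (map (node_code (dag_of (unary_name H) v)) (map (unary_name H) Xs))"
    by (simp only: bits_code_unary_name dag_of_simps)
qed

text \<open>Here \<open>Atom 1\<close> is a dummy memo value, chosen only to differ from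
  \<open>Atom 0\<close>; the keys of the table are what matters. The result is copied to the top
  because the name of the root is printed before the nodes.\<close>

definition finish :: prog where
  "finish = blk [OPick 0] ;; dfs (blk [OAtom 1]) ;; blk [OPick 1]"

definition print_result :: prog where
  "print_result = emit_num VS ;; Emit 3 ;; while_nonnil node_prog"

definition main_prog :: "prog \<Rightarrow> prog" where
  "main_prog c = push_num CT atoms ;; reverse_input ;; parse ;; (c ;; finish) ;; print_result"

lemma run_finish_prog:
  assumes "v \<in> terms ars" "card (subs v) \<le> N"
  shows "run finish [ev v] (ev v # AL (\<lambda>_. Atom 1) (visit v []) # [ev v]) (dfs_cost N 1 + 3)"
proof -
  have 1: "run (blk [OPick 0]) [ev v] (ev v # [ev v]) 1" by (rule run_blk_le) simp_all
  have "run (dfs (blk [OAtom 1])) (ev v # [ev v]) (AL (\<lambda>_. Atom 1) (visit v []) # [ev v])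
     (dfs_cost (card (subs v)) 1)"
    by (rule run_dfs[OF assms(1)]) (simp, rule run_blk_le, simp_all add: atoms_def)
  then have 2: "run (dfs (blk [OAtom 1])) (ev v # [ev v]) (AL (\<lambda>_. Atom 1) (visit v []) # [ev v])
     (dfs_cost N 1)"
    by (rule run_mono) (rule dfs_cost_mono[OF assms(2) order_refl])
  have 3: "run (blk [OPick 1]) (AL (\<lambda>_. Atom 1) (visit v []) # [ev v])
     (ev v # AL (\<lambda>_. Atom 1) (visit v []) # [ev v]) 2"
    by (rule run_blk_le) simp_all
  show ?thesis unfolding finish_def by (rule run_mono[OF run_seq[OF 1 run_seq[OF 2 3]]]) simp
qed

lemma outp_print_result:
  assumes H: "heap_ok H" and v: "v \<in> terms ars" and N: "card (subs v) \<le> N"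
  shows "outp H print_result (ev v # AL (\<lambda>_. Atom 1) (visit v []) # V) [] (Atom 0 # V)
    (name H v @ [3] @ concat (map (node_string H) (visit v [])))
    (Q (length H) + 1 + (N * (node_cost * Q (length H + node_cost) + 2) + 1))"
proof -
  have vp: "set (visit v []) = subs v" "distinct (visit v [])"
    using visit_props[of "[]" v] by (simp_all add: sub_closed_def)
  then have l: "length (visit v []) \<le> N" using N by (metis distinct_card)
  have "set (visit v []) \<subseteq> terms ars" using vp subs_terms[OF v] by simp
  note 3 = outp_nodes[OF H this, of V "([] @ name H v) @ [3]"]
  have "length (visit v []) * (node_cost * Q (length H + node_cost) + 2) \<le> N * (node_cost * Q (length H + node_cost) + 2)"
    using l by (rule mult_le_mono1)
  then have "Q (length H) + (1 + (length (visit v []) * (node_cost * Q (length H + node_cost) + 2) + 1))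
     \<le> Q (length H) + 1 + (N * (node_cost * Q (length H + node_cost) + 2) + 1)" by linarith
  from outp_mono[OF outp_seq[OF outp_name outp_seq[OF outp_emit 3]] this]
  show ?thesis by (simp add: print_result_def)
qed

theorem main_prog_correct:
  assumes "computable f k"
    and size: "\<forall>vs \<in> tuples ars k. f vs \<in> terms ars \<and> card (subs (f vs)) \<le> (dag_size vs + 2) ^ d"
  shows "\<exists>c e. \<forall>vs \<in> tuples ars k. \<exists>(G :: bool list dag) s t.
     dag_represents ars G (f vs) \<and> dag_encoding G (s 0) \<and>
     exec (main_prog c) (initial_store (input_code vs)) t s \<and> t \<le> (sum_list (map tsize vs) + 2) ^ e"
proof -
  obtain c ec where c: "\<And>vs V. vs \<in> tuples ars k \<Longrightarrow>
      run c (map ev vs @ V) (ev (f vs) # V) ((dag_size vs + 2) ^ ec)"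
    using assms(1) unfolding computable_def by blast
  \<comment> \<open>\<open>n1\<close> bounds the parsing and \<open>n2\<close> the evaluation with
    the final search, each both in operations and in new cells; hence \<open>L\<close> bounds the
    final heap.\<close>
  define n1 where "n1 = (\<lambda>s. 1 + parse_cost * (s + k))"
  define n2 where "n2 = (\<lambda>s. (s + 2) ^ ec + (dfs_cost ((s + 2) ^ d) 1 + 3))"
  define L where "L = (\<lambda>s. n1 s + n2 s)"
  define T where "T = (\<lambda>s. (2 * atoms + 2) + (((s + k) * (2 * length ars + 10) + 1) + (n1 s * Q (n1 s) +
     (n2 s * Q (L s) + (Q (L s) + 1 + ((s + 2) ^ d * (node_cost * Q (L s + node_cost) + 2) + 1))))))"
  have "pb T"
    unfolding T_def L_def n1_def n2_def Q_def dfs_cost_def dfs_step_cost_def by (intro pb_intros)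
  then obtain e where e: "\<And>s. T s \<le> (s + 2) ^ e" using pbD by blast
  have *: "\<exists>(G :: bool list dag) s t. dag_represents ars G (f vs) \<and> dag_encoding G (s 0) \<and>
     exec (main_prog c) (initial_store (input_code vs)) t s \<and> t \<le> T (sum_list (map tsize vs))"
    if vs: "vs \<in> tuples ars k" for vs
  proof -
    let ?v = "f vs"
    let ?w = "input_code vs"
    let ?M = "AL (\<lambda>_. Atom 1) (visit ?v [])"
    define s where "s = sum_list (map tsize vs)"
    have k: "length vs = k" "set vs \<subseteq> terms ars" using vs by (simp_all add: tuples_def)
    have v: "?v \<in> terms ars" using size vs by blast
    have ds: "dag_size vs + 2 \<le> s + 2" using dag_size_le by (simp add: s_def)
    have "card (subs ?v) \<le> (dag_size vs + 2) ^ d" using size vs by blast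
    also have "\<dots> \<le> (s + 2) ^ d" using ds by (rule power_mono) simp
    finally have N: "card (subs ?v) \<le> (s + 2) ^ d" .
    have "(dag_size vs + 2) ^ ec \<le> (s + 2) ^ ec" using ds by (rule power_mono) simp
    with c[OF vs, of "[]"] have "run c (map ev vs) [ev ?v] ((s + 2) ^ ec)"
      using run_mono by simp
    from run_seq[OF this run_finish_prog[OF v N]]
    have comp: "run (c ;; finish) (map ev vs) (ev ?v # ?M # [ev ?v]) (n2 s)" by (simp add: n2_def)
    have 1: "runs (push_num CT atoms) (initial_store ?w) ((initial_store ?w)(CT := num atoms)) (2 * atoms + 2)"
      by (rule runs_le[OF runs_push_num]) (auto simp: initial_store_def)
    have "runs reverse_input ((initial_store ?w)(CT := num atoms))
      (((initial_store ?w)(CT := num atoms))(IN := [], RV := rev ?w @ ((initial_store ?w)(CT := num atoms)) RV))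
      (length ?w * (2 * length ars + 10) + 1)"
      by (rule runs_reverse_input[OF set_input_code[OF k(2)]]) (simp add: initial_store_def)
    moreover have "((initial_store ?w)(CT := num atoms))(IN := [], RV := rev ?w @ ((initial_store ?w)(CT := num atoms)) RV)
      = st [] [] (rev ?w) []"
      by (auto simp: initial_store_def st_def fun_eq_iff entries_def)
    moreover have "length ?w = s + k" by (simp add: length_input_code s_def k)
    ultimately have 2: "runs reverse_input ((initial_store ?w)(CT := num atoms)) (st [] [] (rev ?w) [])
      ((s + k) * (2 * length ars + 10) + 1)" by simp
    have "parses (map ev vs) [] (rev ?w @ []) (1 + parse_cost * (sum_list (map tsize vs) + length vs))"
      by (rule parses_input[OF k(2)]) (use parses_end[of "map ev vs"] in simp)
    then have "parses (map ev vs) [] (rev ?w) (n1 s)" by (simp add: n1_def s_def k)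
    then have "\<exists>H1. heap_ext [] H1 \<and> all_known H1 (map ev vs) \<and> length H1 \<le> length ([] :: val list) + n1 s \<and>
      runs parse (st [] [] (rev ?w) []) (st (map ev vs) H1 [] []) (n1 s * Q (length ([] :: val list) + n1 s))"
      unfolding parses_def by (simp add: all_known_def del: list.size)
    then obtain H1 where H1: "heap_ext [] H1" "all_known H1 (map ev vs)" "length H1 \<le> n1 s"
      "runs parse (st [] [] (rev ?w) []) (st (map ev vs) H1 [] []) (n1 s * Q (n1 s))"
      by auto
    then have "heap_ok H1" by (simp add: heap_ext_def)
    with comp H1(2) obtain H2 where H2: "heap_ext H1 H2" "all_known H2 (ev ?v # ?M # [ev ?v])"
      "length H2 \<le> length H1 + n2 s"
      "runs (c ;; finish) (st (map ev vs) H1 [] []) (st (ev ?v # ?M # [ev ?v]) H2 [] [])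
        (n2 s * Q (length H1 + n2 s))"
      unfolding run_def by blast
    have ok: "heap_ok H2" "known H2 (ev ?v)" using H2(1,2) by (simp_all add: heap_ext_def all_known_def)
    let ?out = "name H2 ?v @ [3] @ concat (map (node_string H2) (visit ?v []))"
    have out: "runs print_result (st (ev ?v # ?M # [ev ?v]) H2 [] []) (st (Atom 0 # [ev ?v]) H2 [] ?out)
      (Q (length H2) + 1 + ((s + 2) ^ d * (node_cost * Q (length H2 + node_cost) + 2) + 1))"
      using outp_print_result[OF ok(1) v N, of "[ev ?v]"] H2(2) unfolding outp_def by blast
    have L: "length H1 + n2 s \<le> L s" "length H2 \<le> L s" using H1(3) H2(3) by (simp_all add: L_def)
    have "n2 s * Q (length H1 + n2 s) \<le> n2 s * Q (L s)" using L by (intro mult_le_mono2 Q_mono)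
    note 4 = runs_le[OF H2(4) refl this]
    have "Q (length H2) + 1 + ((s + 2) ^ d * (node_cost * Q (length H2 + node_cost) + 2) + 1)
       \<le> Q (L s) + 1 + ((s + 2) ^ d * (node_cost * Q (L s + node_cost) + 2) + 1)"
      using L(2) by (intro add_mono mult_le_mono Q_mono) simp_all
    note 5 = runs_le[OF out refl this]
    have "runs (main_prog c) (initial_store ?w) (st (Atom 0 # [ev ?v]) H2 [] ?out) (T s)"
      unfolding main_prog_def T_def
      by (rule runs_seq[OF 1 runs_seq[OF 2 runs_seq[OF H1(4) runs_seq[OF 4 5]]]])
    then obtain t where "exec (main_prog c) (initial_store ?w) t (st (Atom 0 # [ev ?v]) H2 [] ?out)" "t \<le> T s"
      by (auto simp: runs_def)
    moreover have "dag_represents ars (dag_of (unary_name H2) ?v) ?v"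
      by (rule dag_of_represents[OF inj_on_unary_name[OF ok] v])
    moreover have "dag_encoding (dag_of (unary_name H2) ?v) (st (Atom 0 # [ev ?v]) H2 [] ?out 0)"
      using dag_encoding_output[OF ok, of "visit ?v []"] visit_props[of "[]" ?v] by (simp add: sub_closed_def)
    ultimately show ?thesis unfolding s_def[symmetric]
      by (intro exI[of _ "dag_of (unary_name H2) ?v"] exI[of _ "st (Atom 0 # [ev ?v]) H2 [] ?out"]
          exI[of _ t] conjI)
  qed
  show ?thesis
  proof (intro exI[of _ c] exI[of _ e] ballI)
    fix vs assume "vs \<in> tuples ars k"
    from *[OF this] obtain G :: "bool list dag" and s t where G:
      "dag_represents ars G (f vs)" "dag_encoding G (s 0)"
      "exec (main_prog c) (initial_store (input_code vs)) t s" "t \<le> T (sum_list (map tsize vs))" by (elim exE conjE)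
    from G(4) e[of "sum_list (map tsize vs)"] have "t \<le> (sum_list (map tsize vs) + 2) ^ e"
      by (rule order_trans)
    with G(1-3) show "\<exists>(G :: bool list dag) s t. dag_represents ars G (f vs) \<and> dag_encoding G (s 0) \<and>
      exec (main_prog c) (initial_store (input_code vs)) t s \<and> t \<le> (sum_list (map tsize vs) + 2) ^ e"
      by (intro exI[of _ G] exI[of _ s] exI[of _ t] conjI)
  qed
qed

end

text \<open>A polynomial has to be given as an explicit sum of monomials. Estimating by the maximum
  \<open>M\<close> of 2 and the entries avoids a multinomial expansion, as \<open>M ^ c\<close> is
  one of the summands on the right.\<close>

lemma sum_power_le:
  fixes xs :: "nat list"
  assumes "length xs = k"
  shows "(sum_list xs + 2) ^ c \<le> (k + 1) ^ c * (2 ^ c + (\<Sum>i<k. (xs ! i) ^ c))"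
proof -
  define M where "M = Max (insert 2 (set xs))"
  have le: "x \<le> M" if "x \<in> set xs" for x using that by (simp add: M_def)
  have "sum_list xs \<le> length xs * M"
    using sum_list_mono[of xs "\<lambda>x. x" "\<lambda>_. M"] le by (simp add: sum_list_triv)
  moreover have "2 \<le> M" by (simp add: M_def)
  ultimately have "sum_list xs + 2 \<le> (k + 1) * M" using assms by simp
  then have "(sum_list xs + 2) ^ c \<le> ((k + 1) * M) ^ c" by (rule power_mono) simp
  also have "\<dots> = (k + 1) ^ c * M ^ c" by (rule power_mult_distrib)
  also have "M ^ c \<le> 2 ^ c + (\<Sum>i<k. (xs ! i) ^ c)"
  proof -
    have "M \<in> insert 2 (set xs)" unfolding M_def by (rule Max_in) auto
    then consider "M = 2" | i where "i < k" "M = xs ! i" using assms by (auto simp: in_set_conv_nth)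
    then show ?thesis
    proof cases
      case (2 i)
      then have "M ^ c \<le> (\<Sum>i<k. (xs ! i) ^ c)" using member_le_sum[of i "{..<k}" "\<lambda>i. (xs ! i) ^ c"] by simp
      then show ?thesis by simp
    qed simp
  qed
  finally show ?thesis by simp
qed

text \<open>The positive exponent \<open>Suc c\<close> keeps the exponent vectors \<open>u i\<close>
  distinct from each other and from that of the constant monomial.\<close>

lemma polynomial_fun_power_sum:
  "polynomial_fun k (\<lambda>xs. a * (b + (\<Sum>i<k. (xs ! i) ^ Suc c)))"
proof -
  define u where "u = (\<lambda>i j :: nat. if j = i then Suc c else 0)"
  define E where "E = insert (\<lambda>_. 0) (u ` {..<k})"
  define w where "w = (\<lambda>e :: nat \<Rightarrow> nat. if e = (\<lambda>_. 0) then a * b else a)"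
  have u0: "u i \<noteq> (\<lambda>_. 0)" for i by (auto simp: u_def fun_eq_iff)
  have inj: "inj_on u {..<k}" by (rule inj_onI) (auto simp: u_def fun_eq_iff split: if_splits)
  have prod: "(\<Prod>j<k. (xs ! j) ^ u i j) = (xs ! i) ^ Suc c" if "i < k" for xs :: "nat list" and i
  proof -
    have "(\<Prod>j<k. (xs ! j) ^ u i j) = (\<Prod>j<k. if j = i then (xs ! i) ^ Suc c else 1)"
      by (rule prod.cong) (auto simp: u_def)
    then show ?thesis using that by simp
  qed
  have "a * (b + (\<Sum>i<k. (xs ! i) ^ Suc c)) = (\<Sum>e\<in>E. w e * (\<Prod>j<k. (xs ! j) ^ e j))" for xs
  proof -
    have "(\<Sum>e\<in>E. w e * (\<Prod>j<k. (xs ! j) ^ e j)) = w (\<lambda>_. 0) + (\<Sum>e\<in>u ` {..<k}. w e * (\<Prod>j<k. (xs ! j) ^ e j))"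
      unfolding E_def using u0 by (subst sum.insert) (auto simp: image_iff, metis)
    also have "(\<Sum>e\<in>u ` {..<k}. w e * (\<Prod>j<k. (xs ! j) ^ e j)) = (\<Sum>i<k. a * (xs ! i) ^ Suc c)"
      by (subst sum.reindex[OF inj]) (auto intro!: sum.cong simp: w_def u0 prod simp del: power_Suc)
    finally show ?thesis by (simp add: w_def distrib_left sum_distrib_left)
  qed
  then show ?thesis unfolding polynomial_fun_def
    by (intro exI[of _ E] exI[of _ w]) (simp add: E_def)
qed

theorem theorem5p3:
  fixes ars :: "nat list" and f :: "trm list \<Rightarrow> trm" and k :: nat
    and ps :: "nat list" and m :: nat
  assumes "SimRec ars k f"
    and "length ps = k"
    and "tiered ars f ps m"
  shows "\<exists>p_f :: nat list \<Rightarrow> nat. polynomial_fun k p_f \<and>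
    (\<exists>M. turing_machine M \<and> {..<4 + length ars} \<subseteq> alphabet M \<and>
      (\<forall>vs \<in> tuples ars k. \<exists>(G :: bool list dag) w.
         dag_represents ars G (f vs) \<and> dag_encoding G w \<and>
         outputs_within M (input_code vs) w (p_f (map tsize vs))))"
proof -
  obtain d where d: "\<forall>vs \<in> tuples ars k. f vs \<in> terms ars \<and> card (subs (f vs)) \<le> (dag_size vs + 2) ^ d"
    using tiered_dag_size[OF assms(3)] assms(2) by blast
  have "signature.computable ars f k"
    using signature.computable_tiered[OF assms(3)] assms(2) by simp
  from signature.main_prog_correct[OF this d] obtain c e where
    run: "\<forall>vs \<in> tuples ars k. \<exists>(G :: bool list dag) s t. dag_represents ars G (f vs) \<and>
      dag_encoding G (s 0) \<and> exec (signature.main_prog ars c) (initial_store (input_code vs)) t s \<and>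
      t \<le> (sum_list (map tsize vs) + 2) ^ e" by (elim exE)
  \<comment> \<open>\<open>Suc e\<close> replaces \<open>e\<close> to make the exponent positive, as
    the explicit monomial form above requires.\<close>
  define p where "p = (\<lambda>xs :: nat list. (k + 1) ^ Suc e * (2 ^ Suc e + (\<Sum>i<k. (xs ! i) ^ Suc e)))"
  obtain M where M: "turing_machine M" "{..<4 + length ars} \<subseteq> alphabet M"
    "\<And>w s t t'. exec (signature.main_prog ars c) (initial_store w) t s \<Longrightarrow> t \<le> t' \<Longrightarrow> outputs_within M w (s 0) t'"
    using prog_machine[of "4 + length ars" "signature.main_prog ars c"] by blast
  have "\<exists>(G :: bool list dag) w. dag_represents ars G (f vs) \<and> dag_encoding G w \<and>
      outputs_within M (input_code vs) w (p (map tsize vs))" if vs: "vs \<in> tuples ars k" for vs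
  proof -
    obtain G :: "bool list dag" and s t where G: "dag_represents ars G (f vs)" "dag_encoding G (s 0)"
      "exec (signature.main_prog ars c) (initial_store (input_code vs)) t s"
      "t \<le> (sum_list (map tsize vs) + 2) ^ e"
      using bspec[OF run vs] by (elim exE conjE)
    have "(sum_list (map tsize vs) + 2) ^ e \<le> (sum_list (map tsize vs) + 2) ^ Suc e"
      by (rule power_increasing) simp_all
    also have "\<dots> \<le> p (map tsize vs)"
      unfolding p_def using sum_power_le[of "map tsize vs" k "Suc e"] vs by (simp add: tuples_def del: power_Suc)
    finally have "t \<le> p (map tsize vs)" using G(4) by linarith
    from M(3)[OF G(3) this] G(1,2) show ?thesis
      by (intro exI[of _ G] exI[of _ "s 0"] conjI)
  qed
  moreover have "polynomial_fun k p" unfolding p_def by (rule polynomial_fun_power_sum)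
  ultimately show ?thesis using M(1,2) by blast
qed

end
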